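(* For every integer $d\geq 3$, every $R\geq 1$, every $p\in(\frac1{d-1},1)$ and every $\alpha\in(0,1)$ there exist $b>0$, a constant $c>0$, and a sequence of regular $(b,d)$-expanders $\mathcal{G}=\mathcal{G}^{(n)}$, with $\mathcal{G}^{(n)}$ having $n$ vertices ($n\to\infty$ along the sequence) and girth at least $R$, such that the random graph $G\sim\mathcal{G}_p$ satisfies \[ \P\big(|V(\mathcal{C}_2(G))|\geq c\, n^{\alpha}\big)\to 1 \quad\text{as } n\to\infty, \] where $\P$ denotes $\mathbb{P}$, the probability with respect to $G$, and $\mathcal{C}_2(G)$ is the second largest connected component of $G$.
   Context: A graph $\mathcal{G}$ is a $(b,d)$-expander if its maximum degree is $d$ and for every $S\subset V(\mathcal{G})$ with $|S|\le |V(\mathcal{G})|/2$ there are at least $b|S|$ edges between $S$ and $V(\mathcal{G})\setminus S$. A regular $(b,d)$-expander is a $(b,d)$-expander that is $d$-regular. The girth is the length of the shortest cycle. For $0<p<1$, $\mathcal{G}_p$ denotes bond percolation on $\mathcal{G}$: the random spanning subgraph of $\mathcal{G}$ in which each edge is present independently with probability $p$. $\mathcal{C}_i(G)$, $i=1,2,\ldots$, denote the connected components of $G$ in decreasing order of their sizes (numbers of vertices). *)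

theory Defs
  imports "HOL-Probability.Probability"
begin

datatype 'v ugraph = UGraph (verts: "'v set") (edges: "'v set set")

definition finite_simple_graph :: "'v ugraph \<Rightarrow> bool" where
  "finite_simple_graph G \<longleftrightarrow>
     finite (verts G) \<and> verts G \<noteq> {} \<and>
     (\<forall>e\<in>edges G. e \<subseteq> verts G \<and> card e = 2)"

definition degree :: "'v ugraph \<Rightarrow> 'v \<Rightarrow> nat" where
  "degree G v = card {e \<in> edges G. v \<in> e}"

definition max_degree :: "'v ugraph \<Rightarrow> nat" where
  "max_degree G = Max (degree G ` verts G)"

definition edges_between :: "'v ugraph \<Rightarrow> 'v set \<Rightarrow> 'v set \<Rightarrow> 'v set set" where
  "edges_between G S T = {e \<in> edges G. \<exists>u\<in>S. \<exists>v\<in>T. e = {u, v}}"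

definition expander :: "real \<Rightarrow> nat \<Rightarrow> 'v ugraph \<Rightarrow> bool" where
  "expander b d G \<longleftrightarrow>
     finite_simple_graph G \<and> max_degree G = d \<and>
     (\<forall>S \<subseteq> verts G. real (card S) \<le> real (card (verts G)) / 2 \<longrightarrow>
        b * real (card S) \<le> real (card (edges_between G S (verts G - S))))"

definition regular_expander :: "real \<Rightarrow> nat \<Rightarrow> 'v ugraph \<Rightarrow> bool" where
  "regular_expander b d G \<longleftrightarrow> expander b d G \<and> (\<forall>v\<in>verts G. degree G v = d)"

text \<open>A cycle is given by the list of its vertices, without repeating the starting vertex;
  its length is the length of that list.\<close>

definition is_cycle :: "'v ugraph \<Rightarrow> 'v list \<Rightarrow> bool" where
  "is_cycle G vs \<longleftrightarrow>
     3 \<le> length vs \<and> distinct vs \<and>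
     (\<forall>i < length vs. {vs ! i, vs ! (Suc i mod length vs)} \<in> edges G)"

text \<open>The infimum makes the girth of an acyclic graph \<open>\<infinity>\<close>.\<close>

definition girth :: "'v ugraph \<Rightarrow> enat" where
  "girth G = (INF vs \<in> {vs. is_cycle G vs}. enat (length vs))"

definition connectivity :: "'v ugraph \<Rightarrow> ('v \<times> 'v) set" where
  "connectivity G = {(u, v). {u, v} \<in> edges G}\<^sup>* \<inter> verts G \<times> verts G"

text \<open>Connected components are represented by their vertex sets.\<close>

definition graph_components :: "'v ugraph \<Rightarrow> 'v set set" where
  "graph_components G = verts G // connectivity G"

text \<open>An enumeration of the components in decreasing order of size, ties being broken
  arbitrarily. The enumeration is 1-based, and \<open>nth_component G i\<close> is empty if there are fewer
  than \<open>i\<close> components.\<close>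

definition ordered_components :: "'v ugraph \<Rightarrow> 'v set list" where
  "ordered_components G =
     (SOME Cs. set Cs = graph_components G \<and> distinct Cs \<and>
        sorted_wrt (\<lambda>A B. card B \<le> card A) Cs)"

definition nth_component :: "'v ugraph \<Rightarrow> nat \<Rightarrow> 'v set" where
  "nth_component G i =
     (let Cs = ordered_components G in if 1 \<le> i \<and> i \<le> length Cs then Cs ! (i - 1) else {})"

definition percolation :: "'v ugraph \<Rightarrow> real \<Rightarrow> 'v ugraph pmf" where
  "percolation G p =
     map_pmf (\<lambda>\<omega>. UGraph (verts G) {e \<in> edges G. \<omega> e})
       (Pi_pmf (edges G) False (\<lambda>_. bernoulli_pmf p))"

end

theory Submission
  imports Defs "HOL-Combinatorics.Permutations"
begin

text \<open>
  The graph consists of two vertex-disjoint parts at the bottom of a forest, each of which has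
  a percolation cluster of linear size, while percolation on the forest is subcritical, so that
  the two clusters stay apart. The forest has to be an expander nevertheless. This is possible
  because expansion needs only that the number of branches doubles after every bounded number
  of steps, and replacing each edge of the forest by a chain of \<open>l\<close> copies of a fixed finite
  graph makes the probability of passing from one level to the next smaller than any given
  constant. A bottom of \<open>2 * m\<close> sites and a height \<open>h\<close> give about \<open>m * 2 ^ h\<close> vertices. If
  \<open>m = 2 ^ (q * h)\<close>, then \<open>m\<close> is of order \<open>n powr (q / (q + 1))\<close>, and the expected
  number of open paths from the bottom to the top tends to \<open>0\<close> once \<open>l\<close> is large. The sites at the top are
  joined by permutations that make the top an expander, and from the top the expansion is
  inherited by the whole forest: a set with few elements at the top has at least twice as many
  children as elements outside the top (\<open>forest_expansion\<close>).

  Every site carries the same finite piece, and all sites are joined through ports of that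
  piece. Take the ball of radius \<open>r\<close> in the \<open>d\<close>-regular tree whose edges are coloured by \<open>d\<close> colours.
  Each colour acts on the ball as an involution, and the Cayley graph of these involutions is
  \<open>d\<close>-regular and has girth larger than \<open>r\<close>, because a reduced word of length at most \<open>r\<close>
  moves the centre of the ball. Let \<open>B\<close> be the Cayley graph for a fixed radius \<open>g0\<close> and let
  one of its edges be marked. A piece is a connected cover of \<open>B\<close> minus the marked edge;
  its ports are the vertices above the ends of that edge. However ports of the one kind are
  matched with ports of the other kind, the outcome is a cover of \<open>B\<close>. It is
  therefore \<open>d\<close>-regular and has girth at least that of \<open>B\<close> (\<open>nat_graph\<close>). This leaves complete
  freedom in the choice of the matching.

  For the large clusters, the piece is taken to be locally a tree up to a huge radius. Removing the
  ports slows down the growth of the tree, but ports are rare if the girth of \<open>B\<close> is large,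
  so that the growth rate times \<open>p\<close> still exceeds \<open>1\<close>. A weighted second moment estimate shows
  that the cluster of a port contains at least \<open>K\<close> further ports with a probability that does
  not depend on \<open>K\<close> (\<open>piece_percolation\<close>). Now match the ports of \<open>m\<close> pieces by a
  random permutation. If no linear cluster arises, then the clusters with at
  least \<open>K\<close> ports split into two groups with linearly many ports each and no open
  edge between them. There are at most \<open>2 powr (w / K)\<close> ways to split the \<open>w\<close> ports, and
  each of them has probability at most \<open>exp (- c * w)\<close> with \<open>c\<close> independent of \<open>K\<close>, so that a large
  \<open>K\<close> suffices (\<open>random_gluing\<close>). Averaging over the permutation yields one permutation that
  works for most percolation configurations (\<open>random_wiring\<close>).
\<close>

section \<open>Bond configurations on a finite edge set\<close>

text \<open>The expectation of \<open>f\<close> applied to the set of open edges. As a finite sum it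
  splits, restricts and transports along injections by plain inductions on the edge set.\<close>

definition bond_mean :: "real \<Rightarrow> 'e set \<Rightarrow> ('e set \<Rightarrow> real) \<Rightarrow> real" where
  "bond_mean p E f = (\<Sum>H\<in>Pow E. p ^ card H * (1 - p) ^ card (E - H) * f H)"

lemma bond_mean_empty [simp]: "bond_mean p {} f = f {}"
  by (simp add: bond_mean_def)

lemma bond_mean_insert:
  assumes "finite E" "e \<notin> E"
  shows "bond_mean p (insert e E) f =
    (1 - p) * bond_mean p E f + p * bond_mean p E (\<lambda>H. f (insert e H))"
proof -
  let ?g = "\<lambda>H. p ^ card H * (1 - p) ^ card (insert e E - H) * f H"
  have disj: "Pow E \<inter> insert e ` Pow E = {}" using assms by auto
  have inj: "inj_on (insert e) (Pow E)"
    using assms by (auto simp: inj_on_def)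
  have "bond_mean p (insert e E) f = sum ?g (Pow E) + sum ?g (insert e ` Pow E)"
    unfolding bond_mean_def Pow_insert using assms disj by (intro sum.union_disjoint) auto
  also have "sum ?g (Pow E) = (1 - p) * bond_mean p E f"
    unfolding bond_mean_def sum_distrib_left
  proof (intro sum.cong refl)
    fix H assume "H \<in> Pow E"
    hence "insert e E - H = insert e (E - H)" "e \<notin> E - H" "finite (E - H)" using assms by auto
    thus "?g H = (1 - p) * (p ^ card H * (1 - p) ^ card (E - H) * f H)" by simp
  qed
  also have "sum ?g (insert e ` Pow E) = p * bond_mean p E (\<lambda>H. f (insert e H))"
    unfolding bond_mean_def sum_distrib_left sum.reindex[OF inj] o_def
  proof (intro sum.cong refl)
    fix H assume "H \<in> Pow E"
    hence "insert e E - insert e H = E - H" "e \<notin> H" "finite H" using assms finite_subset by auto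
    thus "?g (insert e H) = p * (p ^ card H * (1 - p) ^ card (E - H) * f (insert e H))" by simp
  qed
  finally show ?thesis .
qed

lemma bond_mean_cong:
  assumes "\<And>H. H \<subseteq> E \<Longrightarrow> f H = g H"
  shows "bond_mean p E f = bond_mean p E g"
  unfolding bond_mean_def using assms by (intro sum.cong) auto

lemma bond_mean_mono:
  assumes "0 \<le> p" "p \<le> 1" "\<And>H. H \<subseteq> E \<Longrightarrow> f H \<le> g H"
  shows "bond_mean p E f \<le> bond_mean p E g"
  unfolding bond_mean_def using assms by (intro sum_mono mult_left_mono) auto

lemma bond_mean_cmult: "bond_mean p E (\<lambda>H. c * f H) = c * bond_mean p E f"
  unfolding bond_mean_def sum_distrib_left by (intro sum.cong refl) (simp add: mult_ac)

lemma bond_mean_multc: "bond_mean p E (\<lambda>H. f H * c) = bond_mean p E f * c"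
  using bond_mean_cmult[of p E c f] by (simp add: mult.commute)

lemma bond_mean_add: "bond_mean p E (\<lambda>H. f H + g H) = bond_mean p E f + bond_mean p E g"
  unfolding bond_mean_def by (simp add: sum.distrib algebra_simps)

lemma bond_mean_sum: "bond_mean p E (\<lambda>H. \<Sum>i\<in>I. f i H) = (\<Sum>i\<in>I. bond_mean p E (f i))"
  unfolding bond_mean_def sum_distrib_left by (rule sum.swap)

lemma bond_mean_const [simp]: "finite E \<Longrightarrow> bond_mean p E (\<lambda>_. c) = c"
  by (induction E rule: finite_induct) (auto simp: bond_mean_insert algebra_simps)

lemma bond_mean_nonneg:
  assumes "0 \<le> p" "p \<le> 1" "\<And>H. H \<subseteq> E \<Longrightarrow> 0 \<le> f H"
  shows "0 \<le> bond_mean p E f"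
  unfolding bond_mean_def using assms by (intro sum_nonneg mult_nonneg_nonneg) auto

lemma bond_mean_union:
  assumes "finite A" "finite B" "A \<inter> B = {}"
  shows "bond_mean p (A \<union> B) f = bond_mean p A (\<lambda>S. bond_mean p B (\<lambda>T. f (S \<union> T)))"
  using assms(2,3)
proof (induction B arbitrary: f rule: finite_induct)
  case (insert e B)
  have "bond_mean p (A \<union> insert e B) f =
     (1 - p) * bond_mean p (A \<union> B) f + p * bond_mean p (A \<union> B) (\<lambda>H. f (insert e H))"
    using insert assms(1) by (simp add: bond_mean_insert)
  then show ?case
    using insert assms(1) by (simp add: bond_mean_insert bond_mean_add bond_mean_cmult)
qed simp

lemma bond_mean_image:
  assumes "finite E" "inj_on h E"
  shows "bond_mean p (h ` E) f = bond_mean p E (\<lambda>H. f (h ` H))"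
  using assms
proof (induction E arbitrary: f rule: finite_induct)
  case (insert e E)
  then show ?case by (simp add: bond_mean_insert)
qed simp

lemma bond_mean_restrict:
  assumes "finite E" "A \<subseteq> E"
  shows "bond_mean p E (\<lambda>H. f (H \<inter> A)) = bond_mean p A f"
proof -
  have E: "E = A \<union> (E - A)" using assms by auto
  have fin: "finite A" "finite (E - A)" using assms finite_subset by auto
  have "bond_mean p E (\<lambda>H. f (H \<inter> A)) =
      bond_mean p A (\<lambda>S. bond_mean p (E - A) (\<lambda>T. f ((S \<union> T) \<inter> A)))"
    by (subst E, rule bond_mean_union) (use fin in auto)
  also have "\<dots> = bond_mean p A (\<lambda>S. bond_mean p (E - A) (\<lambda>T. f S))"
  proof (intro bond_mean_cong)
    fix S T assume "S \<subseteq> A" "T \<subseteq> E - A"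
    hence "(S \<union> T) \<inter> A = S" by auto
    thus "f ((S \<union> T) \<inter> A) = f S" by simp
  qed
  finally show ?thesis using fin by simp
qed

lemma bond_mean_indep:
  assumes "finite E" "A \<subseteq> E" "B \<subseteq> E" "A \<inter> B = {}"
  shows "bond_mean p E (\<lambda>H. f (H \<inter> A) * g (H \<inter> B)) = bond_mean p A f * bond_mean p B g"
proof -
  have fin: "finite A" "finite B" using assms(1-3) by (auto intro: finite_subset)
  have "bond_mean p E (\<lambda>H. f (H \<inter> A) * g (H \<inter> B)) =
      bond_mean p E (\<lambda>H. (\<lambda>H. f (H \<inter> A) * g (H \<inter> B)) (H \<inter> (A \<union> B)))"
    by (intro bond_mean_cong) (simp add: Int_assoc Int_absorb1 Int_absorb2)
  also have "\<dots> = bond_mean p (A \<union> B) (\<lambda>H. f (H \<inter> A) * g (H \<inter> B))"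
    by (rule bond_mean_restrict) (use assms in auto)
  also have "\<dots> = bond_mean p A (\<lambda>S. bond_mean p B (\<lambda>T. f ((S \<union> T) \<inter> A) * g ((S \<union> T) \<inter> B)))"
    by (rule bond_mean_union) (use assms fin in auto)
  also have "\<dots> = bond_mean p A (\<lambda>S. bond_mean p B (\<lambda>T. f S * g T))"
  proof (intro bond_mean_cong)
    fix S T assume "S \<subseteq> A" "T \<subseteq> B"
    hence "(S \<union> T) \<inter> A = S" "(S \<union> T) \<inter> B = T" using assms(4) by auto
    thus "f ((S \<union> T) \<inter> A) * g ((S \<union> T) \<inter> B) = f S * g T" by simp
  qed
  finally show ?thesis by (simp add: bond_mean_cmult bond_mean_multc)
qed

text \<open>The generating function of the number of open edges in \<open>A\<close>. It evaluates to
  the probabilities of all-closed events at \<open>x = 0\<close>, and it averages the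
  bound of \<open>card_permutations_into\<close> over the open edges in one step.\<close>

lemma bond_mean_power_card:
  assumes "finite E" "A \<subseteq> E"
  shows "bond_mean p E (\<lambda>H. x ^ card (H \<inter> A)) = (1 - p + p * x) ^ card A"
proof -
  have finA: "finite A" using assms finite_subset by auto
  have "bond_mean p E (\<lambda>H. x ^ card (H \<inter> A)) = bond_mean p A (\<lambda>H. x ^ card H)"
    by (rule bond_mean_restrict) (use assms in auto)
  also have "\<dots> = (1 - p + p * x) ^ card A"
    using finA
  proof (induction A rule: finite_induct)
    case (insert e A)
    have "bond_mean p A (\<lambda>H. x ^ card (insert e H)) = bond_mean p A (\<lambda>H. x * x ^ card H)"
    proof (intro bond_mean_cong)
      fix H assume "H \<subseteq> A"
      hence "e \<notin> H" "finite H" using insert finite_subset by auto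
      thus "x ^ card (insert e H) = x * x ^ card H" by simp
    qed
    then show ?case using insert
      by (simp add: bond_mean_insert bond_mean_cmult algebra_simps)
  qed simp
  finally show ?thesis .
qed

lemma bond_mean_all_open:
  assumes "finite E" "A \<subseteq> E"
  shows "bond_mean p E (\<lambda>H. of_bool (A \<subseteq> H)) = p ^ card A"
proof -
  have finA: "finite A" using assms finite_subset by auto
  have "bond_mean p E (\<lambda>H. of_bool (A \<subseteq> H)) = bond_mean p E (\<lambda>H. (\<lambda>H. of_bool (A \<subseteq> H)) (H \<inter> A))"
    by (intro bond_mean_cong) auto
  also have "\<dots> = bond_mean p A (\<lambda>H. of_bool (A \<subseteq> H))"
    by (rule bond_mean_restrict) (use assms in auto)
  also have "\<dots> = (\<Sum>H\<in>Pow A. if H = A then p ^ card A else 0)"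
    unfolding bond_mean_def by (intro sum.cong) auto
  also have "\<dots> = p ^ card A" using finA by simp
  finally show ?thesis .
qed

lemma bond_mean_all_closed:
  assumes "finite E" "A \<subseteq> E"
  shows "bond_mean p E (\<lambda>H. of_bool (H \<inter> A = {})) = (1 - p) ^ card A"
proof -
  have finA: "finite A" using assms finite_subset by auto
  have "bond_mean p E (\<lambda>H. of_bool (H \<inter> A = {})) = bond_mean p E (\<lambda>H. 0 ^ card (H \<inter> A))"
    by (intro bond_mean_cong) (use finA in \<open>auto simp: power_0_left\<close>)
  thus ?thesis using bond_mean_power_card[OF assms, of p 0] by simp
qed

lemma bond_mean_exists_le:
  assumes "0 \<le> p" "p \<le> 1" "finite I" "\<And>H. H \<subseteq> E \<Longrightarrow> Q H \<Longrightarrow> \<exists>i\<in>I. R i H"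
  shows "bond_mean p E (\<lambda>H. of_bool (Q H)) \<le> (\<Sum>i\<in>I. bond_mean p E (\<lambda>H. of_bool (R i H)))"
proof -
  have "bond_mean p E (\<lambda>H. of_bool (Q H)) \<le> bond_mean p E (\<lambda>H. \<Sum>i\<in>I. of_bool (R i H))"
  proof (intro bond_mean_mono assms(1,2))
    fix H assume H: "H \<subseteq> E"
    show "(of_bool (Q H) :: real) \<le> (\<Sum>i\<in>I. of_bool (R i H))"
    proof (cases "Q H")
      case True
      then obtain i where i: "i \<in> I" "R i H" using assms(4)[OF H] by blast
      have "(\<Sum>i\<in>{i}. of_bool (R i H) :: real) \<le> (\<Sum>i\<in>I. of_bool (R i H))"
        using i assms(3) by (intro sum_mono2) auto
      then show ?thesis using True i by simp
    qed (simp add: sum_nonneg)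
  qed
  thus ?thesis by (simp add: bond_mean_sum)
qed

lemma prob_Pi_pmf_bernoulli:
  assumes "finite E" "0 \<le> p" "p \<le> 1"
  shows "measure_pmf.prob (Pi_pmf E False (\<lambda>_. bernoulli_pmf p)) {\<omega>. Q {e \<in> E. \<omega> e}} =
    bond_mean p E (\<lambda>H. of_bool (Q H))"
  using assms(1)
proof (induction E arbitrary: Q rule: finite_induct)
  case empty
  then show ?case by (simp add: indicator_def)
next
  case (insert e E)
  let ?P = "Pi_pmf E False (\<lambda>_. bernoulli_pmf p)"
  have set_off: "{a. (a = e \<or> a \<in> E) \<and> (fun_upd \<omega> e b) a} = (if b then insert e {a \<in> E. \<omega> a} else {a \<in> E. \<omega> a})" for \<omega> b
    using insert(2) by auto
  have "Pi_pmf (insert e E) False (\<lambda>_. bernoulli_pmf p) =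
      bind_pmf (bernoulli_pmf p) (\<lambda>b. map_pmf (\<lambda>\<omega>. fun_upd \<omega> e b) ?P)"
    using insert by (simp add: Pi_pmf_insert' map_pmf_def bind_assoc_pmf bind_return_pmf)
  hence "measure_pmf.prob (Pi_pmf (insert e E) False (\<lambda>_. bernoulli_pmf p)) {\<omega>. Q {a \<in> insert e E. \<omega> a}} =
    measure_pmf.expectation (bernoulli_pmf p) (\<lambda>b. measure_pmf.prob (map_pmf (\<lambda>\<omega>. fun_upd \<omega> e b) ?P)
       {\<omega>. Q {a \<in> insert e E. \<omega> a}})"
    by (simp add: measure_pmf_bind measure_pmf.measure_bind[where N="count_space UNIV"] measure_pmf_in_subprob_algebra)
  also have "\<dots> = p * measure_pmf.prob ?P {\<omega>. Q (insert e {a \<in> E. \<omega> a})} +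
      (1 - p) * measure_pmf.prob ?P {\<omega>. Q {a \<in> E. \<omega> a}}"
    using assms by (simp add: vimage_def set_off del: fun_upd_apply)
  finally show ?case using insert
    by (simp add: bond_mean_insert insert.IH[of Q] insert.IH[of "\<lambda>H. Q (insert e H)"])
qed

lemma prob_percolation:
  assumes "finite (edges G)" "0 \<le> p" "p \<le> 1"
  shows "measure_pmf.prob (percolation G p) {H. Q H} =
    bond_mean p (edges G) (\<lambda>H. of_bool (Q (UGraph (verts G) H)))"
  using prob_Pi_pmf_bernoulli[OF assms, of "\<lambda>H. Q (UGraph (verts G) H)"]
  by (simp add: percolation_def vimage_def)

section \<open>Counting permutations; expanding permutations\<close>

text \<open>Composition with the transposition of \<open>x\<close> and \<open>y\<close> shows that every \<open>y\<close> outside \<open>A\<close> is sent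
  into \<open>B\<close> by equally many of the permutations with \<open>\<sigma> ` A \<subseteq> B\<close>. Each such permutation sends
  exactly \<open>card B - card A\<close> points outside \<open>A\<close> into \<open>B\<close>.\<close>

lemma card_permutations_into_step:
  assumes "finite W" "A \<subseteq> W" "B \<subseteq> W" "x \<in> W - A"
  shows "(card W - card A) * card {\<sigma>. \<sigma> permutes W \<and> \<sigma> ` insert x A \<subseteq> B} =
         (card B - card A) * card {\<sigma>. \<sigma> permutes W \<and> \<sigma> ` A \<subseteq> B}"
proof -
  define N where "N = {\<sigma>. \<sigma> permutes W \<and> \<sigma> ` A \<subseteq> B}"
  have finN: "finite N" unfolding N_def using finite_permutations[OF assms(1)] by simp
  have fin: "finite A" "finite B" using assms finite_subset by blast+
  have swap: "card {\<sigma>\<in>N. \<sigma> x \<in> B} = card {\<sigma>\<in>N. \<sigma> y \<in> B}" if y: "y \<in> W - A" for y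
  proof -
    let ?f = "\<lambda>\<sigma>. \<sigma> \<circ> Transposition.transpose x y"
    have fixA: "Transposition.transpose x y a = a" if "a \<in> A" for a
      using that y assms(4) by (intro transpose_apply_other) auto
    have inN: "?f \<sigma> \<in> N" if "\<sigma> \<in> N" for \<sigma>
    proof -
      have "?f \<sigma> permutes W"
        using that y assms(4) by (intro permutes_compose permutes_swap_id) (auto simp: N_def)
      moreover have "?f \<sigma> ` A = \<sigma> ` A" using fixA by (intro image_cong) simp_all
      ultimately show ?thesis using that by (simp add: N_def)
    qed
    have "bij_betw ?f {\<sigma>\<in>N. \<sigma> x \<in> B} {\<sigma>\<in>N. \<sigma> y \<in> B}"
    proof (rule bij_betwI[where g = ?f])
      show "?f \<in> {\<sigma>\<in>N. \<sigma> x \<in> B} \<rightarrow> {\<sigma>\<in>N. \<sigma> y \<in> B}"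
        "?f \<in> {\<sigma>\<in>N. \<sigma> y \<in> B} \<rightarrow> {\<sigma>\<in>N. \<sigma> x \<in> B}"
        by (intro Pi_I, simp only: mem_Collect_eq inN, simp)+
    qed (simp_all add: comp_assoc)
    thus ?thesis by (rule bij_betw_same_card)
  qed
  have "(card W - card A) * card {\<sigma>\<in>N. \<sigma> x \<in> B} = (\<Sum>y\<in>W - A. card {\<sigma>\<in>N. \<sigma> y \<in> B})"
  proof -
    have "(\<Sum>y\<in>W - A. card {\<sigma>\<in>N. \<sigma> y \<in> B}) = (\<Sum>y\<in>W - A. card {\<sigma>\<in>N. \<sigma> x \<in> B})"
      by (rule sum.cong[OF refl]) (rule swap[symmetric])
    thus ?thesis using fin assms(2) by (simp add: card_Diff_subset)
  qed
  also have "\<dots> = (\<Sum>\<sigma>\<in>N. card B - card A)"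
  proof (rule sum_multicount_gen, goal_cases)
    case 3
    show ?case
    proof
    fix \<sigma> assume "\<sigma> \<in> N"
    hence \<sigma>: "\<sigma> permutes W" "\<sigma> ` A \<subseteq> B" by (auto simp: N_def)
    have inj: "inj \<sigma>" using \<sigma>(1) by (rule permutes_inj)
    have "\<sigma> ` {y\<in>W - A. \<sigma> y \<in> B} = B - \<sigma> ` A"
    proof
      show "B - \<sigma> ` A \<subseteq> \<sigma> ` {y\<in>W - A. \<sigma> y \<in> B}"
      proof
        fix b assume b: "b \<in> B - \<sigma> ` A"
        hence "b \<in> \<sigma> ` W" using permutes_image[OF \<sigma>(1)] assms(3) by auto
        thus "b \<in> \<sigma> ` {y\<in>W - A. \<sigma> y \<in> B}" using b by auto
      qed
      show "\<sigma> ` {y\<in>W - A. \<sigma> y \<in> B} \<subseteq> B - \<sigma> ` A"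
        using inj_image_mem_iff[OF inj] by auto
    qed
    moreover have "card (\<sigma> ` {y\<in>W - A. \<sigma> y \<in> B}) = card {y\<in>W - A. \<sigma> y \<in> B}"
      using inj by (intro card_image) (rule inj_on_subset, auto)
    moreover have "card (B - \<sigma> ` A) = card B - card A"
      using \<sigma>(2) fin inj by (simp add: card_Diff_subset card_image inj_on_subset)
    ultimately show "card {y\<in>W - A. \<sigma> y \<in> B} = card B - card A" by simp
    qed
  qed (use assms(1) finN in auto)
  finally have "(card W - card A) * card {\<sigma>\<in>N. \<sigma> x \<in> B} = (card B - card A) * card N"
    by simp
  moreover have "{\<sigma>\<in>N. \<sigma> x \<in> B} = {\<sigma>. \<sigma> permutes W \<and> \<sigma> ` insert x A \<subseteq> B}"
    by (auto simp: N_def)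
  ultimately show ?thesis by (simp add: N_def)
qed

lemma card_permutations_into:
  assumes "finite W" "W \<noteq> {}" "A \<subseteq> W" "B \<subseteq> W"
  shows "real (card {\<sigma>. \<sigma> permutes W \<and> \<sigma> ` A \<subseteq> B}) \<le> fact (card W) * (card B / card W) ^ card A"
proof -
  have "finite A" using assms finite_subset by blast
  thus ?thesis using assms(3)
  proof (induction A rule: finite_induct)
    case empty
    then show ?case using card_permutations[OF refl assms(1)] by simp
  next
    case (insert x A)
    let ?w = "real (card W)" and ?a = "real (card A)" and ?b = "real (card B)"
    let ?N = "real (card {\<sigma>. \<sigma> permutes W \<and> \<sigma> ` A \<subseteq> B})"
    let ?N' = "real (card {\<sigma>. \<sigma> permutes W \<and> \<sigma> ` insert x A \<subseteq> B})"
    have lt: "card A < card W" using insert assms(1) by (intro psubset_card_mono) auto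
    have le: "card B \<le> card W" using assms by (intro card_mono)
    have eq: "(?w - ?a) * ?N' = real (card B - card A) * ?N"
    proof -
      have "real ((card W - card A) * card {\<sigma>. \<sigma> permutes W \<and> \<sigma> ` insert x A \<subseteq> B}) =
         real ((card B - card A) * card {\<sigma>. \<sigma> permutes W \<and> \<sigma> ` A \<subseteq> B})"
        using card_permutations_into_step[of W A B x] assms insert by (intro arg_cong[where f=real]) auto
      thus ?thesis using lt by (simp add: of_nat_diff)
    qed
    have "real (card B - card A) * ?w \<le> ?b * (?w - ?a)"
    proof (cases "card A \<le> card B")
      case True
      have "?b * ?a \<le> ?w * ?a" using le by (intro mult_right_mono) auto
      then show ?thesis using True by (simp add: of_nat_diff algebra_simps)
    next
      case False
      then show ?thesis using lt by simp
    qed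
    hence r: "real (card B - card A) \<le> ?b / ?w * (?w - ?a)"
      using lt by (simp add: field_simps)
    have "(?w - ?a) * ?N' \<le> ?b / ?w * (?w - ?a) * ?N"
      unfolding eq using r by (intro mult_right_mono) auto
    hence "(?w - ?a) * ?N' \<le> (?w - ?a) * (?b / ?w * ?N)" by (simp only: mult_ac)
    hence "?N' \<le> ?b / ?w * ?N" using lt by (subst (asm) mult_le_cancel_left_pos) auto
    also have "\<dots> \<le> ?b / ?w * (fact (card W) * (?b / ?w) ^ card A)"
      using insert by (intro mult_left_mono) auto
    finally show ?case using insert by (simp add: mult_ac)
  qed
qed

text \<open>The binomial is one term of the expansion of \<open>(1 + x) ^ n\<close> at \<open>x = k / n\<close>, divided by \<open>x ^ k\<close>.\<close>

lemma binomial_le_exp_pow: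
  assumes "0 < k" "k \<le> n"
  shows "real (n choose k) \<le> (3 * n / k) ^ k"
proof -
  let ?x = "real k / real n"
  have x: "?x > 0" using assms by simp
  have "real (n choose k) * ?x ^ k \<le> (\<Sum>i\<le>n. real (n choose i) * ?x ^ i * 1 ^ (n - i))"
    using x assms by (subst sum.remove[of _ k]) (auto intro!: sum_nonneg)
  also have "\<dots> = (?x + 1) ^ n" by (simp add: binomial_ring)
  also have "\<dots> \<le> exp ?x ^ n" using x exp_ge_add_one_self[of ?x] by (intro power_mono) (auto simp: add.commute)
  also have "\<dots> = exp (real n * ?x)" by (simp only: exp_of_nat_mult)
  also have "\<dots> = exp (real k)" using assms by simp
  also have "\<dots> = exp 1 ^ k" by (simp flip: exp_of_nat_mult)
  also have "\<dots> \<le> 3 ^ k" using exp_le by (intro power_mono) auto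
  finally have "real (n choose k) \<le> 3 ^ k / ?x ^ k"
    using x by (subst pos_le_divide_eq) simp_all
  also have "\<dots> = (3 * n / k) ^ k" by (simp add: power_divide power_mult_distrib)
  finally show ?thesis by simp
qed

text \<open>The expected number of pairs \<open>(S, T)\<close> of sizes \<open>s\<close> and \<open>t\<close> such that all of \<open>21\<close> random
  permutations map \<open>S\<close> into \<open>T\<close>. Both binomials are powers of \<open>1 / x\<close> with \<open>x = t / M \<le> 3 / 4\<close> and together
  contribute the exponent \<open>3 * s\<close>; the remaining \<open>18 * s\<close> factors \<open>x\<close> beat the constants.\<close>

lemma expander_union_bound:
  fixes M s t :: nat
  assumes "1 \<le> s" "2 * s \<le> M" "t = s + s div 2"
  shows "real (M choose s) * real (M choose t) * (t / M) ^ (s * 21) \<le> (1/4) ^ s"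
proof -
  define x where "x = real t / real M"
  have t: "2 * t \<le> 3 * s" "4 * t \<le> 3 * M" "s \<le> t" "0 < t" "t \<le> M" using assms by auto
  hence M: "0 < M" by simp
  have "4 * real t \<le> 3 * real M" using t by linarith
  hence x: "0 < x" "x \<le> 3/4" using t M by (auto simp: x_def field_simps)
  have c1: "real (M choose t) \<le> (3 / x) ^ (2 * s)"
  proof -
    have "real (M choose t) \<le> (3 / x) ^ t"
      using binomial_le_exp_pow[of t M] t by (simp add: x_def)
    also have "\<dots> \<le> (3 / x) ^ (2 * s)"
      using x t by (intro power_increasing) (auto simp: field_simps)
    finally show ?thesis .
  qed
  have c2: "real (M choose s) \<le> (9 / (2 * x)) ^ s"
  proof -
    have "real (M choose s) \<le> (3 * M / s) ^ s"
      using binomial_le_exp_pow[of s M] assms by simp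
    also have "\<dots> \<le> (9 / (2 * x)) ^ s"
    proof (intro power_mono)
      have "2 * real t \<le> 3 * real s" using t by linarith
      thus "real (3 * M) / real s \<le> 9 / (2 * x)" using t M assms by (simp add: x_def field_simps)
    qed simp
    finally show ?thesis .
  qed
  have "real (M choose s) * real (M choose t) * x ^ (s * 21) \<le>
      (9 / (2 * x)) ^ s * (3 / x) ^ (2 * s) * x ^ (s * 21)"
    using c1 c2 x by (intro mult_mono) auto
  also have "\<dots> = ((9 / (2 * x)) * (3 / x)^2 * x ^ 21) ^ s"
    using power_mult[of "3 / x" 2 s] power_mult[of x 21 s]
    by (simp only: power_mult_distrib mult.commute[of s 21])
  also have "(9 / (2 * x)) * (3 / x)^2 * x ^ 21 = 81/2 * x ^ 18"
    using x by (simp add: field_simps power2_eq_square eval_nat_numeral)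
  also have "(81/2 * x ^ 18) ^ s \<le> (1/4) ^ s"
  proof (intro power_mono)
    have "x ^ 18 \<le> (3/4) ^ 18" using x by (intro power_mono) auto
    also have "\<dots> \<le> 1/162" by (simp add: power_divide)
    finally show "81/2 * x ^ 18 \<le> 1/4" by simp
  qed (use x in auto)
  finally show ?thesis by (simp add: x_def)
qed

text \<open>The union bound over all small sets that fail to expand. If \<open>S\<close> had fewer than \<open>card S / 2\<close>
  outgoing pairs, then \<open>S\<close> together with all its images would fit into a set of size
  \<open>card S + card S div 2\<close>.\<close>

theorem expanding_permutations_exist:
  fixes M :: nat
  obtains \<pi> :: "nat \<Rightarrow> nat \<Rightarrow> nat" where
    "\<And>j. j < 21 \<Longrightarrow> \<pi> j permutes {..<M}"
    "\<And>S. S \<subseteq> {..<M} \<Longrightarrow> 2 * card S \<le> M \<Longrightarrow>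
       card S \<le> 2 * card {(i, j). i \<in> S \<and> j < 21 \<and> \<pi> j i \<notin> S}"
proof (cases "M = 0")
  case True
  show ?thesis by (rule that[of "\<lambda>_. id"]) (use True in \<open>auto simp: permutes_id\<close>)
next
  case False
  define P where "P = {\<sigma>. \<sigma> permutes {..<M}}"
  define all where "all = ({..<21::nat} \<rightarrow>\<^sub>E P)"
  define bad where "bad S T = ({..<21::nat} \<rightarrow>\<^sub>E {\<sigma>. \<sigma> permutes {..<M} \<and> \<sigma> ` S \<subseteq> T})" for S T :: "nat set"
  define sub where "sub s = {S. S \<subseteq> {..<M} \<and> card S = s}" for s
  define t where "t s = s + s div 2" for s :: nat
  define Bad where "Bad = (\<Union>s\<in>{1..M div 2}. \<Union>S\<in>sub s. \<Union>T\<in>sub (t s). bad S T)"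
  have cardP: "card P = fact M" "finite P"
    unfolding P_def using card_permutations[of "{..<M}"] finite_permutations[of "{..<M}"] by auto
  have card_all: "real (card all) = fact M ^ 21" by (simp add: all_def card_PiE cardP)
  have fin_all: "finite all" by (simp add: all_def finite_PiE cardP)
  have sub: "card (sub s) = M choose s" "finite (sub s)" for s
    unfolding sub_def using n_subsets[of "{..<M}" s] by auto
  have card_bad: "real (card (bad S T)) \<le> (fact M * (t s / M) ^ s) ^ 21"
    if "S \<in> sub s" "T \<in> sub (t s)" for S T s
  proof -
    have "real (card {\<sigma>. \<sigma> permutes {..<M} \<and> \<sigma> ` S \<subseteq> T}) \<le> fact M * (t s / M) ^ s"
      using card_permutations_into[of "{..<M}" S T] that False by (auto simp: sub_def)
    hence "real (card {\<sigma>. \<sigma> permutes {..<M} \<and> \<sigma> ` S \<subseteq> T}) ^ 21 \<le> (fact M * (t s / M) ^ s) ^ 21"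
      by (intro power_mono) auto
    thus ?thesis by (simp add: bad_def card_PiE)
  qed
  have "real (card Bad) \<le> (\<Sum>s\<in>{1..M div 2}. real (card (\<Union>S\<in>sub s. \<Union>T\<in>sub (t s). bad S T)))"
    unfolding Bad_def by (subst of_nat_sum[symmetric], subst of_nat_le_iff) (rule card_UN_le, simp)
  also have "\<dots> \<le> (\<Sum>s\<in>{1..M div 2}. \<Sum>S\<in>sub s. \<Sum>T\<in>sub (t s). real (card (bad S T)))"
  proof (rule sum_mono)
    fix s
    have "card (\<Union>S\<in>sub s. \<Union>T\<in>sub (t s). bad S T) \<le> (\<Sum>S\<in>sub s. card (\<Union>T\<in>sub (t s). bad S T))"
      by (intro card_UN_le sub)
    also have "\<dots> \<le> (\<Sum>S\<in>sub s. \<Sum>T\<in>sub (t s). card (bad S T))"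
      by (intro sum_mono card_UN_le sub)
    finally show "real (card (\<Union>S\<in>sub s. \<Union>T\<in>sub (t s). bad S T)) \<le>
        (\<Sum>S\<in>sub s. \<Sum>T\<in>sub (t s). real (card (bad S T)))"
      by (subst (asm) of_nat_le_iff[where ?'a = real, symmetric]) simp
  qed
  also have "\<dots> \<le> (\<Sum>s\<in>{1..M div 2}. fact M ^ 21 * (1/4) ^ s)"
  proof (rule sum_mono)
    fix s assume s: "s \<in> {1..M div 2}"
    have "(\<Sum>S\<in>sub s. \<Sum>T\<in>sub (t s). real (card (bad S T))) \<le>
        (\<Sum>S\<in>sub s. \<Sum>T\<in>sub (t s). (fact M * (t s / M) ^ s) ^ 21)"
      by (intro sum_mono card_bad)
    also have "\<dots> = fact M ^ 21 * (real (M choose s) * real (M choose t s) * (t s / M) ^ (s * 21))"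
      by (simp add: sub power_mult_distrib power_mult)
    also have "\<dots> \<le> fact M ^ 21 * (1/4) ^ s"
      using expander_union_bound[of s M "t s"] s by (intro mult_left_mono) (auto simp: t_def)
    finally show "(\<Sum>S\<in>sub s. \<Sum>T\<in>sub (t s). real (card (bad S T))) \<le> fact M ^ 21 * (1/4) ^ s" .
  qed
  also have "\<dots> = fact M ^ 21 * (\<Sum>s\<in>{1..M div 2}. (1/4) ^ s)" by (simp add: sum_distrib_left)
  also have "(\<Sum>s\<in>{1..M div 2}. (1/4::real) ^ s) < 1"
  proof -
    have eq: "(\<Sum>s\<in>{1..n}. (1/4::real) ^ s) = (1 - (1/4) ^ n) / 3" for n
      by (induction n) (simp_all add: diff_divide_distrib)
    have aux: "(1 - y) / 3 < 1" if "0 < y" for y :: real using that by simp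
    show ?thesis unfolding eq by (rule aux) simp
  qed
  finally have "real (card Bad) < real (card all)" by (simp add: card_all)
  hence "\<not> all \<subseteq> Bad"
  proof (intro notI)
    assume lt: "real (card Bad) < real (card all)" and sub': "all \<subseteq> Bad"
    have "Bad \<subseteq> all" unfolding Bad_def bad_def all_def P_def by (auto simp: PiE_iff)
    hence "finite Bad" using fin_all finite_subset by blast
    thus False using card_mono[OF _ sub'] lt by simp
  qed
  then obtain \<pi> where \<pi>: "\<pi> \<in> all" "\<pi> \<notin> Bad" by blast
  show ?thesis
  proof (rule that[of \<pi>])
    show perm: "\<pi> j permutes {..<M}" if "j < 21" for j
      using \<pi>(1) that by (auto simp: all_def P_def PiE_iff)
    fix S :: "nat set" assume S: "S \<subseteq> {..<M}" "2 * card S \<le> M"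
    have finS: "finite S" using S finite_subset by blast
    let ?X = "{(i, j). i \<in> S \<and> j < (21::nat) \<and> \<pi> j i \<notin> S}"
    have finX: "finite ?X" by (rule finite_subset[of _ "S \<times> {..<21}"]) (use finS in auto)
    let ?N = "(\<lambda>(i, j). \<pi> j i) ` ?X"
    have cardN: "card ?N \<le> card ?X" using finX by (rule card_image_le)
    show "card S \<le> 2 * card ?X"
    proof (rule ccontr)
      assume "\<not> card S \<le> 2 * card ?X"
      hence small: "card ?N \<le> card S div 2" "card S \<noteq> 0" using cardN by auto
      have NM: "?N \<subseteq> {..<M}" using S(1) permutes_in_image[OF perm] by auto
      have "card (S \<union> ?N) \<le> t (card S)" using small(1) card_Un_le[of S ?N] by (simp add: t_def)
      moreover have "t (card S) \<le> card {..<M}" using S(2) by (simp add: t_def)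
      ultimately obtain T where T: "S \<union> ?N \<subseteq> T" "T \<subseteq> {..<M}" "card T = t (card S)"
        using exists_subset_between[of "S \<union> ?N" "t (card S)" "{..<M}"] S(1) NM by auto
      have "\<pi> j ` S \<subseteq> T" if "j < 21" for j
      proof
        fix y assume "y \<in> \<pi> j ` S"
        then obtain i where i: "i \<in> S" "y = \<pi> j i" by auto
        show "y \<in> T"
        proof (cases "y \<in> S")
          case False
          hence "(i, j) \<in> ?X" using i that by auto
          hence "y \<in> ?N" using i by force
          thus ?thesis using T by auto
        qed (use T in auto)
      qed
      hence "\<pi> \<in> bad S T"
        using \<pi>(1) by (auto simp: bad_def all_def P_def PiE_iff)
      moreover have "S \<in> sub (card S)" "T \<in> sub (t (card S))" using S T by (auto simp: sub_def)
      moreover have "card S \<in> {1..M div 2}" using S small by auto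
      ultimately have "\<pi> \<in> Bad" unfolding Bad_def by blast
      thus False using \<pi>(2) by blast
    qed
  qed
qed

section \<open>Gluing clusters by a random permutation\<close>

text \<open>Two labels are identified if they lie in one cluster, or if the open label \<open>u\<close> is joined to its
  partner \<open>\<sigma> u\<close>; the set \<open>H\<close> consists of the open labels.\<close>

definition glue :: "'a set \<Rightarrow> ('a \<Rightarrow> 'c) \<Rightarrow> ('a \<Rightarrow> 'a) \<Rightarrow> 'a set \<Rightarrow> ('a \<times> 'a) set" where
  "glue Wg cl \<sigma> H = {(u, v). u \<in> Wg \<and> v \<in> Wg \<and>
     (cl u = cl v \<or> (u \<in> H \<and> v = \<sigma> u) \<or> (v \<in> H \<and> u = \<sigma> v))}"

definition large_glued :: "real \<Rightarrow> 'a set \<Rightarrow> ('a \<Rightarrow> 'c) \<Rightarrow> ('a \<Rightarrow> 'a) \<Rightarrow> 'a set \<Rightarrow> bool" where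
  "large_glued a Wg cl \<sigma> H \<longleftrightarrow> (\<exists>X\<subseteq>Wg. a \<le> real (card X) \<and> (\<forall>u\<in>X. \<forall>v\<in>X. (u, v) \<in> (glue Wg cl \<sigma> H)\<^sup>*))"

lemma sym_glue: "sym (glue Wg cl \<sigma> H)"
  unfolding glue_def sym_def by auto

text \<open>A closed set of maximal size below half works: adding one more class, all classes being
  small, would otherwise keep it below half.\<close>

lemma balanced_closed_subset:
  fixes r :: "('a \<times> 'a) set"
  assumes "finite W" "r \<subseteq> W \<times> W" "sym r" "a \<le> real (card W)" "0 < a"
    and small: "\<And>u. u \<in> W \<Longrightarrow> real (card {v \<in> W. (u, v) \<in> r\<^sup>*}) < a / 4"
  obtains P where "P \<subseteq> W" "r `` P \<subseteq> P" "a / 4 \<le> real (card P)" "a / 4 \<le> real (card (W - P))"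
proof -
  define C where "C = {P. P \<subseteq> W \<and> r `` P \<subseteq> P \<and> real (card P) \<le> a / 2}"
  have "finite C" by (rule finite_subset[of _ "Pow W"]) (use assms(1) in \<open>auto simp: C_def\<close>)
  moreover have "{} \<in> C" using assms by (simp add: C_def)
  ultimately obtain P where P: "P \<in> C" "\<And>Q. Q \<in> C \<Longrightarrow> card Q \<le> card P"
    using Max_in[of "card ` C"] Max_ge[of "card ` C"] by (metis (no_types, lifting) empty_iff finite_imageI image_iff)
  have PW: "P \<subseteq> W" "r `` P \<subseteq> P" "real (card P) \<le> a / 2" using P(1) by (auto simp: C_def)
  have finP: "finite P" using PW(1) assms(1) finite_subset by blast
  have large: "a / 4 \<le> real (card P)"
  proof (rule ccontr)
    assume lt: "\<not> a / 4 \<le> real (card P)"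
    hence "P \<noteq> W" using assms(4,5) by auto
    then obtain u where u: "u \<in> W" "u \<notin> P" using PW by auto
    let ?D = "{v \<in> W. (u, v) \<in> r\<^sup>*}"
    have "real (card (P \<union> ?D)) \<le> real (card P) + real (card ?D)"
      using card_Un_le[of P ?D] by linarith
    also have "\<dots> \<le> a / 2" using small[OF u(1)] lt by linarith
    finally have "P \<union> ?D \<in> C"
      using PW assms(2) by (auto simp: C_def intro: rtrancl.rtrancl_into_rtrancl)
    hence "card (P \<union> ?D) \<le> card P" by (rule P(2))
    moreover have "insert u P \<subseteq> P \<union> ?D" using u by auto
    ultimately have "card (insert u P) \<le> card P"
      using card_mono[of "P \<union> ?D" "insert u P"] finP assms(1) by auto
    thus False using u finP by simp
  qed
  have "real (card (W - P)) = real (card W) - real (card P)"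
    using PW(1) finP assms(1) by (simp add: card_Diff_subset card_mono of_nat_diff)
  hence "a / 4 \<le> real (card (W - P))" using PW(3) assms(4,5) by linarith
  with that PW large show thesis by blast
qed

lemma not_large_glued_cut:
  assumes "finite Wg" "a \<le> real (card Wg)" "0 < a"
    and "\<not> large_glued (a / 4) Wg cl \<sigma> H"
  obtains C where "C \<subseteq> cl ` Wg" "a / 4 \<le> real (card {u\<in>Wg. cl u \<in> C})"
    "a / 4 \<le> real (card {u\<in>Wg. cl u \<notin> C})" "\<And>u. u \<in> Wg \<Longrightarrow> cl u \<in> C \<Longrightarrow> u \<in> H \<Longrightarrow> \<sigma> u \<in> Wg \<Longrightarrow> cl (\<sigma> u) \<in> C"
proof -
  let ?r = "glue Wg cl \<sigma> H"
  have small: "real (card {v \<in> Wg. (u, v) \<in> ?r\<^sup>*}) < a / 4" if "u \<in> Wg" for u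
  proof (rule ccontr)
    assume "\<not> ?thesis"
    moreover have "(x, y) \<in> ?r\<^sup>*" if "(u, x) \<in> ?r\<^sup>*" "(u, y) \<in> ?r\<^sup>*" for x y
      using that sym_rtrancl[OF sym_glue[of Wg cl \<sigma> H]] by (meson rtrancl_trans symD)
    ultimately have "large_glued (a / 4) Wg cl \<sigma> H"
      unfolding large_glued_def by (intro exI[of _ "{v \<in> Wg. (u, v) \<in> ?r\<^sup>*}"]) auto
    thus False using assms(4) by blast
  qed
  have "?r \<subseteq> Wg \<times> Wg" by (auto simp: glue_def)
  from balanced_closed_subset[OF assms(1) this sym_glue assms(2,3) small]
  obtain P where P: "P \<subseteq> Wg" "?r `` P \<subseteq> P" "a / 4 \<le> real (card P)" "a / 4 \<le> real (card (Wg - P))"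
    by blast
  have closed: "x \<in> P" if "x \<in> Wg" "y \<in> P" "cl x = cl y" for x y
  proof -
    have "(y, x) \<in> ?r" using that P(1) by (auto simp: glue_def)
    thus ?thesis using P(2) that(2) by blast
  qed
  have iff: "cl u \<in> cl ` P \<longleftrightarrow> u \<in> P" if "u \<in> Wg" for u
    using closed[OF that] by blast
  have eqP: "{u\<in>Wg. cl u \<in> cl ` P} = P" and eqQ: "{u\<in>Wg. cl u \<notin> cl ` P} = Wg - P"
    using P(1) iff by (auto simp del: image_iff)
  show thesis
  proof (rule that[of "cl ` P"])
    fix u assume u: "u \<in> Wg" "cl u \<in> cl ` P" "u \<in> H" "\<sigma> u \<in> Wg"
    hence "u \<in> P" using iff by simp
    moreover from u have "(u, \<sigma> u) \<in> ?r" by (simp add: glue_def)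
    ultimately show "cl (\<sigma> u) \<in> cl ` P" using P(2) by blast
  next
    show "cl ` P \<subseteq> cl ` Wg" using P(1) by blast
    show "a / 4 \<le> real (card {u \<in> Wg. cl u \<in> cl ` P})" unfolding eqP by (rule P(3))
    show "a / 4 \<le> real (card {u \<in> Wg. cl u \<notin> cl ` P})" unfolding eqQ by (rule P(4))
  qed
qed

lemma card_clusters_le:
  assumes "finite Wg" "\<And>u. u \<in> Wg \<Longrightarrow> K \<le> card {v\<in>Wg. cl v = cl u}"
  shows "K * card (cl ` Wg) \<le> card Wg"
proof -
  have "K * card (cl ` Wg) = (\<Sum>c\<in>cl ` Wg. K)" by simp
  also have "\<dots> \<le> (\<Sum>c\<in>cl ` Wg. card {v\<in>Wg. cl v = c})" by (intro sum_mono) (use assms in auto)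
  also have "\<dots> = card Wg"
    using assms(1) by (subst card_UN_disjoint[symmetric]) (auto intro: arg_cong[where f = card])
  finally show ?thesis .
qed

text \<open>A configuration without a large class is witnessed by a balanced set of clusters such
  that no open label inside is joined to a label outside. For a fixed set, averaging over the permutation
  gives at most \<open>(1 - q) ^ k\<close>, where \<open>q\<close> is the proportion of the outside and \<open>k\<close> the number
  of open labels inside; averaging over the open labels gives \<open>(1 - p * q)\<close> to the number
  of labels inside. The factor \<open>2 powr (card W / K)\<close> counts the sets of clusters.\<close>

theorem random_gluing:
  fixes cl :: "'a \<Rightarrow> 'c" and p a :: real
  assumes "finite W" "W \<noteq> {}" "0 < p" "p \<le> 1" "Wg \<subseteq> W" "0 < K"
    and clusters: "\<And>u. u \<in> Wg \<Longrightarrow> K \<le> card {v\<in>Wg. cl v = cl u}"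
    and a: "0 < a" "a \<le> real (card Wg)"
  shows "(\<Sum>\<sigma> | \<sigma> permutes W. bond_mean p W (\<lambda>H. of_bool (\<not> large_glued (a / 4) Wg cl \<sigma> H)))
    \<le> fact (card W) * 2 powr (card W / K) * (1 - p * (a / (4 * card W))) powr (a / 4)"
proof -
  define w where "w = real (card W)"
  define b where "b = 1 - p * (a / (4 * w))"
  have finWg: "finite Wg" using assms finite_subset by blast
  have w: "w > 0" using assms by (simp add: w_def card_gt_0_iff)
  have aw: "a \<le> w" unfolding w_def using a card_mono[OF assms(1,5)] by linarith
  have b: "0 < b" "b \<le> 1"
  proof -
    have "a / (4 * w) < 1" using aw w a by (simp add: field_simps)
    hence "p * (a / (4 * w)) < 1 * 1" using assms a w by (intro mult_le_less_imp_less) auto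
    thus "0 < b" by (simp add: b_def)
    show "b \<le> 1" using assms a w by (simp add: b_def)
  qed
  define CC where "CC = {C. C \<subseteq> cl ` Wg \<and> a / 4 \<le> real (card {u\<in>Wg. cl u \<in> C}) \<and>
    a / 4 \<le> real (card {u\<in>Wg. cl u \<notin> C})}"
  define PP where "PP C = {u\<in>Wg. cl u \<in> C}" for C
  define QQ where "QQ C = {u\<in>Wg. cl u \<notin> C}" for C
  have finCC: "finite CC" by (rule finite_subset[of _ "Pow (cl ` Wg)"]) (use finWg in \<open>auto simp: CC_def\<close>)
  have cardCC: "real (card CC) \<le> 2 powr (w / K)"
  proof -
    have "card CC \<le> card (Pow (cl ` Wg))"
      by (rule card_mono) (use finWg in \<open>auto simp: CC_def\<close>)
    also have "\<dots> = 2 ^ card (cl ` Wg)" using finWg by (simp add: card_Pow)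
    finally have "real (card CC) \<le> real (2 ^ card (cl ` Wg))"
      by (rule of_nat_mono)
    also have "\<dots> = 2 powr real (card (cl ` Wg))"
      by (subst powr_realpow) simp_all
    also have "\<dots> \<le> 2 powr (w / K)"
    proof (rule powr_mono)
      have "K * card (cl ` Wg) \<le> card W"
        using card_clusters_le[OF finWg clusters] card_mono[OF assms(1,5)] by linarith
      hence "real K * real (card (cl ` Wg)) \<le> w" unfolding w_def
        by (simp only: of_nat_mult[symmetric] of_nat_le_iff)
      thus "real (card (cl ` Wg)) \<le> w / K" using assms(6) by (simp add: field_simps)
    qed simp
    finally show ?thesis .
  qed
  have term_le: "(\<Sum>\<sigma> | \<sigma> permutes W. bond_mean p W (\<lambda>H. of_bool (\<sigma> ` (H \<inter> PP C) \<subseteq> W - QQ C)))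
      \<le> fact (card W) * b powr (a / 4)" if "C \<in> CC" for C
  proof -
    let ?\<beta> = "real (card (W - QQ C)) / card W"
    have PQ: "PP C \<subseteq> W" "QQ C \<subseteq> W" "a / 4 \<le> real (card (PP C))" "a / 4 \<le> real (card (QQ C))"
      using that assms(5) by (auto simp: CC_def PP_def QQ_def)
    have finQ: "finite (QQ C)" using PQ(2) assms(1) finite_subset by blast
    have \<beta>: "?\<beta> = 1 - real (card (QQ C)) / w"
      using PQ(2) w finQ card_mono[OF assms(1) PQ(2)] by (simp add: card_Diff_subset w_def of_nat_diff field_simps)
    have "(\<Sum>\<sigma> | \<sigma> permutes W. bond_mean p W (\<lambda>H. of_bool (\<sigma> ` (H \<inter> PP C) \<subseteq> W - QQ C))) =
        bond_mean p W (\<lambda>H. \<Sum>\<sigma> | \<sigma> permutes W. of_bool (\<sigma> ` (H \<inter> PP C) \<subseteq> W - QQ C))"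
      by (simp add: bond_mean_sum)
    also have "\<dots> = bond_mean p W (\<lambda>H. real (card {\<sigma>. \<sigma> permutes W \<and> \<sigma> ` (H \<inter> PP C) \<subseteq> W - QQ C}))"
      using finite_permutations[OF assms(1)]
      by (intro bond_mean_cong) (simp add: sum_of_bool_eq Collect_conj_eq)
    also have "\<dots> \<le> bond_mean p W (\<lambda>H. fact (card W) * ?\<beta> ^ card (H \<inter> PP C))"
      by (intro bond_mean_mono card_permutations_into) (use assms PQ in auto)
    also have "\<dots> = fact (card W) * (1 - p + p * ?\<beta>) ^ card (PP C)"
      using bond_mean_power_card[OF assms(1) PQ(1), of p ?\<beta>] by (simp add: bond_mean_cmult)
    also have "\<dots> \<le> fact (card W) * b ^ card (PP C)"
    proof (intro mult_left_mono power_mono)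
      have "p * (a / 4 / w) \<le> p * (real (card (QQ C)) / w)"
        using PQ w assms by (intro mult_left_mono divide_right_mono) auto
      thus "1 - p + p * ?\<beta> \<le> b" unfolding \<beta> b_def by (simp add: algebra_simps)
      show "0 \<le> 1 - p + p * ?\<beta>" using assms by simp
    qed simp
    also have "b ^ card (PP C) = b powr real (card (PP C))" using b by (simp add: powr_realpow)
    also have "fact (card W) * b powr real (card (PP C)) \<le> fact (card W) * b powr (a / 4)"
      using PQ b by (intro mult_left_mono powr_mono') auto
    finally show ?thesis by simp
  qed
  have "(\<Sum>\<sigma> | \<sigma> permutes W. bond_mean p W (\<lambda>H. of_bool (\<not> large_glued (a / 4) Wg cl \<sigma> H))) \<le>
     (\<Sum>\<sigma> | \<sigma> permutes W. \<Sum>C\<in>CC. bond_mean p W (\<lambda>H. of_bool (\<sigma> ` (H \<inter> PP C) \<subseteq> W - QQ C)))"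
  proof (rule sum_mono, rule bond_mean_exists_le)
    fix \<sigma> H assume \<sigma>: "\<sigma> \<in> {\<sigma>. \<sigma> permutes W}" and H: "H \<subseteq> W" "\<not> large_glued (a / 4) Wg cl \<sigma> H"
    from not_large_glued_cut[OF finWg a(2,1) H(2)] obtain C where
      C: "C \<subseteq> cl ` Wg" "a / 4 \<le> real (card {u\<in>Wg. cl u \<in> C})"
        "a / 4 \<le> real (card {u\<in>Wg. cl u \<notin> C})"
        "\<And>u. u \<in> Wg \<Longrightarrow> cl u \<in> C \<Longrightarrow> u \<in> H \<Longrightarrow> \<sigma> u \<in> Wg \<Longrightarrow> cl (\<sigma> u) \<in> C" by blast
    have "\<sigma> ` (H \<inter> PP C) \<subseteq> W - QQ C"
    proof
      fix y assume "y \<in> \<sigma> ` (H \<inter> PP C)"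
      then obtain u where u: "u \<in> H" "u \<in> Wg" "cl u \<in> C" "y = \<sigma> u" by (auto simp: PP_def)
      have "\<sigma> u \<in> W" using \<sigma> u(2) assms(5) permutes_in_image[of \<sigma> W u] by auto
      thus "y \<in> W - QQ C" using C(4)[OF u(2,3,1)] u(4) by (auto simp: QQ_def)
    qed
    moreover have "C \<in> CC" using C by (simp add: CC_def)
    ultimately show "\<exists>C\<in>CC. \<sigma> ` (H \<inter> PP C) \<subseteq> W - QQ C" by blast
  qed (use assms finCC in auto)
  also have "\<dots> = (\<Sum>C\<in>CC. \<Sum>\<sigma> | \<sigma> permutes W. bond_mean p W (\<lambda>H. of_bool (\<sigma> ` (H \<inter> PP C) \<subseteq> W - QQ C)))"
    by (rule sum.swap)
  also have "\<dots> \<le> (\<Sum>C\<in>CC. fact (card W) * b powr (a / 4))" by (intro sum_mono term_le)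
  also have "\<dots> = fact (card W) * b powr (a / 4) * real (card CC)" by simp
  also have "\<dots> \<le> fact (card W) * b powr (a / 4) * 2 powr (w / K)"
    using cardCC by (intro mult_left_mono) auto
  finally show ?thesis by (simp add: b_def w_def mult_ac)
qed

section \<open>Random wiring of independent copies\<close>

definition slice :: "('x \<times> 'e) set \<Rightarrow> 'x \<Rightarrow> 'e set" where
  "slice J x = {e. (x, e) \<in> J}"

lemma slice_Pair_image [simp]: "slice (Pair x ` H) x = H"
  by (auto simp: slice_def)

lemma bond_mean_slices_indep:
  assumes "finite M" "finite E" "x \<in> M" "y \<in> M" "x \<noteq> y"
  shows "bond_mean p (M \<times> E) (\<lambda>J. f (slice J x) * g (slice J y)) = bond_mean p E f * bond_mean p E g"
proof -
  have "bond_mean p (M \<times> E) (\<lambda>J. f (slice J x) * g (slice J y)) =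
      bond_mean p (M \<times> E) (\<lambda>J. (\<lambda>J. f (slice J x)) (J \<inter> Pair x ` E) * (\<lambda>J. g (slice J y)) (J \<inter> Pair y ` E))"
    by (intro bond_mean_cong arg_cong2[where f = "(*)"] arg_cong[where f = f] arg_cong[where f = g])
      (auto simp: slice_def)
  also have "\<dots> = bond_mean p (Pair x ` E) (\<lambda>J. f (slice J x)) * bond_mean p (Pair y ` E) (\<lambda>J. g (slice J y))"
    by (rule bond_mean_indep) (use assms in auto)
  also have "\<dots> = bond_mean p E f * bond_mean p E g"
    using assms by (simp add: bond_mean_image inj_on_def)
  finally show ?thesis .
qed

text \<open>Chebyshev's inequality: the copies are independent and each contributes at most
  \<open>card L\<close> good labels.\<close>

lemma few_good_labels:
  fixes good_labels :: "'e set \<Rightarrow> 'l set"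
  assumes "finite E" "finite L" "L \<noteq> {}" "0 \<le> p" "p \<le> 1" "0 < \<theta>" "0 < m"
    and sub: "\<And>H. good_labels H \<subseteq> L"
    and \<theta>: "\<And>i. i \<in> L \<Longrightarrow> \<theta> \<le> bond_mean p E (\<lambda>H. of_bool (i \<in> good_labels H))"
  shows "bond_mean p ({..<m} \<times> E) (\<lambda>J. of_bool
      (real (card (SIGMA x:{..<m}. good_labels (slice J x))) < \<theta> * real (m * card L) / 2)) \<le> 4 / (\<theta>\<^sup>2 * m)"
proof -
  let ?M = "{..<m::nat}"
  let ?E = "bond_mean p ({..<m} \<times> E)"
  define l where "l = real (card L)"
  have l: "l > 0" using assms by (simp add: l_def card_gt_0_iff)
  define X where "X H = real (card (good_labels H))" for H
  define \<mu> where "\<mu> = bond_mean p E X"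
  have X: "0 \<le> X H" "X H \<le> l" for H
    using card_mono[OF assms(2) sub] by (auto simp: X_def l_def)
  have X_sum: "X H = (\<Sum>i\<in>L. of_bool (i \<in> good_labels H))" for H
    using sub[of H] assms(2) by (simp add: X_def sum_of_bool_eq Int_absorb1)
  have \<mu>_ge: "\<theta> * l \<le> \<mu>"
  proof -
    have "\<theta> * l = (\<Sum>i\<in>L. \<theta>)" by (simp add: l_def)
    also have "\<dots> \<le> (\<Sum>i\<in>L. bond_mean p E (\<lambda>H. of_bool (i \<in> good_labels H)))" by (intro sum_mono \<theta>)
    also have "\<dots> = \<mu>" by (simp add: \<mu>_def X_sum[abs_def] bond_mean_sum)
    finally show ?thesis .
  qed
  have \<mu>_le: "\<mu> \<le> l" "0 \<le> \<mu>"
  proof -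
    have "\<mu> \<le> bond_mean p E (\<lambda>_. l)" unfolding \<mu>_def using X assms by (intro bond_mean_mono) auto
    thus "\<mu> \<le> l" using assms by simp
    show "0 \<le> \<mu>" unfolding \<mu>_def using X assms by (intro bond_mean_nonneg) auto
  qed
  define Y where "Y H = X H - \<mu>" for H
  have Y: "(Y H)\<^sup>2 \<le> l\<^sup>2" for H
  proof -
    have "\<bar>Y H\<bar> \<le> l" using X[of H] \<mu>_le by (auto simp: Y_def)
    hence "\<bar>Y H\<bar>\<^sup>2 \<le> l\<^sup>2" by (intro power_mono) auto
    thus ?thesis by simp
  qed
  have EY: "bond_mean p E Y = 0"
    using bond_mean_add[of p E X "\<lambda>_. - \<mu>"] assms(1) by (simp add: Y_def[abs_def] \<mu>_def)
  have cov: "?E (\<lambda>J. Y (slice J x) * Y (slice J y)) \<le> (if x = y then l\<^sup>2 else 0)"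
    if "x \<in> ?M" "y \<in> ?M" for x y
  proof (cases "x = y")
    case True
    have "?E (\<lambda>J. Y (slice J x) * Y (slice J x)) \<le> ?E (\<lambda>J. l\<^sup>2)"
      using Y assms by (intro bond_mean_mono) (auto simp: power2_eq_square)
    thus ?thesis using True assms by simp
  next
    case False
    thus ?thesis using bond_mean_slices_indep[of ?M E x y p Y Y] that assms EY by simp
  qed
  have var: "?E (\<lambda>J. (\<Sum>x<m. Y (slice J x))\<^sup>2) \<le> m * l\<^sup>2"
  proof -
    have "?E (\<lambda>J. (\<Sum>x<m. Y (slice J x))\<^sup>2) = (\<Sum>x<m. \<Sum>y<m. ?E (\<lambda>J. Y (slice J x) * Y (slice J y)))"
      by (simp add: power2_eq_square sum_product bond_mean_sum)
    also have "\<dots> \<le> (\<Sum>x<m. \<Sum>y<m. if x = y then l\<^sup>2 else 0)"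
      by (intro sum_mono cov) auto
    also have "\<dots> = m * l\<^sup>2" by simp
    finally show ?thesis .
  qed
  define t where "t = \<theta> * (m * l) / 2"
  have t: "t > 0" using assms l by (simp add: t_def)
  have "?E (\<lambda>J. of_bool (real (card (SIGMA x:{..<m}. good_labels (slice J x))) < t))
      \<le> ?E (\<lambda>J. (1 / t\<^sup>2) * (\<Sum>x<m. Y (slice J x))\<^sup>2)"
  proof (intro bond_mean_mono assms)
    fix J :: "(nat \<times> 'e) set"
    have fin: "finite (good_labels H)" for H using sub assms(2) finite_subset by blast
    have cardS: "real (card (SIGMA x:{..<m}. good_labels (slice J x))) = (\<Sum>x<m. X (slice J x))"
      using fin by (simp add: X_def)
    show "of_bool (real (card (SIGMA x:{..<m}. good_labels (slice J x))) < t) \<le> (1 / t\<^sup>2) * (\<Sum>x<m. Y (slice J x))\<^sup>2"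
    proof (cases "real (card (SIGMA x:{..<m}. good_labels (slice J x))) < t")
      case True
      have "m * (\<theta> * l) \<le> m * \<mu>" using \<mu>_ge by (intro mult_left_mono) auto
      hence "2 * t \<le> m * \<mu>" by (simp add: t_def algebra_simps)
      hence "t \<le> - (\<Sum>x<m. Y (slice J x))"
        using True unfolding cardS by (simp add: Y_def sum_subtractf)
      hence "t\<^sup>2 \<le> (- (\<Sum>x<m. Y (slice J x)))\<^sup>2" using t by (intro power_mono) auto
      thus ?thesis using True t by (simp add: field_simps)
    qed simp
  qed
  also have "\<dots> = (1 / t\<^sup>2) * ?E (\<lambda>J. (\<Sum>x<m. Y (slice J x))\<^sup>2)" by (rule bond_mean_cmult)
  also have "\<dots> \<le> (1 / t\<^sup>2) * (m * l\<^sup>2)" using var by (intro mult_left_mono) auto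
  also have "\<dots> = 4 / (\<theta>\<^sup>2 * m)"
    using l assms by (simp add: t_def power2_eq_square field_simps)
  finally show ?thesis by (simp add: t_def l_def)
qed

text \<open>The bound of \<open>random_gluing\<close> holds for every configuration inside the copies that has
  enough good labels. Hence it holds on average over the configuration, and some permutation
  is at least as good as the average permutation.\<close>

theorem random_wiring:
  fixes good_labels :: "'e set \<Rightarrow> 'l set" and cl :: "'e set \<Rightarrow> 'l \<Rightarrow> 'c" and m K :: nat
  assumes "finite E" "finite L" "L \<noteq> {}" "0 < p" "p \<le> 1" "0 < \<theta>" "0 < m" "0 < K"
    and sub: "\<And>H. good_labels H \<subseteq> L"
    and clusters: "\<And>H i. i \<in> good_labels H \<Longrightarrow> K \<le> card {j\<in>good_labels H. cl H j = cl H i}"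
    and \<theta>: "\<And>i. i \<in> L \<Longrightarrow> \<theta> \<le> bond_mean p E (\<lambda>H. of_bool (i \<in> good_labels H))"
  obtains \<sigma> where "\<sigma> permutes ({..<m} \<times> L)"
    "bond_mean p ({..<m} \<times> E) (\<lambda>J. bond_mean p ({..<m} \<times> L) (\<lambda>H. of_bool (\<not> large_glued (\<theta> * (m * card L) / 8)
        (SIGMA x:{..<m}. good_labels (slice J x)) (\<lambda>(x, i). (x, cl (slice J x) i)) \<sigma> H)))
     \<le> 4 / (\<theta>\<^sup>2 * m) + 2 powr (real (m * card L) / K) * (1 - p * \<theta> / 8) powr (\<theta> * (m * card L) / 8)"
proof -
  define W where "W = {..<m} \<times> L"
  define Wg where "Wg J = (SIGMA x:{..<m}. good_labels (slice J x))" for J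
  define clu where "clu J = (\<lambda>(x::nat, i). (x, cl (slice J x) i))" for J
  define w where "w = real (m * card L)"
  define B where "B = 2 powr (w / K) * (1 - p * \<theta> / 8) powr (\<theta> * w / 8)"
  define few where "few J \<longleftrightarrow> real (card (Wg J)) < \<theta> * w / 2" for J
  let ?P = "{\<sigma>. \<sigma> permutes W}"
  have W: "finite W" "W \<noteq> {}" "real (card W) = w"
    using assms by (auto simp: W_def w_def lessThan_empty_iff)
  have w: "w > 0" using W by (metis card_gt_0_iff of_nat_0_less_iff)
  have WgW: "Wg J \<subseteq> W" for J using sub by (auto simp: Wg_def W_def)
  have finWg: "finite (Wg J)" for J using WgW W(1) finite_subset by blast
  let ?bad = "\<lambda>\<sigma> J H. of_bool (\<not> large_glued (\<theta> * w / 8) (Wg J) (clu J) \<sigma> H) :: real"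
  have clusters': "K \<le> card {v\<in>Wg J. clu J v = clu J u}" if u: "u \<in> Wg J" for J u
  proof -
    obtain x i where xi: "u = (x, i)" "x < m" "i \<in> good_labels (slice J x)" using u by (auto simp: Wg_def)
    have "Pair x ` {j\<in>good_labels (slice J x). cl (slice J x) j = cl (slice J x) i} \<subseteq> {v\<in>Wg J. clu J v = clu J u}"
      using xi by (auto simp: Wg_def clu_def)
    hence "card (Pair x ` {j\<in>good_labels (slice J x). cl (slice J x) j = cl (slice J x) i}) \<le> card {v\<in>Wg J. clu J v = clu J u}"
      using finWg by (intro card_mono) auto
    thus ?thesis using clusters[OF xi(3)] by (simp add: card_image inj_on_def)
  qed
  have perJ: "(\<Sum>\<sigma>\<in>?P. bond_mean p W (?bad \<sigma> J)) \<le> fact (card W) * (of_bool (few J) + B)" for J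
  proof (cases "few J")
    case True
    have "(\<Sum>\<sigma>\<in>?P. bond_mean p W (?bad \<sigma> J)) \<le> (\<Sum>\<sigma>\<in>?P. bond_mean p W (\<lambda>_. 1))"
      using assms by (intro sum_mono bond_mean_mono) auto
    also have "\<dots> = fact (card W)" using W card_permutations[OF refl W(1)] by simp
    also have "\<dots> \<le> fact (card W) * (of_bool (few J) + B)" using True by (simp add: B_def)
    finally show ?thesis .
  next
    case False
    let ?a = "\<theta> * w / 2"
    have eq8: "?a / 4 = \<theta> * w / 8" by simp
    have "(\<Sum>\<sigma>\<in>?P. bond_mean p W (?bad \<sigma> J)) \<le>
        fact (card W) * 2 powr (card W / K) * (1 - p * (?a / (4 * card W))) powr (?a / 4)"
      unfolding eq8[symmetric]
      by (rule random_gluing) (use assms W w WgW clusters' False in \<open>auto simp: few_def\<close>)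
    also have "p * (?a / (4 * card W)) = p * \<theta> / 8" using W w by simp
    finally show ?thesis using False W by (simp add: B_def mult_ac)
  qed
  have "(\<Sum>\<sigma>\<in>?P. bond_mean p ({..<m} \<times> E) (\<lambda>J. bond_mean p W (?bad \<sigma> J))) =
      bond_mean p ({..<m} \<times> E) (\<lambda>J. \<Sum>\<sigma>\<in>?P. bond_mean p W (?bad \<sigma> J))"
    by (simp add: bond_mean_sum)
  also have "\<dots> \<le> bond_mean p ({..<m} \<times> E) (\<lambda>J. fact (card W) * (of_bool (few J) + B))"
    using assms by (intro bond_mean_mono perJ) auto
  also have "\<dots> = fact (card W) * (bond_mean p ({..<m} \<times> E) (\<lambda>J. of_bool (few J)) + B)"
    using assms by (simp add: bond_mean_cmult bond_mean_add)
  also have "\<dots> \<le> fact (card W) * (4 / (\<theta>\<^sup>2 * m) + B)"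
    using few_good_labels[OF assms(1-3) _ assms(5-7) sub \<theta>] assms(4)
    by (intro mult_left_mono add_right_mono) (auto simp: few_def Wg_def w_def)
  finally have tot: "(\<Sum>\<sigma>\<in>?P. bond_mean p ({..<m} \<times> E) (\<lambda>J. bond_mean p W (?bad \<sigma> J)))
     \<le> fact (card W) * (4 / (\<theta>\<^sup>2 * m) + B)" .
  have "\<exists>\<sigma>\<in>?P. bond_mean p ({..<m} \<times> E) (\<lambda>J. bond_mean p W (?bad \<sigma> J)) \<le> 4 / (\<theta>\<^sup>2 * m) + B"
  proof (rule ccontr)
    assume neg: "\<not> ?thesis"
    have "(\<Sum>\<sigma>\<in>?P. 4 / (\<theta>\<^sup>2 * m) + B) < (\<Sum>\<sigma>\<in>?P. bond_mean p ({..<m} \<times> E) (\<lambda>J. bond_mean p W (?bad \<sigma> J)))"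
    proof (rule sum_strict_mono)
      show "finite ?P" by (rule finite_permutations[OF W(1)])
      show "?P \<noteq> {}" using permutes_id[of W] by blast
    qed (use neg in \<open>meson not_le\<close>)
    thus False using tot card_permutations[OF refl W(1)] by simp
  qed
  then obtain \<sigma> where "\<sigma> permutes W"
    "bond_mean p ({..<m} \<times> E) (\<lambda>J. bond_mean p W (?bad \<sigma> J)) \<le> 4 / (\<theta>\<^sup>2 * m) + B" by blast
  thus thesis using that[of \<sigma>] by (simp add: W_def Wg_def clu_def w_def B_def)
qed

section \<open>Words acting on a ball of the regular tree\<close>

definition joined :: "'v set set \<Rightarrow> ('v \<times> 'v) set" where
  "joined H = {(a, b). {a, b} \<in> H}\<^sup>*"

lemma joined_refl [simp]: "(a, a) \<in> joined H"
  by (simp add: joined_def)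

lemma joined_trans: "(a, b) \<in> joined H \<Longrightarrow> (b, c) \<in> joined H \<Longrightarrow> (a, c) \<in> joined H"
  unfolding joined_def by (rule rtrancl_trans)

lemma joined_sym: "(a, b) \<in> joined H \<Longrightarrow> (b, a) \<in> joined H"
proof -
  have "sym {(a, b). {a, b} \<in> H}" by (auto simp: sym_def insert_commute)
  thus "(a, b) \<in> joined H \<Longrightarrow> (b, a) \<in> joined H"
    unfolding joined_def using sym_rtrancl symD by metis
qed

lemma joined_edge: "{a, b} \<in> H \<Longrightarrow> (a, b) \<in> joined H"
  unfolding joined_def by auto

lemma joined_mono: "H \<subseteq> H' \<Longrightarrow> (a, b) \<in> joined H \<Longrightarrow> (a, b) \<in> joined H'"
  unfolding joined_def using rtrancl_mono[of "{(a, b). {a, b} \<in> H}" "{(a, b). {a, b} \<in> H'}"] by auto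

lemma even_card_involution:
  assumes "finite X" "\<And>x. x \<in> X \<Longrightarrow> f x \<in> X" "\<And>x. x \<in> X \<Longrightarrow> f (f x) = x" "\<And>x. x \<in> X \<Longrightarrow> f x \<noteq> x"
  shows "even (card X)"
proof -
  let ?C = "(\<lambda>x. {x, f x}) ` X"
  have "2 * card ?C = card (\<Union>?C)"
  proof (rule card_partition)
    show "finite (\<Union>?C)" using assms(1) by auto
    show "card c = 2" if c: "c \<in> ?C" for c
    proof -
      obtain x where "c = {x, f x}" "x \<in> X" using c by (rule imageE)
      thus ?thesis using assms(4)[of x] by (simp add: card_2_iff)
    qed
    show "c1 \<inter> c2 = {}" if c: "c1 \<in> ?C" "c2 \<in> ?C" "c1 \<noteq> c2" for c1 c2
    proof -
      obtain x y where xy: "x \<in> X" "c1 = {x, f x}" "y \<in> X" "c2 = {y, f y}" using c(1,2) by blast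
      have fx: "f (f x) = x" "f (f y) = y" using assms(3) xy by blast+
      show ?thesis
      proof (rule ccontr)
        assume "c1 \<inter> c2 \<noteq> {}"
        hence "x = y \<or> x = f y \<or> f x = y \<or> f x = f y" using xy by blast
        hence "x = y \<or> x = f y" using fx by metis
        thus False
        proof
          assume "x = f y"
          thus False using xy c(3) fx by (simp add: insert_commute)
        qed (use xy c(3) in simp)
      qed
    qed
  qed (use assms in auto)
  moreover have "\<Union>?C = X" using assms(2) by auto
  ultimately show ?thesis by (metis dvd_triv_left)
qed

text \<open>The \<open>d\<close>-regular tree whose edges are coloured by \<open>d\<close> colours has the words without equal
  neighbouring letters as its vertices; the colour \<open>c\<close> joins \<open>w\<close> and \<open>c # w\<close>. The involution
  \<open>tree_swap d g c\<close> exchanges the ends of each edge of colour \<open>c\<close> inside the ball and fixes the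
  vertices on the boundary that have no such edge.\<close>

definition tree_ball :: "nat \<Rightarrow> nat \<Rightarrow> nat list set" where
  "tree_ball d g = {w. distinct_adj w \<and> set w \<subseteq> {..<d} \<and> length w \<le> g}"

definition tree_swap :: "nat \<Rightarrow> nat \<Rightarrow> nat \<Rightarrow> nat list \<Rightarrow> nat list" where
  "tree_swap d g c w = (if w \<in> tree_ball d g then
      if w \<noteq> [] \<and> hd w = c then tl w else if length w < g then c # w else w
    else w)"

lemma finite_tree_ball: "finite (tree_ball d g)"
  by (rule finite_subset[OF _ finite_lists_length_le[of "{..<d}" g]]) (auto simp: tree_ball_def)

lemma tree_swap_tree_ball: "c < d \<Longrightarrow> w \<in> tree_ball d g \<Longrightarrow> tree_swap d g c w \<in> tree_ball d g"
  by (cases w) (auto simp: tree_swap_def tree_ball_def distinct_adj_Cons)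

lemma tree_swap_tree_swap [simp]: "c < d \<Longrightarrow> tree_swap d g c (tree_swap d g c w) = w"
  by (cases w) (auto simp: tree_swap_def tree_ball_def distinct_adj_Cons)

lemma tree_swap_comp [simp]: "c < d \<Longrightarrow> tree_swap d g c \<circ> tree_swap d g c = id"
  by (auto simp: fun_eq_iff)

lemma tree_swap_permutes: "c < d \<Longrightarrow> tree_swap d g c permutes tree_ball d g"
proof (rule bij_imp_permutes)
  assume "c < d"
  thus "bij_betw (tree_swap d g c) (tree_ball d g) (tree_ball d g)"
    by (intro bij_betwI[where g = "tree_swap d g c"]) (auto intro: tree_swap_tree_ball)
qed (simp add: tree_swap_def)

primrec word_perm :: "nat \<Rightarrow> nat \<Rightarrow> nat list \<Rightarrow> nat list \<Rightarrow> nat list" where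
  "word_perm d g [] = id"
| "word_perm d g (c # w) = tree_swap d g c \<circ> word_perm d g w"

text \<open>The reason for large girth: a reduced word carries the centre of the ball to itself read as a
  vertex, so distinct reduced words of length at most \<open>g\<close> act differently.\<close>

lemma word_perm_Nil: "w \<in> tree_ball d g \<Longrightarrow> word_perm d g w [] = w"
proof (induction w)
  case (Cons c w)
  hence "w \<in> tree_ball d g" by (auto simp: tree_ball_def distinct_adj_Cons)
  with Cons show ?case by (auto simp: tree_swap_def tree_ball_def distinct_adj_Cons)
qed simp

lemma word_perm_permutes: "set w \<subseteq> {..<d} \<Longrightarrow> word_perm d g w permutes tree_ball d g"
  by (induction w) (auto intro: permutes_compose tree_swap_permutes permutes_id)

lemma distinct_adj_infix: "distinct_adj (u @ v @ w) \<Longrightarrow> distinct_adj v"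
  by (simp add: distinct_adj_append_iff)

text \<open>A vertex of a piece is a pair of permutations: the first one, on a ball of large radius
  \<open>g\<close>, makes the piece locally a tree; the second one, on the ball of fixed radius \<open>g0\<close>,
  is the image of the vertex in the base graph that the piece covers.\<close>

type_synonym piece_vertex = "(nat list \<Rightarrow> nat list) \<times> (nat list \<Rightarrow> nat list)"

locale tree_base =
  fixes d g0 :: nat
  assumes d: "3 \<le> d" and g0: "2 \<le> g0"
begin

definition base_step :: "nat \<Rightarrow> (nat list \<Rightarrow> nat list) \<Rightarrow> nat list \<Rightarrow> nat list" where
  "base_step c \<rho> = \<rho> \<circ> tree_swap d g0 c"

text \<open>The ends of the marked edge of the base graph, which has colour \<open>0\<close> and starts at the
  identity.\<close>

definition special :: "(nat list \<Rightarrow> nat list) \<Rightarrow> bool" where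
  "special \<rho> \<longleftrightarrow> \<rho> = id \<or> \<rho> = tree_swap d g0 0"

lemma base_step_base_step [simp]: "c < d \<Longrightarrow> base_step c (base_step c \<rho>) = \<rho>"
  by (simp add: base_step_def o_assoc[symmetric])

lemma special_base_step [simp]: "special (base_step 0 \<rho>) \<longleftrightarrow> special \<rho>"
proof -
  have "base_step 0 \<rho> = id \<longleftrightarrow> \<rho> = tree_swap d g0 0" "base_step 0 \<rho> = tree_swap d g0 0 \<longleftrightarrow> \<rho> = id"
    using d base_step_base_step[of 0 \<rho>] base_step_base_step[of 0 id] base_step_base_step[of 0 "tree_swap d g0 0"]
    by (auto simp: base_step_def)
  thus ?thesis by (auto simp: special_def)
qed

text \<open>At either end of the marked edge, colour \<open>0\<close> is the marked edge.\<close>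

primrec avoid :: "nat list \<Rightarrow> (nat list \<Rightarrow> nat list) \<Rightarrow> bool" where
  "avoid [] \<rho> \<longleftrightarrow> True"
| "avoid (c # w) \<rho> \<longleftrightarrow> c < d \<and> \<not> (c = 0 \<and> special \<rho>) \<and> avoid w (base_step c \<rho>)"

lemma avoid_append: "avoid (u @ v) \<rho> \<longleftrightarrow> avoid u \<rho> \<and> avoid v (fold base_step u \<rho>)"
  by (induction u arbitrary: \<rho>) auto

lemma avoid_set: "avoid w \<rho> \<Longrightarrow> set w \<subseteq> {..<d}"
  by (induction w arbitrary: \<rho>) auto

lemma avoid_rev:
  "avoid w \<rho> \<Longrightarrow> avoid (rev w) (fold base_step w \<rho>) \<and> fold base_step (rev w) (fold base_step w \<rho>) = \<rho>"
  by (induction w arbitrary: \<rho>) (auto simp: avoid_append)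

lemma fold_base_step: "fold base_step w \<rho> = \<rho> \<circ> word_perm d g0 w"
  by (induction w arbitrary: \<rho>) (auto simp: base_step_def o_assoc)

text \<open>The component of \<open>id\<close> in the base graph without the marked edge.\<close>

definition base_verts :: "(nat list \<Rightarrow> nat list) set" where
  "base_verts = {fold base_step z id | z. avoid z id}"

lemma base_verts_id: "id \<in> base_verts"
  unfolding base_verts_def by (auto intro!: exI[of _ "[]"])

lemma base_verts_permutes: "\<rho> \<in> base_verts \<Longrightarrow> \<rho> permutes tree_ball d g0"
  unfolding base_verts_def using avoid_set by (auto simp: fold_base_step intro: word_perm_permutes)

lemma finite_base_verts: "finite base_verts"
  by (rule finite_subset[OF _ finite_permutations[OF finite_tree_ball[of d g0]]]) (use base_verts_permutes in auto)

lemma base_verts_fold: "\<rho> \<in> base_verts \<Longrightarrow> avoid w \<rho> \<Longrightarrow> fold base_step w \<rho> \<in> base_verts"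
proof -
  assume "\<rho> \<in> base_verts" "avoid w \<rho>"
  then obtain z where z: "avoid z id" "\<rho> = fold base_step z id" by (auto simp: base_verts_def)
  hence "avoid (z @ w) id \<and> fold base_step w \<rho> = fold base_step (z @ w) id"
    using \<open>avoid w \<rho>\<close> by (simp add: avoid_append)
  thus ?thesis unfolding base_verts_def by blast
qed

lemma base_verts_base_step: "\<rho> \<in> base_verts \<Longrightarrow> c < d \<Longrightarrow> \<not> (c = 0 \<and> special \<rho>) \<Longrightarrow> base_step c \<rho> \<in> base_verts"
  using base_verts_fold[of \<rho> "[c]"] by simp

lemma base_step_neq: "\<rho> \<in> base_verts \<Longrightarrow> c < d \<Longrightarrow> base_step c \<rho> \<noteq> \<rho>"
proof
  assume "\<rho> \<in> base_verts" "c < d" "base_step c \<rho> = \<rho>"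
  hence "\<rho> (tree_swap d g0 c []) = \<rho> []" by (simp add: base_step_def fun_eq_iff)
  moreover have "inj \<rho>" using base_verts_permutes[OF \<open>\<rho> \<in> base_verts\<close>] by (rule permutes_inj)
  ultimately have "tree_swap d g0 c [] = []" by (auto dest: injD)
  thus False using g0 by (simp add: tree_swap_def tree_ball_def)
qed

text \<open>A parity argument shows that the marked edge is not a bridge. Otherwise its far end would not
  lie in the component \<open>base_verts\<close> of \<open>id\<close> without the marked edge. That component is paired off by
  colour \<open>1\<close>, while colour \<open>0\<close> pairs off all of it except \<open>id\<close>.\<close>

lemma detour_exists: "tree_swap d g0 0 \<in> base_verts"
proof (rule ccontr)
  assume not: "tree_swap d g0 0 \<notin> base_verts"
  have "even (card base_verts)"
    by (rule even_card_involution[of _ "base_step 1"])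
      (use finite_base_verts base_verts_base_step[of _ 1] base_step_neq[of _ 1] d in auto)
  moreover have "even (card (base_verts - {id}))"
  proof (rule even_card_involution[of _ "base_step 0"])
    fix \<rho> assume \<rho>: "\<rho> \<in> base_verts - {id}"
    hence ns: "\<not> special \<rho>" using not by (auto simp: special_def)
    have "base_step 0 \<rho> \<noteq> id" using ns special_base_step[of \<rho>] by (auto simp: special_def)
    thus "base_step 0 \<rho> \<in> base_verts - {id}" using base_verts_base_step[of \<rho> 0] \<rho> ns d by auto
  qed (use finite_base_verts base_step_neq[of _ 0] d in auto)
  moreover have "card base_verts = Suc (card (base_verts - {id}))"
    using card_Suc_Diff1[OF finite_base_verts base_verts_id] by simp
  ultimately show False by simp
qed

text \<open>A walk around the marked edge: it leads from one end to the other without using it.\<close>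

definition around :: "nat list" where
  "around = (SOME z. avoid z id \<and> fold base_step z id = tree_swap d g0 0)"

lemma around: "avoid around id" "fold base_step around id = tree_swap d g0 0"
proof -
  have "\<exists>z. avoid z id \<and> fold base_step z id = tree_swap d g0 0" using detour_exists by (auto simp: base_verts_def)
  hence "avoid around id \<and> fold base_step around id = tree_swap d g0 0" unfolding around_def by (rule someI_ex)
  thus "avoid around id" "fold base_step around id = tree_swap d g0 0" by auto
qed

definition return_word :: "(nat list \<Rightarrow> nat list) \<Rightarrow> nat list" where
  "return_word \<rho> = (SOME z. avoid z \<rho> \<and> fold base_step z \<rho> = id)"

lemma return_word: assumes "\<rho> \<in> base_verts" shows "avoid (return_word \<rho>) \<rho>" "fold base_step (return_word \<rho>) \<rho> = id"
proof -
  obtain z where z: "avoid z id" "\<rho> = fold base_step z id" using assms by (auto simp: base_verts_def)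
  hence "\<exists>z. avoid z \<rho> \<and> fold base_step z \<rho> = id" using avoid_rev[OF z(1)] by auto
  hence "avoid (return_word \<rho>) \<rho> \<and> fold base_step (return_word \<rho>) \<rho> = id" unfolding return_word_def by (rule someI_ex)
  thus "avoid (return_word \<rho>) \<rho>" "fold base_step (return_word \<rho>) \<rho> = id" by auto
qed

definition max_return :: nat where "max_return = Max ((\<lambda>\<rho>. length (return_word \<rho>)) ` base_verts)"

lemma length_return_word: "\<rho> \<in> base_verts \<Longrightarrow> length (return_word \<rho>) \<le> max_return"
  unfolding max_return_def using finite_base_verts by (intro Max_ge) auto

definition allowed :: "(nat list \<Rightarrow> nat list) \<Rightarrow> nat \<Rightarrow> nat set" where
  "allowed \<rho> a = {c. c < d \<and> c \<noteq> a \<and> \<not> (c = 0 \<and> special \<rho>)}"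

text \<open>The probability that a non-backtracking random walk that avoids the marked edge follows the word, if
  it starts at \<open>\<rho>\<close> and has just used colour \<open>a\<close>. A value \<open>a \<ge> d\<close> stands for a
  walk that has not made a step yet.\<close>

primrec walk_mass :: "(nat list \<Rightarrow> nat list) \<Rightarrow> nat \<Rightarrow> nat list \<Rightarrow> real" where
  "walk_mass \<rho> a [] = 1"
| "walk_mass \<rho> a (c # w) = (if c \<in> allowed \<rho> a then walk_mass (base_step c \<rho>) c w / card (allowed \<rho> a) else 0)"

definition words :: "nat \<Rightarrow> nat list set" where
  "words n = {w. set w \<subseteq> {..<d} \<and> length w = n}"

primrec visits :: "(nat list \<Rightarrow> nat list) \<Rightarrow> nat list \<Rightarrow> nat" where
  "visits \<rho> [] = 0"
| "visits \<rho> (c # w) = of_bool (special \<rho>) + visits (base_step c \<rho>) w"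

lemma finite_allowed [simp]: "finite (allowed \<rho> a)" by (simp add: allowed_def)

lemma card_allowed: "d \<le> card (allowed \<rho> a) + 1 + of_bool (special \<rho>)"
proof -
  have "{..<d} \<subseteq> insert a (allowed \<rho> a \<union> (if special \<rho> then {0} else {}))"
    by (auto simp: allowed_def)
  hence "card {..<d} \<le> card (insert a (allowed \<rho> a \<union> (if special \<rho> then {0} else {})))"
    by (rule card_mono[rotated]) auto
  also have "\<dots> \<le> 1 + card (allowed \<rho> a \<union> (if special \<rho> then {0} else {}))"
    using card_insert_le_m1[of 1] by (simp add: card_insert_if)
  also have "\<dots> \<le> 1 + (card (allowed \<rho> a) + card (if special \<rho> then {0::nat} else {}))"
    using card_Un_le by (intro add_left_mono)
  finally show ?thesis by (cases "special \<rho>") auto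
qed

lemma finite_words [simp]: "finite (words n)"
  using finite_lists_length_eq[of "{..<d}" n] by (simp add: words_def)

lemma sum_words_Suc: "(\<Sum>w\<in>words (Suc n). f w) = (\<Sum>c<d. \<Sum>w\<in>words n. f (c # w))"
proof -
  have eq: "words (Suc n) = (\<lambda>(c, w). c # w) ` ({..<d} \<times> words n)"
    by (auto simp: words_def length_Suc_conv image_iff)
  show ?thesis unfolding eq by (subst sum.reindex) (auto simp: inj_on_def sum.cartesian_product intro!: sum.cong)
qed

lemma walk_mass_nonneg [simp]: "0 \<le> walk_mass \<rho> a w"
  by (induction w arbitrary: \<rho> a) auto

lemma sum_walk_mass: "(\<Sum>w\<in>words n. walk_mass \<rho> a w) = 1"
proof (induction n arbitrary: \<rho> a)
  case 0
  have "words 0 = {[]}" by (auto simp: words_def)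
  thus ?case by simp
next
  case (Suc n)
  have "card (allowed \<rho> a) > 0" using card_allowed[of \<rho> a] d by (cases "special \<rho>") auto
  hence "allowed \<rho> a \<noteq> {}" by auto
  moreover have "(\<Sum>w\<in>words n. walk_mass \<rho> a (c # w)) = (if c \<in> allowed \<rho> a then 1 / card (allowed \<rho> a) else 0)" for c
    by (simp add: Suc flip: sum_divide_distrib)
  moreover have "{..<d} \<inter> allowed \<rho> a = allowed \<rho> a" by (auto simp: allowed_def)
  ultimately show ?case by (simp add: sum_words_Suc sum.If_cases del: walk_mass.simps)
qed

lemma walk_mass_append: "walk_mass \<rho> a (u @ v) = walk_mass \<rho> a u * walk_mass (fold base_step u \<rho>) (last (a # u)) v"
  by (induction u arbitrary: \<rho> a) auto

lemma walk_mass_nonzero: "walk_mass \<rho> a w \<noteq> 0 \<Longrightarrow> distinct_adj (a # w) \<and> avoid w \<rho>"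
  by (induction w arbitrary: \<rho> a) (auto simp: allowed_def distinct_adj_Cons split: if_splits)

lemma sum_walk_mass_cylinder:
  assumes "w \<in> words r" "i \<le> r"
  shows "(\<Sum>w' | w' \<in> words r \<and> take i w' = take i w. walk_mass \<rho> a w') = walk_mass \<rho> a (take i w)"
proof -
  let ?u = "take i w"
  have len: "length ?u = i" using assms by (simp add: words_def)
  have eq: "{w' \<in> words r. take i w' = ?u} = (@) ?u ` words (r - i)"
  proof
    show "{w' \<in> words r. take i w' = ?u} \<subseteq> (@) ?u ` words (r - i)"
    proof
      fix w' assume w': "w' \<in> {w' \<in> words r. take i w' = ?u}"
      hence "w' = ?u @ drop i w'" by (metis (mono_tags, lifting) append_take_drop_id mem_Collect_eq)
      moreover have "drop i w' \<in> words (r - i)" using w' set_drop_subset[of i w'] by (auto simp: words_def)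
      ultimately show "w' \<in> (@) ?u ` words (r - i)" by blast
    qed
    show "(@) ?u ` words (r - i) \<subseteq> {w' \<in> words r. take i w' = ?u}"
      using assms len set_take_subset[of i w] by (fastforce simp: words_def)
  qed
  show ?thesis unfolding eq
    by (subst sum.reindex) (auto simp: inj_on_def walk_mass_append sum_walk_mass simp flip: sum_distrib_left)
qed

lemma walk_mass_le_visits: "walk_mass \<rho> a w \<le> (1 / (real d - 1)) ^ length w * 2 ^ visits \<rho> w"
proof (induction w arbitrary: \<rho> a)
  case (Cons c w)
  let ?n = "real (card (allowed \<rho> a))"
  have d': "real d - 1 > 0" using d by simp
  have n: "?n > 0" "real d - 1 \<le> ?n * 2 ^ of_bool (special \<rho>)"
    using card_allowed[of \<rho> a] d by (cases "special \<rho>"; simp)+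
  have inv: "1 / ?n \<le> 1 / (real d - 1) * 2 ^ of_bool (special \<rho>)"
    using n d' by (simp add: field_simps)
  have "walk_mass (base_step c \<rho>) c w / ?n = 1 / ?n * walk_mass (base_step c \<rho>) c w" by simp
  also have "\<dots> \<le> 1 / (real d - 1) * 2 ^ of_bool (special \<rho>) *
      ((1 / (real d - 1)) ^ length w * 2 ^ visits (base_step c \<rho>) w)"
    using d' by (intro mult_mono inv Cons.IH) auto
  also have "\<dots> = (1 / (real d - 1)) ^ length (c # w) * 2 ^ visits \<rho> (c # w)"
    by (simp add: power_add)
  finally show ?case using d' by (auto simp del: length_Cons visits.simps)
qed simp

lemma visits_card: "visits \<rho> w = card {i. i < length w \<and> special (fold base_step (take i w) \<rho>)}"
proof (induction w arbitrary: \<rho>)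
  case (Cons c w)
  let ?I = "{i. i < length w \<and> special (fold base_step (take i w) (base_step c \<rho>))}"
  have "{i. i < length (c # w) \<and> special (fold base_step (take i (c # w)) \<rho>)} =
      (if special \<rho> then {0} else {}) \<union> Suc ` ?I" (is "?L = ?R")
  proof (rule set_eqI)
    fix i show "i \<in> ?L \<longleftrightarrow> i \<in> ?R" by (cases i) auto
  qed
  moreover have "card ((if special \<rho> then {0} else {}) \<union> Suc ` ?I) =
      card (if special \<rho> then {0::nat} else {}) + card (Suc ` ?I)"
    by (rule card_Un_disjoint) auto
  ultimately show ?case using Cons by (simp add: card_image)
qed simp

text \<open>Between two visits to the ends of the marked edge the walk reads a reduced word that acts as
  the identity or as the marked edge itself, and such a word is long.\<close>

lemma special_gap:
  assumes "special \<rho>" "special (fold base_step v \<rho>)" "avoid v \<rho>" "distinct_adj v" "v \<noteq> []"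
  shows "g0 < length v"
proof (rule ccontr)
  assume "\<not> g0 < length v"
  hence v: "v \<in> tree_ball d g0" using assms avoid_set by (auto simp: tree_ball_def)
  have "0 < d" using d by simp
  have "word_perm d g0 v = id \<or> word_perm d g0 v = tree_swap d g0 0"
  proof -
    have "word_perm d g0 v = \<rho> \<circ> fold base_step v \<rho>"
      using assms(1) \<open>0 < d\<close> unfolding fold_base_step special_def by (auto simp: o_assoc)
    thus ?thesis using assms(1,2) \<open>0 < d\<close> by (auto simp: special_def)
  qed
  hence "v = [] \<or> v = [0]"
    using word_perm_Nil[OF v] g0 by (auto simp: tree_swap_def tree_ball_def)
  thus False using assms by auto
qed

lemma separated_card:
  assumes "I \<subseteq> {..<n}" "\<And>i j. i \<in> I \<Longrightarrow> j \<in> I \<Longrightarrow> i < j \<Longrightarrow> i + L \<le> j" "0 < L"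
  shows "L * card I \<le> n + L - 1"
proof -
  have fin: "finite I" using assms(1) finite_subset by blast
  have "L * card I = (\<Sum>i\<in>I. card {i..<i + L})" by simp
  also have "\<dots> = card (\<Union>i\<in>I. {i..<i + L})"
  proof (rule card_UN_disjoint[symmetric])
    show "\<forall>i\<in>I. \<forall>j\<in>I. i \<noteq> j \<longrightarrow> {i..<i + L} \<inter> {j..<j + L} = {}"
    proof (intro ballI impI)
      fix i j assume "i \<in> I" "j \<in> I" "i \<noteq> j"
      hence "i + L \<le> j \<or> j + L \<le> i" using assms(2) by (meson linorder_neqE_nat)
      thus "{i..<i + L} \<inter> {j..<j + L} = {}" by auto
    qed
  qed (use fin in auto)
  also have "\<dots> \<le> card {..<n + L - 1}"
  proof (rule card_mono)
    show "(\<Union>i\<in>I. {i..<i + L}) \<subseteq> {..<n + L - 1}"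
    proof
      fix x assume "x \<in> (\<Union>i\<in>I. {i..<i + L})"
      then obtain i where "i \<in> I" "x < i + L" by auto
      thus "x \<in> {..<n + L - 1}" using assms(1,3) by fastforce
    qed
  qed simp
  finally show ?thesis by simp
qed

lemma visits_le:
  assumes "walk_mass \<rho> a w \<noteq> 0"
  shows "(g0 + 1) * visits \<rho> w \<le> length w + g0"
proof -
  let ?I = "{i. i < length w \<and> special (fold base_step (take i w) \<rho>)}"
  from walk_mass_nonzero[OF assms] have w: "distinct_adj w" "avoid w \<rho>"
    by (auto simp: distinct_adj_Cons)
  have "(g0 + 1) * card ?I \<le> length w + (g0 + 1) - 1"
  proof (rule separated_card)
    fix i j assume ij: "i \<in> ?I" "j \<in> ?I" "i < j"
    let ?v = "drop i (take j w)"
    have tj: "take j w = take i w @ ?v" using append_take_drop_id[of i "take j w"] ij by (simp add: min_def)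
    have weq: "w = take i w @ ?v @ drop j w"
      using tj by (metis append.assoc append_take_drop_id)
    have "avoid (take i w @ ?v @ drop j w) \<rho>" using w(2) weq by simp
    hence av: "avoid ?v (fold base_step (take i w) \<rho>)" by (simp only: avoid_append)
    have "distinct_adj ?v" using w(1) weq distinct_adj_infix by metis
    moreover have "special (fold base_step ?v (fold base_step (take i w) \<rho>))"
      using ij tj by (metis (no_types, lifting) comp_apply fold_append mem_Collect_eq)
    ultimately have "g0 < length ?v"
      using ij av by (intro special_gap[of "fold base_step (take i w) \<rho>"]) auto
    thus "i + (g0 + 1) \<le> j" using ij by simp
  qed auto
  thus ?thesis by (simp add: visits_card)
qed

text \<open>A step from an end of the marked edge has possibly one choice less than the \<open>d - 1\<close> choices of a
  non-backtracking step, which costs a factor of at most \<open>2\<close>. This happens at most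
  once in \<open>g0 + 1\<close> steps.\<close>

definition growth :: real where
  "growth = (real d - 1) * 2 powr (- 1 / (real g0 + 1))"

lemma growth_pos: "growth > 0"
  using d by (simp add: growth_def)

lemma walk_mass_le: "walk_mass \<rho> a w \<le> 2 * (1 / growth) ^ length w"
proof (cases "walk_mass \<rho> a w = 0")
  case False
  let ?n = "length w" and ?L = "real g0 + 1"
  have "real ((g0 + 1) * visits \<rho> w) \<le> real (?n + g0)"
    using visits_le[OF False] by (rule of_nat_mono)
  hence "real (visits \<rho> w) * ?L \<le> ?n + ?L" by (simp add: algebra_simps)
  hence v: "real (visits \<rho> w) \<le> ?n / ?L + 1" by (simp add: field_simps)
  have "(2::real) ^ visits \<rho> w = 2 powr real (visits \<rho> w)" by (simp add: powr_realpow)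
  also have "\<dots> \<le> 2 powr (?n / ?L + 1)" using v by simp
  also have "\<dots> = 2 * (2 powr (1 / ?L)) ^ ?n"
    by (simp add: powr_add powr_power)
  finally have pow: "(2::real) ^ visits \<rho> w \<le> 2 * (2 powr (1 / ?L)) ^ ?n" .
  have "walk_mass \<rho> a w \<le> (1 / (real d - 1)) ^ ?n * 2 ^ visits \<rho> w" by (rule walk_mass_le_visits)
  also have "\<dots> \<le> (1 / (real d - 1)) ^ ?n * (2 * (2 powr (1 / ?L)) ^ ?n)"
    using d by (intro mult_left_mono[OF pow]) simp
  also have "\<dots> = 2 * (1 / growth) ^ ?n"
    by (simp add: growth_def powr_minus power_mult_distrib power_divide power_inverse divide_simps)
  finally show ?thesis .
qed (use growth_pos in simp)

end

section \<open>Percolation inside a piece\<close>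

text \<open>The Paley--Zygmund inequality. Instead of the Cauchy--Schwarz inequality, the proof uses
  \<open>2 * z \<le> s * z\<^sup>2 + 1 / s\<close> with a suitable constant \<open>s\<close>.\<close>

lemma mean_large_of_second_moment:
  fixes Z :: "'e set \<Rightarrow> real"
  assumes "finite E" "0 \<le> p" "p \<le> 1" "0 < a" "0 < b"
    and nonneg: "\<And>H. H \<subseteq> E \<Longrightarrow> 0 \<le> Z H"
    and m1: "a \<le> bond_mean p E Z" and m2: "bond_mean p E (\<lambda>H. (Z H)\<^sup>2) \<le> b"
  shows "a\<^sup>2 / (4 * b) \<le> bond_mean p E (\<lambda>H. of_bool (a / 2 \<le> Z H))"
proof -
  \<comment> \<open>With this constant, the term \<open>s / 2 * b\<close> of the bound below equals \<open>a / 4\<close>.\<close>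
  define s where "s = a / (2 * b)"
  have s: "s > 0" using assms by (simp add: s_def)
  let ?P = "bond_mean p E (\<lambda>H. of_bool (a / 2 \<le> Z H))"
  have "bond_mean p E Z \<le> bond_mean p E (\<lambda>H. a / 2 + (s / 2 * (Z H)\<^sup>2 + 1 / (2 * s) * of_bool (a / 2 \<le> Z H)))"
  proof (intro bond_mean_mono assms)
    fix H assume H: "H \<subseteq> E"
    show "Z H \<le> a / 2 + (s / 2 * (Z H)\<^sup>2 + 1 / (2 * s) * of_bool (a / 2 \<le> Z H))"
    proof (cases "a / 2 \<le> Z H")
      case True
      have "0 \<le> (s * Z H - 1)\<^sup>2" by simp
      hence "2 * s * Z H \<le> s * (s * (Z H)\<^sup>2) + 1" by (simp add: power2_eq_square algebra_simps)
      hence "Z H \<le> s / 2 * (Z H)\<^sup>2 + 1 / (2 * s)" using s by (simp add: field_simps)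
      thus ?thesis using True assms(4) by simp
    next
      case False
      have "0 \<le> s / 2 * (Z H)\<^sup>2" using s by simp
      hence "Z H \<le> a / 2 + s / 2 * (Z H)\<^sup>2" using False by linarith
      thus ?thesis using False by simp
    qed
  qed
  also have "\<dots> = a / 2 + (s / 2 * bond_mean p E (\<lambda>H. (Z H)\<^sup>2) + 1 / (2 * s) * ?P)"
    using assms(1) by (simp add: bond_mean_add bond_mean_cmult del: times_divide_eq_left)
  also have "\<dots> \<le> a / 2 + (s / 2 * b + 1 / (2 * s) * ?P)"
    using m2 s by (intro add_left_mono add_right_mono mult_left_mono) auto
  finally have "a \<le> a / 2 + (s / 2 * b + 1 / (2 * s) * ?P)" using m1 by linarith
  moreover have "s / 2 * b = a / 4" "1 / (2 * s) = b / a" using assms by (auto simp: s_def)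
  ultimately have "a \<le> a / 2 + (a / 4 + b / a * ?P)" by (simp only:)
  hence "a / 4 \<le> b / a * ?P" by linarith
  thus ?thesis using assms by (simp add: field_simps power2_eq_square)
qed

context tree_base
begin

definition piece_step :: "nat \<Rightarrow> nat \<Rightarrow> piece_vertex
    \<Rightarrow> piece_vertex" where
  "piece_step g c f = (fst f \<circ> tree_swap d g c, base_step c (snd f))"

lemma snd_piece_step [simp]: "snd (piece_step g c f) = base_step c (snd f)"
  by (simp add: piece_step_def)

lemma piece_step_piece_step [simp]: "c < d \<Longrightarrow> piece_step g c (piece_step g c f) = f"
  by (simp add: piece_step_def o_assoc[symmetric])

lemma snd_fold_piece_step [simp]: "snd (fold (piece_step g) w f) = fold base_step w (snd f)"
  by (induction w arbitrary: f) auto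

lemma fst_fold_piece_step: "fst (fold (piece_step g) w f) = fst f \<circ> word_perm d g w"
  by (induction w arbitrary: f) (auto simp: piece_step_def o_assoc)

lemma fold_piece_step_rev: "set w \<subseteq> {..<d} \<Longrightarrow> fold (piece_step g) (rev w) (fold (piece_step g) w f) = f"
  by (induction w arbitrary: f) auto

definition piece_verts :: "nat \<Rightarrow> piece_vertex set" where
  "piece_verts g = {fold (piece_step g) z (id, id) | z. avoid z id}"

definition piece_edges :: "nat \<Rightarrow> piece_vertex set set" where
  "piece_edges g = {{f, piece_step g c f} | f c. f \<in> piece_verts g \<and> c < d \<and> \<not> (c = 0 \<and> special (snd f))}"

definition uports :: "nat \<Rightarrow> piece_vertex set" where
  "uports g = {f \<in> piece_verts g. snd f = id}"

definition vports :: "nat \<Rightarrow> piece_vertex set" where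
  "vports g = {f \<in> piece_verts g. snd f = tree_swap d g0 0}"

text \<open>The walk around the marked edge, lifted to the piece, matches the two kinds of ports. It
  shows that there are equally many of both, and it is a short path from
  each port to its partner.\<close>

definition kappa :: "nat \<Rightarrow> piece_vertex
    \<Rightarrow> piece_vertex" where
  "kappa g = fold (piece_step g) around"

lemma piece_verts_snd: "f \<in> piece_verts g \<Longrightarrow> snd f \<in> base_verts"
  unfolding piece_verts_def base_verts_def by auto

lemma piece_verts_fst: "f \<in> piece_verts g \<Longrightarrow> fst f permutes tree_ball d g"
  unfolding piece_verts_def by (auto simp: fst_fold_piece_step intro!: word_perm_permutes dest: subsetD[OF avoid_set])

lemma finite_piece_verts: "finite (piece_verts g)"
  by (rule finite_subset[of _ "{\<pi>. \<pi> permutes tree_ball d g} \<times> base_verts"])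
    (use piece_verts_fst piece_verts_snd finite_base_verts finite_permutations[OF finite_tree_ball] in \<open>auto simp: mem_Times_iff\<close>)

lemma id_piece_verts: "(id, id) \<in> piece_verts g"
  unfolding piece_verts_def by (auto intro!: exI[of _ "[]"])

lemma piece_verts_fold: "f \<in> piece_verts g \<Longrightarrow> avoid w (snd f) \<Longrightarrow> fold (piece_step g) w f \<in> piece_verts g"
proof -
  assume "f \<in> piece_verts g" "avoid w (snd f)"
  then obtain z where z: "avoid z id" "f = fold (piece_step g) z (id, id)" by (auto simp: piece_verts_def)
  hence "avoid (z @ w) id \<and> fold (piece_step g) w f = fold (piece_step g) (z @ w) (id, id)"
    using \<open>avoid w (snd f)\<close> by (simp add: avoid_append)
  thus ?thesis unfolding piece_verts_def by blast
qed

lemma piece_verts_piece_step: "f \<in> piece_verts g \<Longrightarrow> c < d \<Longrightarrow> \<not> (c = 0 \<and> special (snd f)) \<Longrightarrow> piece_step g c f \<in> piece_verts g"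
  using piece_verts_fold[of f g "[c]"] by simp

lemma kappa_bij: "bij_betw (kappa g) (uports g) (vports g)"
proof (rule bij_betwI[where g = "fold (piece_step g) (rev around)"])
  have z: "set around \<subseteq> {..<d}" using avoid_set around(1) by blast
  note rz = avoid_rev[OF around(1), unfolded around(2)]
  show "kappa g \<in> uports g \<rightarrow> vports g"
    unfolding uports_def vports_def kappa_def using around piece_verts_fold by auto
  show "fold (piece_step g) (rev around) \<in> vports g \<rightarrow> uports g"
    unfolding uports_def vports_def using rz piece_verts_fold by auto
  show "fold (piece_step g) (rev around) (kappa g f) = f" for f
    unfolding kappa_def by (rule fold_piece_step_rev[OF z])
  show "kappa g (fold (piece_step g) (rev around) f) = f" for f
    unfolding kappa_def using fold_piece_step_rev[of "rev around" g f] z by simp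
qed

primrec trail :: "nat \<Rightarrow> piece_vertex \<Rightarrow> nat list
    \<Rightarrow> piece_vertex set set" where
  "trail g f [] = {}"
| "trail g f (c # w) = insert {f, piece_step g c f} (trail g (piece_step g c f) w)"

lemma finite_trail [simp]: "finite (trail g f w)"
  by (induction w arbitrary: f) auto

lemma card_trail: "card (trail g f w) \<le> length w"
proof (induction w arbitrary: f)
  case (Cons c w)
  have "card (trail g f (c # w)) \<le> Suc (card (trail g (piece_step g c f) w))"
    by (simp add: card_insert_if)
  thus ?case using Cons[of "piece_step g c f"] by simp
qed simp

lemma piece_edgesI:
  "f \<in> piece_verts g \<Longrightarrow> c < d \<Longrightarrow> \<not> (c = 0 \<and> special (snd f)) \<Longrightarrow> {f, piece_step g c f} \<in> piece_edges g"
  unfolding piece_edges_def by blast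

lemma trail_subset: "f \<in> piece_verts g \<Longrightarrow> avoid w (snd f) \<Longrightarrow> trail g f w \<subseteq> piece_edges g"
proof (induction w arbitrary: f)
  case (Cons c w)
  have "{f, piece_step g c f} \<in> piece_edges g" using Cons.prems by (intro piece_edgesI) auto
  moreover have "trail g (piece_step g c f) w \<subseteq> piece_edges g"
    using Cons.prems piece_verts_piece_step by (intro Cons.IH) auto
  ultimately show ?case by simp
qed simp

lemma trail_joined: "trail g f w \<subseteq> H \<Longrightarrow> (f, fold (piece_step g) w f) \<in> joined H"
proof (induction w arbitrary: f)
  case (Cons c w)
  hence "(f, piece_step g c f) \<in> joined H" by (intro joined_edge) auto
  moreover have "(piece_step g c f, fold (piece_step g) w (piece_step g c f)) \<in> joined H"
    using Cons by simp
  ultimately show ?case using joined_trans by fastforce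
qed simp

lemma finite_piece_edges: "finite (piece_edges g)"
proof -
  have "piece_edges g \<subseteq> (\<lambda>(f, c). {f, piece_step g c f}) ` (piece_verts g \<times> {..<d})" by (auto simp: piece_edges_def)
  thus ?thesis using finite_piece_verts finite_subset by blast
qed

lemma piece_verts_joined:
  assumes "f \<in> piece_verts g" "f' \<in> piece_verts g"
  shows "(f, f') \<in> joined (piece_edges g)"
proof -
  have root: "((id, id), f) \<in> joined (piece_edges g)" if f: "f \<in> piece_verts g" for f
  proof -
    obtain z where "avoid z id" "f = fold (piece_step g) z (id, id)" using f by (auto simp: piece_verts_def)
    thus ?thesis using trail_joined trail_subset[OF id_piece_verts, of z g] by auto
  qed
  show ?thesis by (rule joined_trans[OF joined_sym[OF root] root]) (use assms in auto)
qed

text \<open>Locally the piece is a tree: short reduced words lead to distinct vertices.\<close>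

lemma fold_piece_step_inj_tree_ball:
  assumes "f \<in> piece_verts g"
  shows "inj_on (\<lambda>u. fold (piece_step g) u f) (tree_ball d g)"
proof (rule inj_onI)
  fix u v assume uv: "u \<in> tree_ball d g" "v \<in> tree_ball d g" "fold (piece_step g) u f = fold (piece_step g) v f"
  hence "(fst f \<circ> word_perm d g u) [] = (fst f \<circ> word_perm d g v) []" by (simp flip: fst_fold_piece_step)
  hence "fst f u = fst f v" using word_perm_Nil uv by simp
  thus "u = v" using piece_verts_fst[OF assms] by (auto dest: permutes_inj injD)
qed

lemma trail_image:
  "trail g f w = (\<lambda>u. {fold (piece_step g) (butlast u) f, fold (piece_step g) u f}) ` (\<lambda>i. take (Suc i) w) ` {..<length w}"
proof (induction w arbitrary: f)
  case (Cons c w)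
  let ?e = "\<lambda>f u. {fold (piece_step g) (butlast u) f, fold (piece_step g) u f}"
  have "(\<lambda>i. take (Suc i) (c # w)) ` {..<length (c # w)} = insert [c] ((\<lambda>u. c # u) ` (\<lambda>i. take (Suc i) w) ` {..<length w})"
    by (simp only: length_Cons lessThan_Suc_eq_insert_0) (simp add: image_image)
  hence "?e f ` (\<lambda>i. take (Suc i) (c # w)) ` {..<length (c # w)} =
      insert {f, piece_step g c f} (?e f ` (\<lambda>u. c # u) ` (\<lambda>i. take (Suc i) w) ` {..<length w})"
    by simp
  also have "?e f ` (\<lambda>u. c # u) ` (\<lambda>i. take (Suc i) w) ` {..<length w} =
      ?e (piece_step g c f) ` (\<lambda>i. take (Suc i) w) ` {..<length w}"
    unfolding image_image by (intro image_cong) auto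
  finally show ?case using Cons by simp
qed simp

text \<open>The length of the longest common prefix, as the number of common nonempty prefixes.\<close>

definition agree :: "nat list \<Rightarrow> nat list \<Rightarrow> nat" where
  "agree w w' = card {i. i < length w \<and> take (Suc i) w = take (Suc i) w'}"

text \<open>Two paths in a tree from the same vertex share exactly the edges of their common prefix.\<close>

lemma card_trail_union:
  assumes "f \<in> piece_verts g" "w \<in> tree_ball d g" "w' \<in> tree_ball d g" "length w' = length w"
  shows "card (trail g f w \<union> trail g f w') = 2 * length w - agree w w'"
proof -
  let ?\<epsilon> = "\<lambda>u. {fold (piece_step g) (butlast u) f, fold (piece_step g) u f}"
  define P where "P w = (\<lambda>i. take (Suc i) w) ` {..<length w}" for w :: "nat list"
  have take_tree_ball: "take i v \<in> tree_ball d g" if "v \<in> tree_ball d g" for i v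
    using that set_take_subset[of i v] distinct_adj_appendD1[of "take i v" "drop i v"]
    by (auto simp: tree_ball_def)
  have P: "P v \<subseteq> tree_ball d g - {[]}" if "v \<in> tree_ball d g" for v
    using take_tree_ball[OF that] by (auto simp: P_def)
  have inj_take: "inj_on (\<lambda>i. take (Suc i) v) {..<length v}" for v :: "nat list"
    by (rule inj_on_inverseI[where g = "\<lambda>u. length u - 1"]) auto
  have inj: "inj_on ?\<epsilon> (tree_ball d g - {[]})"
  proof (rule inj_onI)
    fix u v assume uv: "u \<in> tree_ball d g - {[]}" "v \<in> tree_ball d g - {[]}" "?\<epsilon> u = ?\<epsilon> v"
    have b: "butlast u \<in> tree_ball d g" "butlast v \<in> tree_ball d g"
      using uv take_tree_ball by (auto simp: butlast_conv_take)
    have "(butlast u = butlast v \<and> u = v) \<or> (butlast u = v \<and> u = butlast v)"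
      using uv b fold_piece_step_inj_tree_ball[OF assms(1)] unfolding doubleton_eq_iff by (auto dest: inj_onD)
    moreover have "\<not> (butlast u = v \<and> u = butlast v)"
    proof
      assume "butlast u = v \<and> u = butlast v"
      hence "length v = length u - 1" "length u = length v - 1" by (metis length_butlast)+
      moreover have "length u > 0" using uv by auto
      ultimately show False by linarith
    qed
    ultimately show "u = v" by blast
  qed
  have sub: "P w \<union> P w' \<subseteq> tree_ball d g - {[]}" using P assms by blast
  have "trail g f w \<union> trail g f w' = ?\<epsilon> ` (P w \<union> P w')"
    by (simp add: trail_image P_def image_Un)
  hence un: "card (trail g f w \<union> trail g f w') = card (P w \<union> P w')"
    using card_image[OF inj_on_subset[OF inj sub]] by simp
  have inter: "P w \<inter> P w' = (\<lambda>i. take (Suc i) w) ` {i. i < length w \<and> take (Suc i) w = take (Suc i) w'}"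
  proof
    show "P w \<inter> P w' \<subseteq> (\<lambda>i. take (Suc i) w) ` {i. i < length w \<and> take (Suc i) w = take (Suc i) w'}"
    proof
      fix u assume "u \<in> P w \<inter> P w'"
      hence "u \<in> P w" "u \<in> P w'" by auto
      from \<open>u \<in> P w\<close> obtain i where i: "u = take (Suc i) w" "i < length w" unfolding P_def by blast
      from \<open>u \<in> P w'\<close> obtain j where j: "u = take (Suc j) w'" "j < length w"
        unfolding P_def using assms(4) by auto
      note ij = i j
      have "length u = Suc i" using i by simp
      moreover have "length u = Suc j" using j assms(4) by simp
      ultimately have "i = j" by simp
      thus "u \<in> (\<lambda>i. take (Suc i) w) ` {i. i < length w \<and> take (Suc i) w = take (Suc i) w'}"
        using ij by force
    qed
    show "(\<lambda>i. take (Suc i) w) ` {i. i < length w \<and> take (Suc i) w = take (Suc i) w'} \<subseteq> P w \<inter> P w'"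
    proof
      fix u assume "u \<in> (\<lambda>i. take (Suc i) w) ` {i. i < length w \<and> take (Suc i) w = take (Suc i) w'}"
      then obtain i where i: "u = take (Suc i) w" "i < length w" "take (Suc i) w = take (Suc i) w'"
        by auto
      have "u \<in> P w" unfolding P_def using i(1,2) by blast
      moreover have "u = take (Suc i) w'" using i by simp
      hence "u \<in> P w'" unfolding P_def using i(2) assms(4) by auto
      ultimately show "u \<in> P w \<inter> P w'" by blast
    qed
  qed
  have cap: "card (P w \<inter> P w') = agree w w'"
    unfolding agree_def inter by (rule card_image, rule inj_on_subset[OF inj_take[of w]]) auto
  have "card (P w) + card (P w') = card (P w \<union> P w') + card (P w \<inter> P w')"
    by (rule card_Un_Int) (auto simp: P_def)
  moreover have "card (P w) = length w" "card (P w') = length w"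
    using card_image[OF inj_take[of w]] card_image[OF inj_take[of w']] assms(4) by (auto simp: P_def)
  ultimately show ?thesis using cap un by linarith
qed

lemma agree_take: "agree w w' \<le> length w" "take (agree w w') w = take (agree w w') w'"
proof -
  let ?J = "{i. i < length w \<and> take (Suc i) w = take (Suc i) w'}"
  show "agree w w' \<le> length w"
    unfolding agree_def using card_mono[of "{..<length w}" ?J] by auto
  show "take (agree w w') w = take (agree w w') w'"
  proof (cases "?J = {}")
    case True
    thus ?thesis unfolding agree_def by (metis card.empty take0)
  next
    case False
    have fin: "finite ?J" by auto
    let ?m = "Max ?J"
    have m: "?m \<in> ?J" using False fin by (rule Max_in[rotated])
    have "?J \<subseteq> {..?m}" using fin by auto
    hence "card ?J \<le> Suc ?m" using card_mono[of "{..?m}" ?J] by simp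
    hence le: "agree w w' \<le> Suc ?m" by (simp add: agree_def)
    have eq: "take (Suc ?m) w = take (Suc ?m) w'" using m by blast
    have "take (agree w w') w = take (agree w w') (take (Suc ?m) w)" using le by (simp add: min_def)
    also have "\<dots> = take (agree w w') w'" unfolding eq using le by (simp add: min_def)
    finally show ?thesis .
  qed
qed

text \<open>Let \<open>Z\<close> be the number of open reduced paths of length \<open>r\<close>, weighted by \<open>walk_mass\<close> and
  normalised by \<open>p ^ r\<close>, where a path counts only if it extends by a bounded open walk to a port
  whose partner is joined to it. The extension changes the mean by a constant factor.
  Two paths that share \<open>i\<close> edges contribute \<open>p ^ (- i)\<close> to the second moment; the second path
  has total weight at most \<open>2 * growth ^ (- i)\<close>, so the sum over \<open>i\<close> is a convergent
  geometric series. Hence \<open>Z\<close> is bounded below with a probability that does not depend on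
  \<open>r\<close>. As every single path has weight at most
  \<open>2 * (growth * p) ^ (- r)\<close> in \<open>Z\<close>, there are then exponentially many paths.\<close>

theorem piece_percolation:
  assumes p: "0 < p" "p < 1" "1 < growth * p"
  shows "\<exists>\<theta>>0. \<forall>K. \<exists>g. \<forall>x\<in>uports g. \<theta> \<le> bond_mean p (piece_edges g) (\<lambda>H. of_bool
    ((x, kappa g x) \<in> joined H \<and> K \<le> card {j\<in>uports g. (x, j) \<in> joined H \<and> (j, kappa g j) \<in> joined H}))"
proof -
  define q where "q = growth * p"
  define \<Delta> where "\<Delta> = max_return + 2 * length around"
  define a where "a = p ^ \<Delta>"
  define b where "b = 2 / (1 - 1 / q)"
  have q: "q > 1" using p by (simp add: q_def)
  have a: "a > 0" using p by (simp add: a_def)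
  have b: "b > 0" using q by (simp add: b_def field_simps)
  have cr: "card base_verts > 0" using finite_base_verts base_verts_id by (auto simp: card_gt_0_iff)
  have "\<exists>g. \<forall>x\<in>uports g. a\<^sup>2 / (4 * b) \<le> bond_mean p (piece_edges g) (\<lambda>H. of_bool
    ((x, kappa g x) \<in> joined H \<and> K \<le> card {j\<in>uports g. (x, j) \<in> joined H \<and> (j, kappa g j) \<in> joined H}))" for K
  proof -
    define M where "M = K * card base_verts"
    \<comment> \<open>Each port is reached from at most \<open>card base_verts\<close> path ends, one for each image in the base graph.\<close>
    obtain r where r: "4 * real M / a < q ^ r" using real_arch_pow[OF q] by blast
    have "a\<^sup>2 / (4 * b) \<le> bond_mean p (piece_edges r) (\<lambda>H. of_bool
      ((x, kappa r x) \<in> joined H \<and> K \<le> card {j\<in>uports r. (x, j) \<in> joined H \<and> (j, kappa r j) \<in> joined H}))"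
      if x: "x \<in> uports r" for x
    proof -
      define W where "W = {w \<in> words r. walk_mass id d w \<noteq> 0}"
      define tip where "tip w = fold (piece_step r) w x" for w
      define port where "port w = fold (piece_step r) (return_word (snd (tip w))) (tip w)" for w
      define ev where "ev w = trail r x w \<union> (trail r (tip w) (return_word (snd (tip w))) \<union> (trail r (port w) around \<union> trail r x around))" for w
      have xv: "x \<in> piece_verts r" "snd x = id" using x by (auto simp: uports_def)
      have finW: "finite W" by (simp add: W_def)
      have W: "length w = r" "w \<in> tree_ball d r" "avoid w (snd x)" if w: "w \<in> W" for w
        using w walk_mass_nonzero[of id d w] xv by (auto simp: W_def words_def tree_ball_def distinct_adj_Cons)
      have tip: "tip w \<in> piece_verts r" "snd (tip w) \<in> base_verts" if w: "w \<in> W" for w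
      proof -
        show "tip w \<in> piece_verts r" unfolding tip_def using piece_verts_fold[OF xv(1) W(3)[OF w]] .
        thus "snd (tip w) \<in> base_verts" by (rule piece_verts_snd)
      qed
      have port: "port w \<in> piece_verts r" "snd (port w) = id" if w: "w \<in> W" for w
        using tip[OF w] return_word[OF tip(2)[OF w]] piece_verts_fold unfolding port_def by auto
      have ev_sub: "ev w \<subseteq> piece_edges r" if w: "w \<in> W" for w
        unfolding ev_def using W(3)[OF w] tip[OF w] return_word(1)[OF tip(2)[OF w]] port[OF w] xv around(1)
        by (intro Un_least trail_subset) auto
      have fin_ev: "finite (ev w)" for w by (simp add: ev_def)
      have card_ev: "card (ev w) \<le> r + \<Delta>" if w: "w \<in> W" for w
      proof -
        have "card (ev w) \<le> card (trail r x w) + (card (trail r (tip w) (return_word (snd (tip w)))) +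
            (card (trail r (port w) around) + card (trail r x around)))"
          unfolding ev_def by (intro order_trans[OF card_Un_le] add_left_mono) simp
        also have "\<dots> \<le> r + (max_return + (length around + length around))"
          using card_trail[of r x w] card_trail[of r "tip w" "return_word (snd (tip w))"]
            card_trail[of r "port w" around] card_trail[of r x around] length_return_word[OF tip(2)[OF w]] W(1)[OF w]
          by linarith
        finally show ?thesis by (simp add: \<Delta>_def)
      qed
      let ?m = "walk_mass id d"
      define Z where "Z H = (\<Sum>w\<in>W. ?m w * (1 / p) ^ r * of_bool (ev w \<subseteq> H))" for H
      have sumW: "(\<Sum>w\<in>W. ?m w) = 1"
      proof -
        have "(\<Sum>w\<in>W. ?m w) = (\<Sum>w\<in>words r. ?m w)"
          by (rule sum.mono_neutral_left) (auto simp: W_def)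
        thus ?thesis by (simp add: sum_walk_mass)
      qed
      have m1: "a \<le> bond_mean p (piece_edges r) Z"
      proof -
        have "a = (\<Sum>w\<in>W. ?m w) * a" by (simp add: sumW)
        also have "\<dots> = (\<Sum>w\<in>W. ?m w * (1 / p) ^ r * p ^ (r + \<Delta>))"
          unfolding sum_distrib_right using p by (intro sum.cong refl) (simp add: a_def power_add power_divide)
        also have "\<dots> \<le> (\<Sum>w\<in>W. ?m w * (1 / p) ^ r * p ^ card (ev w))"
          using p card_ev by (intro sum_mono mult_left_mono power_decreasing) auto
        also have "\<dots> = bond_mean p (piece_edges r) Z"
          unfolding Z_def bond_mean_sum
          by (intro sum.cong refl) (simp add: bond_mean_cmult bond_mean_all_open[OF finite_piece_edges ev_sub])
        finally show ?thesis .
      qed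
      have pair: "bond_mean p (piece_edges r) (\<lambda>H. of_bool (ev w \<subseteq> H) * of_bool (ev w' \<subseteq> H)) \<le>
          p ^ (2 * r) * (1 / p) ^ agree w w'" if w: "w \<in> W" "w' \<in> W" for w w'
      proof -
        have "bond_mean p (piece_edges r) (\<lambda>H. of_bool (ev w \<subseteq> H) * of_bool (ev w' \<subseteq> H)) =
            bond_mean p (piece_edges r) (\<lambda>H. of_bool (ev w \<union> ev w' \<subseteq> H))"
          by (intro bond_mean_cong) simp
        also have "\<dots> = p ^ card (ev w \<union> ev w')"
          by (rule bond_mean_all_open[OF finite_piece_edges]) (use ev_sub w in auto)
        also have "\<dots> \<le> p ^ card (trail r x w \<union> trail r x w')"
          using p fin_ev by (intro power_decreasing card_mono) (auto simp: ev_def)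
        also have "card (trail r x w \<union> trail r x w') = 2 * r - agree w w'"
          using card_trail_union[OF xv(1) W(2)[OF w(1)] W(2)[OF w(2)]] W(1) w by simp
        also have "p ^ (2 * r - agree w w') = p ^ (2 * r) * (1 / p) ^ agree w w'"
          using agree_take(1)[of w w'] W(1)[OF w(1)] p by (simp add: power_diff power_divide)
        finally show ?thesis .
      qed
      have agree_le: "(1 / p) ^ agree w w' \<le> (\<Sum>i\<le>r. of_bool (take i w' = take i w) * (1 / p) ^ i)"
        if w: "w \<in> W" for w w'
      proof -
        have "(1 / p) ^ agree w w' = (\<Sum>i\<in>{agree w w'}. of_bool (take i w' = take i w) * (1 / p) ^ i)"
          using agree_take(2)[of w w'] by simp
        also have "\<dots> \<le> (\<Sum>i\<le>r. of_bool (take i w' = take i w) * (1 / p) ^ i)"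
          using agree_take(1)[of w w'] W(1)[OF w] p by (intro sum_mono2) auto
        finally show ?thesis .
      qed
      have m2: "bond_mean p (piece_edges r) (\<lambda>H. (Z H)\<^sup>2) \<le> b"
      proof -
        have "bond_mean p (piece_edges r) (\<lambda>H. (Z H)\<^sup>2) = (\<Sum>w\<in>W. \<Sum>w'\<in>W. ?m w * ?m w' * (1 / p) ^ (2 * r) *
            bond_mean p (piece_edges r) (\<lambda>H. of_bool (ev w \<subseteq> H) * of_bool (ev w' \<subseteq> H)))"
          unfolding Z_def power2_eq_square sum_product bond_mean_sum bond_mean_cmult[symmetric]
          by (intro sum.cong refl bond_mean_cong) (simp add: mult_2 power_add)
        also have "\<dots> \<le> (\<Sum>w\<in>W. \<Sum>w'\<in>W. ?m w * ?m w' * (1 / p) ^ (2 * r) * (p ^ (2 * r) * (1 / p) ^ agree w w'))"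
          using p by (intro sum_mono mult_left_mono pair) auto
        also have "\<dots> = (\<Sum>w\<in>W. \<Sum>w'\<in>W. ?m w * ?m w' * (1 / p) ^ agree w w')"
          using p by (intro sum.cong refl) (simp add: power_divide)
        also have "\<dots> \<le> (\<Sum>w\<in>W. \<Sum>w'\<in>W. ?m w * ?m w' * (\<Sum>i\<le>r. of_bool (take i w' = take i w) * (1 / p) ^ i))"
          by (intro sum_mono mult_left_mono agree_le) auto
        also have "\<dots> = (\<Sum>w\<in>W. \<Sum>w'\<in>W. \<Sum>i\<le>r. (1 / p) ^ i * (?m w * (?m w' * of_bool (take i w' = take i w))))"
          by (simp only: sum_distrib_left mult_ac)
        also have "\<dots> = (\<Sum>w\<in>W. \<Sum>i\<le>r. \<Sum>w'\<in>W. (1 / p) ^ i * (?m w * (?m w' * of_bool (take i w' = take i w))))"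
          by (intro sum.cong refl sum.swap)
        also have "\<dots> = (\<Sum>i\<le>r. \<Sum>w\<in>W. \<Sum>w'\<in>W. (1 / p) ^ i * (?m w * (?m w' * of_bool (take i w' = take i w))))"
          by (rule sum.swap)
        also have "\<dots> = (\<Sum>i\<le>r. (1 / p) ^ i * (\<Sum>w\<in>W. ?m w * (\<Sum>w'\<in>W. ?m w' * of_bool (take i w' = take i w))))"
          by (simp add: sum_distrib_left)
        also have "\<dots> \<le> (\<Sum>i\<le>r. (1 / p) ^ i * (\<Sum>w\<in>W. ?m w * (2 * (1 / growth) ^ i)))"
        proof (intro sum_mono mult_left_mono)
          fix i w assume i: "i \<in> {..r}" and w: "w \<in> W"
          have "(\<Sum>w'\<in>W. ?m w' * of_bool (take i w' = take i w)) =
              (\<Sum>w' | w' \<in> W \<and> take i w' = take i w. ?m w')"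
            using finW by (simp add: of_bool_def sum.inter_filter mult.commute if_distrib cong: if_cong)
          also have "\<dots> \<le> (\<Sum>w' | w' \<in> words r \<and> take i w' = take i w. ?m w')"
            by (rule sum_mono2) (auto simp: W_def)
          also have "\<dots> = ?m (take i w)"
            by (rule sum_walk_mass_cylinder) (use i w in \<open>auto simp: W_def\<close>)
          also have "\<dots> \<le> 2 * (1 / growth) ^ i"
            using walk_mass_le[of id d "take i w"] W(1)[OF w] i by simp
          finally show "(\<Sum>w'\<in>W. ?m w' * of_bool (take i w' = take i w)) \<le> 2 * (1 / growth) ^ i" .
        qed (use p in auto)
        also have "\<dots> = (\<Sum>i\<le>r. 2 * (1 / q) ^ i)"
          by (intro sum.cong refl) (simp only: sum_distrib_right[symmetric] sumW, simp add: q_def power_divide power_mult_distrib)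
        also have "\<dots> = 2 * (\<Sum>i<Suc r. (1 / q) ^ i)" by (simp add: sum_distrib_left lessThan_Suc_atMost)
        also have "\<dots> \<le> 2 * (1 / (1 - 1 / q))"
        proof (intro mult_left_mono)
          have "(\<Sum>i<Suc r. (1 / q) ^ i) = (1 - (1 / q) ^ Suc r) / (1 - 1 / q)"
            using q by (subst sum_gp_strict) auto
          also have "\<dots> \<le> 1 / (1 - 1 / q)" using q by (intro divide_right_mono) auto
          finally show "(\<Sum>i<Suc r. (1 / q) ^ i) \<le> 1 / (1 - 1 / q)" .
        qed simp
        finally show ?thesis by (simp add: b_def)
      qed
      have "a\<^sup>2 / (4 * b) \<le> bond_mean p (piece_edges r) (\<lambda>H. of_bool (a / 2 \<le> Z H))"
      proof (rule mean_large_of_second_moment[OF finite_piece_edges _ _ a b _ m1 m2])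
        show "0 \<le> Z H" for H unfolding Z_def using p by (intro sum_nonneg) auto
      qed (use p in auto)
      also have "\<dots> \<le> bond_mean p (piece_edges r) (\<lambda>H. of_bool ((x, kappa r x) \<in> joined H \<and>
          K \<le> card {j\<in>uports r. (x, j) \<in> joined H \<and> (j, kappa r j) \<in> joined H}))"
      proof (intro bond_mean_mono)
        fix H
        let ?L = "{j\<in>uports r. (x, j) \<in> joined H \<and> (j, kappa r j) \<in> joined H}"
        have "(x, kappa r x) \<in> joined H \<and> K \<le> card ?L" if large: "a / 2 \<le> Z H"
        proof -
          define N where "N = {w\<in>W. ev w \<subseteq> H}"
          have finN: "finite N" using finW by (simp add: N_def)
          have "Z H = (\<Sum>w\<in>N. ?m w * (1 / p) ^ r)"
            unfolding Z_def N_def using finW by (simp add: of_bool_def sum.inter_filter if_distrib cong: if_cong)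
          also have "\<dots> \<le> (\<Sum>w\<in>N. 2 * (1 / growth) ^ r * (1 / p) ^ r)"
          proof (intro sum_mono mult_right_mono)
            fix w assume "w \<in> N"
            hence "length w = r" using W(1) by (simp add: N_def)
            thus "?m w \<le> 2 * (1 / growth) ^ r" using walk_mass_le[of id d w] by simp
          qed (use p in auto)
          also have "\<dots> = real (card N) * (2 / q ^ r)"
            by (simp add: q_def power_mult_distrib power_divide)
          finally have "a / 2 \<le> real (card N) * (2 / q ^ r)" using large by linarith
          hence N: "a / 4 * q ^ r \<le> real (card N)" using q by (simp add: field_simps)
          have "real M < a / 4 * q ^ r" using r a by (simp add: field_simps)
          hence MN: "M \<le> card N" using N by linarith
          have "0 < a / 4 * q ^ r" using a q by simp
          hence "0 < card N" using N by linarith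
          then obtain w0 where "w0 \<in> N" by (auto simp: card_gt_0_iff)
          hence "trail r x around \<subseteq> H" by (auto simp: N_def ev_def)
          hence xk: "(x, kappa r x) \<in> joined H" using trail_joined unfolding kappa_def by blast
          have inj: "inj_on (\<lambda>w. (port w, snd (tip w))) N"
          proof (rule inj_onI)
            fix w w' assume w: "w \<in> N" "w' \<in> N" "(port w, snd (tip w)) = (port w', snd (tip w'))"
            hence wW: "w \<in> W" "w' \<in> W" by (auto simp: N_def)
            have turn: "fold (piece_step r) (rev (return_word (snd (tip v)))) (port v) = tip v" if v: "v \<in> W" for v
              unfolding port_def by (rule fold_piece_step_rev) (rule avoid_set[OF return_word(1)[OF tip(2)[OF v]]])
            have eqs: "port w = port w'" "snd (tip w) = snd (tip w')" using w(3) by auto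
            have "tip w = fold (piece_step r) (rev (return_word (snd (tip w)))) (port w)"
              by (rule turn[OF wW(1), symmetric])
            also have "\<dots> = fold (piece_step r) (rev (return_word (snd (tip w')))) (port w')" by (simp only: eqs)
            also have "\<dots> = tip w'" by (rule turn[OF wW(2)])
            finally have "tip w = tip w'" .
            thus "w = w'" using fold_piece_step_inj_tree_ball[OF xv(1)] W(2)[OF wW(1)] W(2)[OF wW(2)]
              by (auto simp: tip_def dest: inj_onD)
          qed
          have img: "(\<lambda>w. (port w, snd (tip w))) ` N \<subseteq> ?L \<times> base_verts"
          proof
            fix z assume "z \<in> (\<lambda>w. (port w, snd (tip w))) ` N"
            then obtain w where w: "w \<in> N" "z = (port w, snd (tip w))" by auto
            hence wW: "w \<in> W" and sub: "ev w \<subseteq> H" by (auto simp: N_def)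
            have "(x, tip w) \<in> joined H" unfolding tip_def by (rule trail_joined) (use sub in \<open>auto simp: ev_def\<close>)
            moreover have "(tip w, port w) \<in> joined H"
              unfolding port_def by (rule trail_joined) (use sub in \<open>auto simp: ev_def\<close>)
            moreover have "(port w, kappa r (port w)) \<in> joined H"
              unfolding kappa_def by (rule trail_joined) (use sub in \<open>auto simp: ev_def\<close>)
            ultimately show "z \<in> ?L \<times> base_verts"
              using port[OF wW] tip[OF wW] w(2) joined_trans by (auto simp: uports_def)
          qed
          have finL: "finite ?L" using finite_piece_verts by (simp add: uports_def)
          have "card N \<le> card (?L \<times> base_verts)"
            by (rule card_inj_on_le[OF inj img]) (use finL finite_base_verts in simp)
          also have "\<dots> = card ?L * card base_verts" by (rule card_cartesian_product)
          finally have "K * card base_verts \<le> card ?L * card base_verts" using MN unfolding M_def by linarith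
          hence "K \<le> card ?L" using cr by simp
          thus ?thesis using xk by blast
        qed
        thus "(of_bool (a / 2 \<le> Z H) :: real) \<le> of_bool ((x, kappa r x) \<in> joined H \<and> K \<le> card ?L)"
          by auto
      qed (use p in auto)
      finally show ?thesis .
    qed
    thus ?thesis by blast
  qed
  moreover have "a\<^sup>2 / (4 * b) > 0" using a b by simp
  ultimately show ?thesis by blast
qed

end

section \<open>Graphs given by coloured involutions\<close>

definition coloured :: "nat \<Rightarrow> (nat \<Rightarrow> 'v \<Rightarrow> 'v) \<Rightarrow> 'v set \<Rightarrow> 'v ugraph" where
  "coloured d nb X = UGraph X {{x, nb c x} | x c. x \<in> X \<and> c < d}"

text \<open>A graph whose edges are the orbits of \<open>d\<close> involutions. A single assumption on closed
  walks of length at most \<open>g0 \<ge> 2\<close> makes it simple (length \<open>1\<close>), \<open>d\<close>-regular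
  (length \<open>2\<close>) and of large girth.\<close>

locale coloured_graph =
  fixes d g0 :: nat and nb :: "nat \<Rightarrow> 'v \<Rightarrow> 'v" and X :: "'v set"
  assumes finX: "finite X" and X_ne: "X \<noteq> {}" and g0_ge: "2 \<le> g0"
    and nb_in: "\<And>c x. x \<in> X \<Longrightarrow> c < d \<Longrightarrow> nb c x \<in> X"
    and nb_nb: "\<And>c x. x \<in> X \<Longrightarrow> c < d \<Longrightarrow> nb c (nb c x) = x"
    and no_short: "\<And>x w. x \<in> X \<Longrightarrow> w \<noteq> [] \<Longrightarrow> distinct_adj w \<Longrightarrow> set w \<subseteq> {..<d} \<Longrightarrow> length w \<le> g0 \<Longrightarrow>
      fold nb w x \<noteq> x"
begin

lemma nb_neq: "x \<in> X \<Longrightarrow> c < d \<Longrightarrow> nb c x \<noteq> x"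
  using no_short[of x "[c]"] g0_ge by simp

lemma nb_inj: "x \<in> X \<Longrightarrow> c < d \<Longrightarrow> c' < d \<Longrightarrow> nb c x = nb c' x \<Longrightarrow> c = c'"
  using no_short[of x "[c, c']"] nb_nb[of x c'] g0_ge by auto

lemma simple: "finite_simple_graph (coloured d nb X)"
  unfolding finite_simple_graph_def coloured_def
  using finX X_ne nb_in nb_neq by (auto simp: card_2_iff) metis

lemma edge_colour:
  assumes "{u, v} \<in> edges (coloured d nb X)"
  obtains c where "c < d" "nb c u = v" "u \<in> X" "v \<in> X"
proof -
  obtain x c where xc: "{u, v} = {x, nb c x}" "x \<in> X" "c < d" using assms by (auto simp: coloured_def)
  hence "(u = x \<and> v = nb c x) \<or> (u = nb c x \<and> v = x)" by (simp add: doubleton_eq_iff)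
  thus thesis using xc nb_nb nb_in that by auto
qed

lemma degree_eq: 
  assumes "v \<in> X" shows "degree (coloured d nb X) v = d"
proof -
  have "{e \<in> edges (coloured d nb X). v \<in> e} = (\<lambda>c. {v, nb c v}) ` {..<d}"
  proof
    show "{e \<in> edges (coloured d nb X). v \<in> e} \<subseteq> (\<lambda>c. {v, nb c v}) ` {..<d}"
    proof
      fix e assume "e \<in> {e \<in> edges (coloured d nb X). v \<in> e}"
      then obtain x c where xc: "e = {x, nb c x}" "x \<in> X" "c < d" "v = x \<or> v = nb c x" by (auto simp: coloured_def)
      hence "e = {v, nb c v}" using nb_nb by auto
      thus "e \<in> (\<lambda>c. {v, nb c v}) ` {..<d}" using xc by blast
    qed
  qed (use assms in \<open>auto simp: coloured_def\<close>)
  moreover have "inj_on (\<lambda>c. {v, nb c v}) {..<d}"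
  proof (rule inj_onI)
    fix c c' assume c: "c \<in> {..<d}" "c' \<in> {..<d}" "{v, nb c v} = {v, nb c' v}"
    hence "nb c v = nb c' v" using nb_neq[of v c] assms by (auto simp: doubleton_eq_iff)
    thus "c = c'" using nb_inj assms c by auto
  qed
  ultimately show ?thesis by (simp add: degree_def card_image)
qed

lemma max_degree_eq: "max_degree (coloured d nb X) = d"
proof -
  have "degree (coloured d nb X) ` verts (coloured d nb X) = {d}"
    using degree_eq X_ne by (auto simp: coloured_def image_iff)
  thus ?thesis by (simp add: max_degree_def)
qed

lemma cycle_long:
  assumes "is_cycle (coloured d nb X) vs"
  shows "g0 < length vs"
proof (rule ccontr)
  assume short: "\<not> g0 < length vs"
  define n where "n = length vs"
  have n: "3 \<le> n" "distinct vs" "\<And>i. i < n \<Longrightarrow> {vs ! i, vs ! (Suc i mod n)} \<in> edges (coloured d nb X)"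
    using assms by (auto simp: is_cycle_def n_def)
  have "\<exists>c. c < d \<and> nb c (vs ! i) = vs ! (Suc i mod n) \<and> vs ! i \<in> X" if "i < n" for i
    using edge_colour[OF n(3)[OF that]] by metis
  then obtain c where c: "\<And>i. i < n \<Longrightarrow> c i < d" "\<And>i. i < n \<Longrightarrow> nb (c i) (vs ! i) = vs ! (Suc i mod n)"
    "\<And>i. i < n \<Longrightarrow> vs ! i \<in> X" by metis
  define w where "w = map c [0..<n]"
  have fold_take: "fold nb (take i w) (vs ! 0) = vs ! (i mod n)" if "i \<le> n" for i
    using that
  proof (induction i)
    case (Suc i)
    have "take (Suc i) w = take i w @ [c i]" using Suc.prems by (simp add: w_def take_Suc_conv_app_nth)
    thus ?case using Suc c(2)[of i] by simp
  qed simp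
  have "fold nb w (vs ! 0) = vs ! 0" using fold_take[of n] n(1) by (simp add: w_def)
  moreover have "distinct_adj w"
    unfolding distinct_adj_conv_nth
  proof (intro allI impI)
    fix i assume "Suc i < length w"
    hence i: "Suc i < n" by (auto simp: w_def)
    show "w ! i \<noteq> w ! Suc i"
    proof
      assume "w ! i = w ! Suc i"
      hence "c i = c (Suc i)" using i by (simp add: w_def)
      hence "vs ! (Suc (Suc i) mod n) = nb (c i) (nb (c i) (vs ! i))" using c(2)[of i] c(2)[of "Suc i"] i by simp
      also have "\<dots> = vs ! i" by (rule nb_nb) (use c i in auto)
      finally have eq: "vs ! (Suc (Suc i) mod n) = vs ! i" .
      have "Suc (Suc i) mod n < n" using n(1) by simp
      hence "Suc (Suc i) mod n = i"
        using eq n(1,2) i nth_eq_iff_index_eq[of vs "Suc (Suc i) mod n" i] by (simp add: n_def)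
      thus False using i n(1) by (cases "Suc (Suc i) = n") auto
    qed
  qed
  moreover have "vs ! 0 \<in> X" by (rule c(3)) (use n(1) in simp)
  moreover have "w \<noteq> []" "set w \<subseteq> {..<d}" "length w \<le> g0"
    using n(1) c(1) short by (auto simp: w_def n_def)
  ultimately show False using no_short by blast
qed

lemma girth_ge: "enat g0 \<le> girth (coloured d nb X)"
  unfolding girth_def using cycle_long by (intro INF_greatest) (auto intro: less_imp_le)

end

lemma exists_sorted_by_card:
  assumes "finite A"
  shows "\<exists>Cs. set Cs = A \<and> distinct Cs \<and> sorted_wrt (\<lambda>A B. card B \<le> card A) Cs"
proof -
  obtain xs where xs: "set xs = A" "distinct xs" using finite_distinct_list[OF assms] by blast
  define ys where "ys = rev (sort_key card xs)"
  have "sorted (map card (sort_key card xs))" by simp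
  hence "sorted_wrt (\<lambda>A B. card A \<le> card B) (sort_key card xs)" by (simp add: sorted_map)
  hence "sorted_wrt (\<lambda>A B. card B \<le> card A) ys" by (simp add: ys_def sorted_wrt_rev)
  moreover have "set ys = A" "distinct ys" using xs by (auto simp: ys_def)
  ultimately show ?thesis by blast
qed

lemma joined_closed:
  assumes "(a, b) \<in> joined H" "a \<in> S" "\<And>u v. {u, v} \<in> H \<Longrightarrow> u \<in> S \<Longrightarrow> v \<in> S"
  shows "b \<in> S"
  using assms(1,2) unfolding joined_def by (induction rule: rtrancl_induct) (use assms(3) in auto)

text \<open>Two sets that are connected internally and separated by a closed set \<open>S\<close> lie in distinct
  components, so the second one in any ordering by size is at least as large as the smaller set.\<close>

lemma second_component_ge:
  assumes fin: "finite V" and HV: "\<And>u v. {u, v} \<in> H \<Longrightarrow> u \<in> V \<and> v \<in> V"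
    and X: "X1 \<subseteq> V" "X2 \<subseteq> V" "X1 \<noteq> {}" "X2 \<noteq> {}" "t \<le> card X1" "t \<le> card X2"
    and conn: "\<And>u v. u \<in> X1 \<Longrightarrow> v \<in> X1 \<Longrightarrow> (u, v) \<in> joined H" "\<And>u v. u \<in> X2 \<Longrightarrow> v \<in> X2 \<Longrightarrow> (u, v) \<in> joined H"
    and S: "X1 \<subseteq> S" "X2 \<inter> S = {}" "\<And>u v. {u, v} \<in> H \<Longrightarrow> u \<in> S \<Longrightarrow> v \<in> S"
  shows "t \<le> card (nth_component (UGraph V H) 2)"
proof -
  let ?G = "UGraph V H"
  let ?r = "connectivity ?G"
  have r: "?r = joined H \<inter> V \<times> V" by (simp add: connectivity_def joined_def)
  obtain x1 x2 where x: "x1 \<in> X1" "x2 \<in> X2" using X by blast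
  define C1 where "C1 = ?r `` {x1}"
  define C2 where "C2 = ?r `` {x2}"
  have C: "C1 \<in> graph_components ?G" "C2 \<in> graph_components ?G"
    using x X by (auto simp: C1_def C2_def graph_components_def quotient_def)
  have sub: "C1 \<subseteq> V" "C2 \<subseteq> V" by (auto simp: C1_def C2_def r)
  have "X1 \<subseteq> C1" "X2 \<subseteq> C2" using x X conn by (auto simp: C1_def C2_def r)
  hence card: "t \<le> card C1" "t \<le> card C2"
    using X card_mono[of C1 X1] card_mono[of C2 X2] sub fin finite_subset by (meson order_trans)+
  have "C1 \<subseteq> S" using joined_closed[of x1 _ H S] S x by (auto simp: C1_def r)
  moreover have "x2 \<in> C2" "x2 \<notin> S" using x X S by (auto simp: C2_def r)
  ultimately have ne: "C1 \<noteq> C2" by blast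
  have fin_comp: "finite (graph_components ?G)"
    using fin by (auto simp: graph_components_def r intro: finite_quotient)
  define Cs where "Cs = ordered_components ?G"
  have "set Cs = graph_components ?G \<and> distinct Cs \<and> sorted_wrt (\<lambda>A B. card B \<le> card A) Cs"
    unfolding Cs_def ordered_components_def by (rule someI_ex) (rule exists_sorted_by_card[OF fin_comp])
  hence Cs: "set Cs = graph_components ?G" "sorted_wrt (\<lambda>A B. card B \<le> card A) Cs" by auto
  obtain i j where ij: "i < length Cs" "Cs ! i = C1" "j < length Cs" "Cs ! j = C2"
    using C Cs(1) by (metis in_set_conv_nth)
  have "i \<noteq> j" using ij ne by auto
  then obtain k where k: "1 \<le> k" "k < length Cs" "t \<le> card (Cs ! k)"
    using ij card by (metis One_nat_def Suc_leI neq0_conv)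
  have "card (Cs ! k) \<le> card (Cs ! 1)"
  proof (cases "k = 1")
    case False
    thus ?thesis using sorted_wrt_nth_less[OF Cs(2), of 1 k] k by simp
  qed simp
  hence "t \<le> card (Cs ! 1)" using k by simp
  moreover have "nth_component ?G 2 = Cs ! 1" using k by (simp add: nth_component_def Let_def flip: Cs_def)
  ultimately show ?thesis by simp
qed

section \<open>Wiring copies of the piece together\<close>

lemma joined_image:
  assumes "(a, b) \<in> joined H"
  shows "(h a, h b) \<in> joined ((`) h ` H)"
  using assms unfolding joined_def
proof (induction rule: rtrancl_induct)
  case (step b c)
  have "{h b, h c} = h ` {b, c}" by simp
  hence "{h b, h c} \<in> (`) h ` H" using step(2) by blast
  thus ?case using step(3) by (auto intro: rtrancl.rtrancl_into_rtrancl)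
qed simp

text \<open>Numbers as names of the ports of a piece. The labels \<open>0\<close>, \<open>1\<close>, \<open>2\<close> are reserved
  for the edges of the forest, all others are free for the random matching and for the
  expander at the top.\<close>

locale labelled = tree_base +
  fixes g D :: nat and lab :: "nat \<Rightarrow> piece_vertex"
  assumes lab: "bij_betw lab {..<D} (uports g)"
begin

definition label_of :: "piece_vertex \<Rightarrow> nat" where
  "label_of = the_inv_into {..<D} lab"

definition kappa_inv :: "piece_vertex \<Rightarrow> piece_vertex" where
  "kappa_inv = fold (piece_step g) (rev around)"

lemma label_of_lab [simp]: "k < D \<Longrightarrow> label_of (lab k) = k"
  unfolding label_of_def using lab by (intro the_inv_into_f_f) (auto simp: bij_betw_def)

lemma lab_uports: "k < D \<Longrightarrow> lab k \<in> uports g"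
  using lab by (auto simp: bij_betw_def)

lemma lab_piece_verts: "k < D \<Longrightarrow> lab k \<in> piece_verts g"
  using lab_uports by (auto simp: uports_def)

lemma snd_lab [simp]: "k < D \<Longrightarrow> snd (lab k) = id"
  using lab_uports by (auto simp: uports_def)

lemma kappa_lab: "k < D \<Longrightarrow> kappa g (lab k) \<in> vports g"
  using kappa_bij[of g] lab_uports by (auto simp: bij_betw_def)

lemma kappa_piece_verts: "k < D \<Longrightarrow> kappa g (lab k) \<in> piece_verts g"
  using kappa_lab by (auto simp: vports_def)

lemma snd_kappa [simp]: "k < D \<Longrightarrow> snd (kappa g (lab k)) = tree_swap d g0 0"
  using kappa_lab by (auto simp: vports_def)

lemma kappa_inv_kappa [simp]: "kappa_inv (kappa g f) = f"
  unfolding kappa_inv_def kappa_def using fold_piece_step_rev avoid_set[OF around(1)] by blast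

lemma id_neq [simp]: "tree_swap d g0 0 \<noteq> id" "id \<noteq> tree_swap d g0 0"
  using base_step_neq[OF base_verts_id, of 0] d by (auto simp: base_step_def)

lemma uports_lab: "f \<in> uports g \<Longrightarrow> \<exists>k<D. f = lab k"
  using lab by (auto simp: bij_betw_def)

lemma vports_lab: "f \<in> vports g \<Longrightarrow> \<exists>k<D. f = kappa g (lab k)"
proof -
  assume "f \<in> vports g"
  hence "f \<in> kappa g ` uports g" using bij_betw_imp_surj_on[OF kappa_bij[of g]] by simp
  then obtain u where "u \<in> uports g" "f = kappa g u" by blast
  thus ?thesis using uports_lab by blast
qed

text \<open>A good label has both of its ports in one cluster together with many other such labels.
  Joining the two ports of a label lets a cluster be treated as a set of labels, whichever of the two
  ports an edge arrives at.\<close>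

definition good_labels :: "nat \<Rightarrow> piece_vertex set set \<Rightarrow> nat set" where
  "good_labels K H = {k \<in> {3..<D}. (lab k, kappa g (lab k)) \<in> joined H \<and>
     K \<le> card {j \<in> {3..<D}. (lab k, lab j) \<in> joined H \<and> (lab j, kappa g (lab j)) \<in> joined H}}"

definition label_cluster :: "piece_vertex set set \<Rightarrow> nat
    \<Rightarrow> piece_vertex set" where
  "label_cluster H k = joined H `` {lab k}"

lemma label_cluster_eq: "label_cluster H j = label_cluster H k \<longleftrightarrow> (lab k, lab j) \<in> joined H"
proof
  assume eq: "label_cluster H j = label_cluster H k"
  have "lab j \<in> label_cluster H j" by (simp add: label_cluster_def)
  thus "(lab k, lab j) \<in> joined H" unfolding eq by (simp add: label_cluster_def)
next
  assume a: "(lab k, lab j) \<in> joined H"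
  have "(lab j, x) \<in> joined H \<longleftrightarrow> (lab k, x) \<in> joined H" for x
    using joined_trans[OF a, of x] joined_trans[OF joined_sym[OF a], of x] by blast
  thus "label_cluster H j = label_cluster H k" by (auto simp: label_cluster_def)
qed

lemma good_clusters:
  assumes "k \<in> good_labels K H" shows "K \<le> card {j \<in> good_labels K H. label_cluster H j = label_cluster H k}"
proof -
  let ?L = "\<lambda>k. {j \<in> {3..<D}. (lab k, lab j) \<in> joined H \<and> (lab j, kappa g (lab j)) \<in> joined H}"
  have "?L k \<subseteq> {j \<in> good_labels K H. label_cluster H j = label_cluster H k}"
  proof
    fix j assume j: "j \<in> ?L k"
    have kj: "(lab k, lab j) \<in> joined H" using j by blast
    have "(lab j, x) \<in> joined H \<longleftrightarrow> (lab k, x) \<in> joined H" for x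
      using joined_trans[OF kj, of x] joined_trans[OF joined_sym[OF kj], of x] by blast
    hence "?L j = ?L k" by simp
    thus "j \<in> {j \<in> good_labels K H. label_cluster H j = label_cluster H k}" using j assms by (simp add: good_labels_def label_cluster_eq)
  qed
  hence "card (?L k) \<le> card {j \<in> good_labels K H. label_cluster H j = label_cluster H k}"
    by (intro card_mono) (auto simp: good_labels_def)
  thus ?thesis using assms by (simp add: good_labels_def)
qed

lemma good_prob:
  assumes p: "0 \<le> p" "p \<le> 1" and k: "k \<in> {3..<D}"
    and \<theta>: "\<And>x. x \<in> uports g \<Longrightarrow> \<theta> \<le> bond_mean p (piece_edges g) (\<lambda>H. of_bool
    ((x, kappa g x) \<in> joined H \<and> K + 3 \<le> card {j\<in>uports g. (x, j) \<in> joined H \<and> (j, kappa g j) \<in> joined H}))"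
  shows "\<theta> \<le> bond_mean p (piece_edges g) (\<lambda>H. of_bool (k \<in> good_labels K H))"
proof -
  have "\<theta> \<le> bond_mean p (piece_edges g) (\<lambda>H. of_bool
    ((lab k, kappa g (lab k)) \<in> joined H \<and> K + 3 \<le> card {j\<in>uports g. (lab k, j) \<in> joined H \<and> (j, kappa g j) \<in> joined H}))"
    by (rule \<theta>) (use k lab_uports in auto)
  also have "\<dots> \<le> bond_mean p (piece_edges g) (\<lambda>H. of_bool (k \<in> good_labels K H))"
  proof (intro bond_mean_mono p)
    fix H
    let ?U = "{j\<in>uports g. (lab k, j) \<in> joined H \<and> (j, kappa g j) \<in> joined H}"
    let ?L = "{j \<in> {3..<D}. (lab k, lab j) \<in> joined H \<and> (lab j, kappa g (lab j)) \<in> joined H}"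
    have "?U \<subseteq> lab ` (?L \<union> {..<3})"
    proof
      fix u assume u: "u \<in> ?U"
      then obtain j where "j < D" "u = lab j" using uports_lab by blast
      thus "u \<in> lab ` (?L \<union> {..<3})" using u by (cases "j < 3") auto
    qed
    hence "card ?U \<le> card (lab ` (?L \<union> {..<3}))" by (intro card_mono) auto
    also have "\<dots> \<le> card (?L \<union> {..<3})" by (rule card_image_le) simp
    also have "\<dots> \<le> card ?L + 3" using card_Un_le[of ?L "{..<3}"] by simp
    finally have "card ?U \<le> card ?L + 3" .
    thus "(of_bool ((lab k, kappa g (lab k)) \<in> joined H \<and> K + 3 \<le> card ?U) :: real) \<le> of_bool (k \<in> good_labels K H)"
      using k by (simp add: good_labels_def)
  qed
  finally show ?thesis .
qed

end

text \<open>The edges of the wired graph: \<open>Inl (y, e)\<close> is the copy at \<open>y\<close> of the edge \<open>e\<close> of the piece,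
  and \<open>Inr (y, k)\<close> is the edge that leaves \<open>y\<close> through the port with label \<open>k\<close>.\<close>

type_synonym 'y bond = "('y \<times> piece_vertex set) + ('y \<times> nat)"

text \<open>The port \<open>k\<close> of the first kind at \<open>y\<close> is joined to the port of the second kind whose site and
  label are given by \<open>\<tau> (y, k)\<close>.\<close>

locale wired = labelled +
  fixes Y :: "'y set" and \<tau> :: "'y \<times> nat \<Rightarrow> 'y \<times> nat"
  assumes finY: "finite Y" and Y_ne: "Y \<noteq> {}" and \<tau>: "\<tau> permutes Y \<times> {..<D}"
begin

definition wired_verts :: "('y \<times> piece_vertex) set" where
  "wired_verts = Y \<times> piece_verts g"

definition nb :: "nat \<Rightarrow> 'y \<times> piece_vertex
    \<Rightarrow> 'y \<times> piece_vertex" where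
  "nb c x = (if c = 0 \<and> snd (snd x) = id then
       (fst (\<tau> (fst x, label_of (snd x))), kappa g (lab (snd (\<tau> (fst x, label_of (snd x))))))
     else if c = 0 \<and> snd (snd x) = tree_swap d g0 0 then
       (fst (inv \<tau> (fst x, label_of (kappa_inv (snd x)))), lab (snd (inv \<tau> (fst x, label_of (kappa_inv (snd x))))))
     else (fst x, piece_step g c (snd x)))"

lemma \<tau>_in: "y \<in> Y \<Longrightarrow> k < D \<Longrightarrow> fst (\<tau> (y, k)) \<in> Y \<and> snd (\<tau> (y, k)) < D"
  using permutes_in_image[OF \<tau>, of "(y, k)"] by (auto simp: mem_Times_iff)

lemma inv\<tau>_in: "y \<in> Y \<Longrightarrow> k < D \<Longrightarrow> fst (inv \<tau> (y, k)) \<in> Y \<and> snd (inv \<tau> (y, k)) < D"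
  using permutes_in_image[OF permutes_inv[OF \<tau>], of "(y, k)"] by (auto simp: mem_Times_iff)

lemma nb_u: "k < D \<Longrightarrow> nb 0 (y, lab k) = (fst (\<tau> (y, k)), kappa g (lab (snd (\<tau> (y, k)))))"
  by (simp add: nb_def)

lemma nb_v: "k < D \<Longrightarrow> nb 0 (y, kappa g (lab k)) = (fst (inv \<tau> (y, k)), lab (snd (inv \<tau> (y, k))))"
  by (simp add: nb_def)

lemma nb_inner: "\<not> (c = 0 \<and> special (snd f)) \<Longrightarrow> nb c (y, f) = (y, piece_step g c f)"
  by (auto simp: nb_def special_def)

lemma vertex_cases:
  assumes "x \<in> wired_verts" "c < d"
  obtains (inner) y f where "x = (y, f)" "y \<in> Y" "f \<in> piece_verts g" "\<not> (c = 0 \<and> special (snd f))"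
  | (u) y k where "x = (y, lab k)" "y \<in> Y" "k < D" "c = 0"
  | (v) y k where "x = (y, kappa g (lab k))" "y \<in> Y" "k < D" "c = 0"
proof -
  obtain y f where x: "x = (y, f)" "y \<in> Y" "f \<in> piece_verts g" using assms by (auto simp: wired_verts_def)
  show thesis
  proof (cases "c = 0 \<and> special (snd f)")
    case True
    hence "f \<in> uports g \<or> f \<in> vports g" using x by (auto simp: special_def uports_def vports_def)
    thus thesis using uports_lab vports_lab u v x True by blast
  qed (use inner x in blast)
qed

lemma nb_wired_verts: "x \<in> wired_verts \<Longrightarrow> c < d \<Longrightarrow> nb c x \<in> wired_verts"
  by (erule (1) vertex_cases)
    (auto simp: nb_u nb_v nb_inner wired_verts_def \<tau>_in inv\<tau>_in kappa_piece_verts lab_piece_verts piece_verts_piece_step)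

lemma nb_nb: "x \<in> wired_verts \<Longrightarrow> c < d \<Longrightarrow> nb c (nb c x) = x"
proof (erule (1) vertex_cases)
  fix y f assume c: "c < d" and x: "x = (y, f)" "f \<in> piece_verts g" "\<not> (c = 0 \<and> special (snd f))"
  have "\<not> (c = 0 \<and> special (snd (piece_step g c f)))" using x by auto
  thus "nb c (nb c x) = x" using c x by (simp add: nb_inner del: snd_piece_step)
next
  fix y k assume x: "x = (y, lab k)" "y \<in> Y" "k < D" "c = 0"
  have "inv \<tau> (\<tau> (y, k)) = (y, k)" by (rule permutes_inverses(2)[OF \<tau>])
  thus "nb c (nb c x) = x" using x \<tau>_in by (simp add: nb_u nb_v)
next
  fix y k assume x: "x = (y, kappa g (lab k))" "y \<in> Y" "k < D" "c = 0"
  have "\<tau> (inv \<tau> (y, k)) = (y, k)" by (rule permutes_inverses(1)[OF \<tau>])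
  thus "nb c (nb c x) = x" using x inv\<tau>_in by (simp add: nb_u nb_v)
qed

lemma nb_proj: "x \<in> wired_verts \<Longrightarrow> c < d \<Longrightarrow> snd (snd (nb c x)) = base_step c (snd (snd x))"
  using d by (elim vertex_cases) (auto simp: nb_u nb_v nb_inner \<tau>_in inv\<tau>_in base_step_def)

lemma fold_nb: "x \<in> wired_verts \<Longrightarrow> set w \<subseteq> {..<d} \<Longrightarrow>
    fold nb w x \<in> wired_verts \<and> snd (snd (fold nb w x)) = fold base_step w (snd (snd x))"
  by (induction w arbitrary: x) (auto simp: nb_wired_verts nb_proj)

text \<open>Every closed walk projects to a closed walk in the base graph with the same colours.\<close>

lemma no_short_closed_walk:
  assumes "x \<in> wired_verts" "w \<noteq> []" "distinct_adj w" "set w \<subseteq> {..<d}" "length w \<le> g0"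
  shows "fold nb w x \<noteq> x"
proof
  assume "fold nb w x = x"
  hence eq: "snd (snd x) \<circ> word_perm d g0 w = snd (snd x)"
    using fold_nb[OF assms(1,4)] by (simp add: fold_base_step)
  have "snd (snd x) \<in> base_verts" using assms(1) piece_verts_snd by (auto simp: wired_verts_def)
  hence "inj (snd (snd x))" using base_verts_permutes permutes_inj by blast
  moreover have "snd (snd x) (word_perm d g0 w []) = snd (snd x) []" using eq by (simp add: fun_eq_iff)
  ultimately have "word_perm d g0 w [] = []" by (auto dest: injD)
  moreover have "w \<in> tree_ball d g0" using assms by (simp add: tree_ball_def)
  ultimately show False using word_perm_Nil assms(2) by metis
qed

lemma finite_wired_verts: "finite wired_verts"
  using finY finite_piece_verts by (simp add: wired_verts_def)

lemma wired_verts_ne: "wired_verts \<noteq> {}"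
  using Y_ne id_piece_verts by (auto simp: wired_verts_def)

definition bonds :: "'y bond set" where
  "bonds = (Y \<times> piece_edges g) <+> (Y \<times> {..<D})"

definition bond_ends :: "'y bond
    \<Rightarrow> ('y \<times> piece_vertex) set" where
  "bond_ends i = (case i of Inl (y, e) \<Rightarrow> Pair y ` e | Inr (y, k) \<Rightarrow> {(y, lab k), nb 0 (y, lab k)})"

lemma bond_ends_simps [simp]: "bond_ends (Inl (y, e)) = Pair y ` e" "bond_ends (Inr (y, k)) = {(y, lab k), nb 0 (y, lab k)}"
  by (simp_all add: bond_ends_def)

lemma finite_bonds: "finite bonds"
  using finY finite_piece_edges by (simp add: bonds_def)

lemma bond_ends_wired_verts: assumes "i \<in> bonds" shows "bond_ends i \<subseteq> wired_verts"
proof (cases i)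
  case (Inl ye)
  thus ?thesis using assms by (auto simp: bonds_def wired_verts_def piece_edges_def piece_verts_piece_step)
next
  case (Inr yk)
  then obtain y k where k: "i = Inr (y, k)" "y \<in> Y" "k < D" using assms by (cases yk) (auto simp: bonds_def)
  hence "(y, lab k) \<in> wired_verts" using lab_piece_verts by (simp add: wired_verts_def)
  thus ?thesis using nb_wired_verts[of "(y, lab k)" 0] d k(1) by simp
qed

lemma edgeI: "x \<in> wired_verts \<Longrightarrow> c < d \<Longrightarrow> {x, nb c x} \<in> edges (coloured d nb wired_verts)"
  unfolding coloured_def ugraph.sel by blast

lemma edges_bond_ends: "edges (coloured d nb wired_verts) = bond_ends ` bonds"
proof
  show "edges (coloured d nb wired_verts) \<subseteq> bond_ends ` bonds"
  proof
    fix e assume "e \<in> edges (coloured d nb wired_verts)"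
    then obtain x c where xc: "e = {x, nb c x}" "x \<in> wired_verts" "c < d" by (auto simp: coloured_def)
    from xc(2,3) show "e \<in> bond_ends ` bonds"
    proof (cases rule: vertex_cases)
      case (inner y f)
      hence "e = bond_ends (Inl (y, {f, piece_step g c f}))" using xc by (simp add: nb_inner)
      moreover have "Inl (y, {f, piece_step g c f}) \<in> bonds" using inner xc(3) by (auto simp: bonds_def intro: piece_edgesI)
      ultimately show ?thesis by blast
    next
      case (u y k)
      hence "e = bond_ends (Inr (y, k))" using xc by simp
      moreover have "Inr (y, k) \<in> bonds" using u by (auto simp: bonds_def)
      ultimately show ?thesis by blast
    next
      case (v y k)
      obtain y' k' where yk: "inv \<tau> (y, k) = (y', k')" by fastforce
      have in': "y' \<in> Y" "k' < D" using inv\<tau>_in[OF v(2,3)] yk by auto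
      have "nb 0 x = (y', lab k')" using v yk by (simp add: nb_v)
      moreover have "nb 0 (y', lab k') = x" using nb_nb[OF xc(2), of 0] xc(3) v(4) calculation by simp
      ultimately have "e = bond_ends (Inr (y', k'))" using xc v by (simp add: insert_commute)
      moreover have "Inr (y', k') \<in> bonds" using in' by (auto simp: bonds_def)
      ultimately show ?thesis by blast
    qed
  qed
  show "bond_ends ` bonds \<subseteq> edges (coloured d nb wired_verts)"
  proof
    fix e assume "e \<in> bond_ends ` bonds"
    then obtain i where i: "i \<in> bonds" "e = bond_ends i" by blast
    show "e \<in> edges (coloured d nb wired_verts)"
    proof (cases i)
      case (Inl ye)
      then obtain y f c where f: "i = Inl (y, {f, piece_step g c f})" "y \<in> Y" "f \<in> piece_verts g" "c < d"
          "\<not> (c = 0 \<and> special (snd f))"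
        using i(1) by (cases ye) (auto simp: bonds_def piece_edges_def)
      have "e = {(y, f), nb c (y, f)}" using f i by (simp add: nb_inner)
      moreover have "(y, f) \<in> wired_verts" using f by (simp add: wired_verts_def)
      ultimately show ?thesis using edgeI f(4) by simp
    next
      case (Inr yk)
      then obtain y k where k: "i = Inr (y, k)" "y \<in> Y" "k < D" using i(1) by (cases yk) (auto simp: bonds_def)
      have "e = {(y, lab k), nb 0 (y, lab k)}" using k i by simp
      moreover have "(y, lab k) \<in> wired_verts" using k lab_piece_verts by (simp add: wired_verts_def)
      ultimately show ?thesis using edgeI[of _ 0] d by simp
    qed
  qed
qed

lemma base_step_id_0: "c < d \<Longrightarrow> base_step c id = tree_swap d g0 0 \<Longrightarrow> c = 0"
proof -
  assume "c < d" "base_step c id = tree_swap d g0 0"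
  hence "tree_swap d g0 c [] = tree_swap d g0 0 []" by (simp add: base_step_def)
  thus ?thesis using g0 by (simp add: tree_swap_def tree_ball_def)
qed

lemma inner_port_disjoint:
  assumes "e \<in> piece_edges g" "k < D" "k' < D"
  shows "{lab k, kappa g (lab k')} \<noteq> e"
proof
  assume eq: "{lab k, kappa g (lab k')} = e"
  obtain f c where f: "e = {f, piece_step g c f}" "c < d" "\<not> (c = 0 \<and> special (snd f))"
    using assms by (auto simp: piece_edges_def)
  consider "f = lab k" "piece_step g c f = kappa g (lab k')" | "f = kappa g (lab k')" "piece_step g c f = lab k"
    using eq f by (auto simp: doubleton_eq_iff)
  thus False
  proof cases
    case 1
    hence "base_step c id = tree_swap d g0 0" using snd_piece_step[of g c f] assms by simp
    hence "c = 0" by (rule base_step_id_0[OF f(2)])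
    thus False using f(3) 1 assms by (simp add: special_def)
  next
    case 2
    hence "base_step c (tree_swap d g0 0) = id" using snd_piece_step[of g c f] assms by simp
    hence "base_step c id = tree_swap d g0 0" using base_step_base_step[OF f(2), of "tree_swap d g0 0"] by simp
    hence "c = 0" by (rule base_step_id_0[OF f(2)])
    thus False using f(3) 2 assms by (simp add: special_def)
  qed
qed

lemma inj_bond_ends: "inj_on bond_ends bonds"
proof (rule inj_onI)
  have mixed: False if "Inl (y, e) \<in> bonds" "Inr (y', k) \<in> bonds" "Pair y ` e = {(y', lab k), nb 0 (y', lab k)}" for y e y' k
  proof -
    have k: "y' \<in> Y" "k < D" and e: "e \<in> piece_edges g" using that by (auto simp: bonds_def)
    have "snd ` (Pair y ` e) = e" by (simp add: image_image)
    hence "e = {lab k, kappa g (lab (snd (\<tau> (y', k))))}" using that(3) k by (simp add: nb_u)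
    thus False using inner_port_disjoint[OF e k(2)] \<tau>_in[OF k] by blast
  qed
  fix i j assume ij: "i \<in> bonds" "j \<in> bonds" "bond_ends i = bond_ends j"
  consider (ll) y e y' e' where "i = Inl (y, e)" "j = Inl (y', e')" | (lr) y e y' k where "i = Inl (y, e)" "j = Inr (y', k)"
    | (rl) y e y' k where "j = Inl (y, e)" "i = Inr (y', k)" | (rr) y k y' k' where "i = Inr (y, k)" "j = Inr (y', k')"
    by (cases i; cases j) auto
  thus "i = j"
  proof cases
    case ll
    have "e \<noteq> {}" using ij ll by (auto simp: bonds_def piece_edges_def)
    moreover have eq: "Pair y ` e = Pair y' ` e'" using ij ll by simp
    ultimately have "y = y'" by auto
    moreover have "snd ` (Pair y ` e) = snd ` (Pair y' ` e')" using eq by simp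
    hence "e = e'" by (simp add: image_image)
    ultimately show ?thesis using ll by simp
  next
    case lr
    thus ?thesis using mixed ij by auto
  next
    case rl
    have "Inl (y, e) \<in> bonds" "Inr (y', k) \<in> bonds" using ij rl by auto
    moreover have "Pair y ` e = {(y', lab k), nb 0 (y', lab k)}" using ij(3) rl by simp
    ultimately show ?thesis using mixed by blast
  next
    case rr
    have k: "y \<in> Y" "k < D" "y' \<in> Y" "k' < D" using ij rr by (auto simp: bonds_def)
    have eq: "{(y, lab k), nb 0 (y, lab k)} = {(y', lab k'), nb 0 (y', lab k')}" using ij rr by simp
    have "(y, lab k) \<noteq> nb 0 (y', lab k')"
    proof
      assume "(y, lab k) = nb 0 (y', lab k')"
      hence "snd (lab k) = snd (kappa g (lab (snd (\<tau> (y', k')))))" using k by (simp add: nb_u)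
      thus False using k \<tau>_in[OF k(3,4)] by simp
    qed
    hence "(y, lab k) = (y', lab k')" using eq by (auto simp: doubleton_eq_iff)
    hence "y = y'" "label_of (lab k) = label_of (lab k')" by auto
    thus ?thesis using k rr by simp
  qed
qed

lemma joined_inner:
  assumes "(f, f') \<in> joined E'" "\<And>e. e \<in> E' \<Longrightarrow> Inl (y, e) \<in> J"
  shows "((y, f), (y, f')) \<in> joined (bond_ends ` J)"
proof -
  have c: "(Pair y f, Pair y f') \<in> joined ((`) (Pair y) ` E')" by (rule joined_image[OF assms(1)])
  have "(`) (Pair y) ` E' \<subseteq> bond_ends ` J"
  proof
    fix x assume "x \<in> (`) (Pair y) ` E'"
    then obtain e where e: "e \<in> E'" "x = Pair y ` e" by blast
    have "bond_ends (Inl (y, e)) \<in> bond_ends ` J" using assms(2)[OF e(1)] by blast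
    thus "x \<in> bond_ends ` J" using e(2) by simp
  qed
  thus ?thesis using c by (rule joined_mono)
qed

lemma joined_port:
  assumes "Inr (y, k) \<in> J" "k < D"
  shows "((y, lab k), (fst (\<tau> (y, k)), kappa g (lab (snd (\<tau> (y, k)))))) \<in> joined (bond_ends ` J)"
proof (rule joined_edge)
  have "bond_ends (Inr (y, k)) \<in> bond_ends ` J" using assms by blast
  thus "{(y, lab k), (fst (\<tau> (y, k)), kappa g (lab (snd (\<tau> (y, k)))))} \<in> bond_ends ` J"
    using assms(2) by (simp add: nb_u)
qed

lemma closed_under_edges:
  assumes "J \<subseteq> bonds" "\<And>y k. Inr (y, k) \<in> J \<Longrightarrow> y \<in> S \<longleftrightarrow> fst (\<tau> (y, k)) \<in> S"
    and "{u, v} \<in> bond_ends ` J" "fst u \<in> S"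
  shows "fst v \<in> S"
proof -
  obtain i where i: "i \<in> J" "{u, v} = bond_ends i" using assms(3) by blast
  show ?thesis
  proof (cases i)
    case (Inl ye)
    have "u \<in> bond_ends i" "v \<in> bond_ends i" using i(2) by blast+
    thus ?thesis using Inl assms(4) by (cases ye) auto
  next
    case (Inr yk)
    then obtain y k where yk: "i = Inr (y, k)" by (cases yk) auto
    hence k: "k < D" using i assms(1) by (auto simp: bonds_def)
    have "{u, v} = {(y, lab k), nb 0 (y, lab k)}" using i yk by simp
    hence "(u = (y, lab k) \<and> v = nb 0 (y, lab k)) \<or> (v = (y, lab k) \<and> u = nb 0 (y, lab k))"
      by (auto simp: doubleton_eq_iff)
    moreover have "y \<in> S \<longleftrightarrow> fst (\<tau> (y, k)) \<in> S" using assms(2) i yk by blast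
    ultimately show ?thesis using assms(4) k by (auto simp: nb_u)
  qed
qed

definition cut_bonds :: "('y \<times> piece_vertex) set
    \<Rightarrow> 'y bond set" where
  "cut_bonds S = {i \<in> bonds. bond_ends i \<inter> S \<noteq> {} \<and> bond_ends i - S \<noteq> {}}"

text \<open>Two large connected sets of vertices, separated by a set \<open>S\<close> of sites that no open port
  edge leaves.\<close>

definition two_large_sets :: "'y bond set \<Rightarrow> nat \<Rightarrow> bool" where
  "two_large_sets J t \<longleftrightarrow> (\<exists>S X1 X2. X1 \<subseteq> wired_verts \<and> X2 \<subseteq> wired_verts \<and> X1 \<noteq> {} \<and> X2 \<noteq> {} \<and> t \<le> card X1 \<and> t \<le> card X2 \<and>
     (\<forall>u\<in>X1. \<forall>v\<in>X1. (u, v) \<in> joined (bond_ends ` J)) \<and> (\<forall>u\<in>X2. \<forall>v\<in>X2. (u, v) \<in> joined (bond_ends ` J)) \<and>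
     fst ` X1 \<subseteq> S \<and> fst ` X2 \<inter> S = {} \<and> (\<forall>y k. Inr (y, k) \<in> J \<longrightarrow> (y \<in> S \<longleftrightarrow> fst (\<tau> (y, k)) \<in> S)))"

text \<open>Transport of the wired graph to the natural numbers. Expansion and percolation are
  expressed in terms of the bonds, through the edge boundaries \<open>cut_bonds S\<close> and through events that
  imply \<open>two_large_sets\<close>.\<close>

theorem nat_graph:
  obtains G :: "nat ugraph" where
    "enat g0 \<le> girth G" "card (verts G) = card Y * card (piece_verts g)"
    "\<And>b. 0 < b \<Longrightarrow> (\<And>S. S \<subseteq> wired_verts \<Longrightarrow> 2 * card S \<le> card wired_verts \<Longrightarrow> b * real (card S) \<le> real (card (cut_bonds S))) \<Longrightarrow> regular_expander b d G"
    "\<And>p Q t. 0 \<le> p \<Longrightarrow> p \<le> 1 \<Longrightarrow> (\<And>J. J \<subseteq> bonds \<Longrightarrow> Q J \<Longrightarrow> two_large_sets J t) \<Longrightarrow>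
      bond_mean p bonds (\<lambda>J. of_bool (Q J)) \<le> measure_pmf.prob (percolation G p) {H. t \<le> card (nth_component H 2)}"
proof -
  obtain \<iota> :: "'y \<times> piece_vertex \<Rightarrow> nat" where \<iota>: "inj_on \<iota> wired_verts"
    using finite_imp_inj_to_nat_seg[OF finite_wired_verts] by blast
  define un where "un = the_inv_into wired_verts \<iota>"
  have un: "un (\<iota> x) = x" if "x \<in> wired_verts" for x
    unfolding un_def by (rule the_inv_into_f_f[OF \<iota> that])
  define nb' where "nb' c n = \<iota> (nb c (un n))" for c n
  define X where "X = \<iota> ` wired_verts"
  have fold_nb': "fold nb' w (\<iota> x) = \<iota> (fold nb w x)" if "x \<in> wired_verts" "set w \<subseteq> {..<d}" for w x
    using that by (induction w arbitrary: x) (auto simp: nb'_def un nb_wired_verts)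
  interpret cg: coloured_graph d g0 nb' X
  proof
    show "finite X" "X \<noteq> {}" "2 \<le> g0" using finite_wired_verts wired_verts_ne g0 by (auto simp: X_def)
    show "nb' c x \<in> X" if "x \<in> X" "c < d" for c x
      using that nb_wired_verts by (auto simp: X_def nb'_def un)
    show "nb' c (nb' c x) = x" if "x \<in> X" "c < d" for c x
      using that nb_wired_verts nb_nb by (auto simp: X_def nb'_def un)
    show "fold nb' w x \<noteq> x" if w: "x \<in> X" "w \<noteq> []" "distinct_adj w" "set w \<subseteq> {..<d}" "length w \<le> g0" for x w
    proof -
      obtain z where z: "z \<in> wired_verts" "x = \<iota> z" using w(1) by (auto simp: X_def)
      have "fold nb w z \<noteq> z" by (rule no_short_closed_walk[OF z(1) w(2-5)])
      hence "\<iota> (fold nb w z) \<noteq> \<iota> z" using \<iota> z(1) fold_nb[OF z(1) w(4)] by (auto dest: inj_onD)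
      thus ?thesis using z fold_nb'[OF z(1) w(4)] by simp
    qed
  qed
  let ?G = "coloured d nb' X"
  let ?bond_ends = "\<lambda>i. \<iota> ` bond_ends i"
  have vG: "verts ?G = X" by (simp add: coloured_def)
  have edges: "edges ?G = ?bond_ends ` bonds"
  proof -
    have gen: "edges (coloured d h A) = (\<lambda>(x, c). {x, h c x}) ` (A \<times> {..<d})" for h :: "nat \<Rightarrow> 'z \<Rightarrow> 'z" and A
      by (auto simp: coloured_def)
    have "edges ?G = (\<lambda>(n, c). {n, nb' c n}) ` (\<lambda>(x, c). (\<iota> x, c)) ` (wired_verts \<times> {..<d})"
      unfolding gen by (rule arg_cong[where f = "image _"]) (auto simp: X_def)
    also have "\<dots> = (`) \<iota> ` (\<lambda>(x, c). {x, nb c x}) ` (wired_verts \<times> {..<d})"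
      unfolding image_image by (intro image_cong refl) (auto simp: nb'_def un)
    also have "\<dots> = (`) \<iota> ` edges (coloured d nb wired_verts)" unfolding gen ..
    finally have "edges ?G = (`) \<iota> ` edges (coloured d nb wired_verts)" .
    thus ?thesis by (simp add: edges_bond_ends image_image)
  qed
  have inj: "inj_on ?bond_ends bonds"
  proof (rule inj_onI)
    fix i j assume ij: "i \<in> bonds" "j \<in> bonds" "?bond_ends i = ?bond_ends j"
    hence "bond_ends i = bond_ends j" using inj_on_image_eq_iff[OF \<iota> bond_ends_wired_verts[OF ij(1)] bond_ends_wired_verts[OF ij(2)]] by simp
    thus "i = j" using inj_bond_ends ij by (auto dest: inj_onD)
  qed
  show thesis
  proof (rule that[of ?G])
    show "enat g0 \<le> girth ?G" by (rule cg.girth_ge)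
    show "card (verts ?G) = card Y * card (piece_verts g)"
      unfolding vG unfolding X_def by (subst card_image[OF \<iota>]) (simp add: wired_verts_def card_cartesian_product)
  next
    fix b :: real
    assume b: "0 < b" and ex: "\<And>S. S \<subseteq> wired_verts \<Longrightarrow> 2 * card S \<le> card wired_verts \<Longrightarrow> b * real (card S) \<le> real (card (cut_bonds S))"
    have "b * real (card S') \<le> real (card (edges_between ?G S' (verts ?G - S')))"
      if S': "S' \<subseteq> verts ?G" "real (card S') \<le> real (card (verts ?G)) / 2" for S'
    proof -
      define S where "S = {x \<in> wired_verts. \<iota> x \<in> S'}"
      have imS: "S' = \<iota> ` S" using S'(1)[unfolded vG] by (auto simp: S_def X_def)
      have SV: "S \<subseteq> wired_verts" by (auto simp: S_def)
      have cS: "card S' = card S" unfolding imS by (rule card_image[OF inj_on_subset[OF \<iota> SV]])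
      have cV: "card (verts ?G) = card wired_verts" unfolding vG unfolding X_def by (rule card_image[OF \<iota>])
      have "2 * card S \<le> card wired_verts" using S'(2) unfolding cS cV by linarith
      hence "b * real (card S) \<le> real (card (cut_bonds S))" by (rule ex[OF SV])
      also have "card (cut_bonds S) \<le> card (edges_between ?G S' (verts ?G - S'))"
      proof (rule card_inj_on_le)
        show "inj_on ?bond_ends (cut_bonds S)" by (rule inj_on_subset[OF inj]) (auto simp: cut_bonds_def)
        show "?bond_ends ` cut_bonds S \<subseteq> edges_between ?G S' (verts ?G - S')"
        proof
          fix e assume "e \<in> ?bond_ends ` cut_bonds S"
          then obtain i where i: "i \<in> bonds" "e = ?bond_ends i" "bond_ends i \<inter> S \<noteq> {}" "bond_ends i - S \<noteq> {}"
            by (auto simp: cut_bonds_def)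
          obtain a b where ab: "a \<in> bond_ends i" "a \<in> S" "b \<in> bond_ends i" "b \<notin> S" using i by blast
          have eE: "e \<in> edges ?G" using i edges by blast
          hence "card e = 2" using cg.simple by (auto simp: finite_simple_graph_def)
          moreover have bV: "b \<in> wired_verts" using bond_ends_wired_verts[OF i(1)] ab by blast
          hence b': "\<iota> b \<notin> S'" using ab by (simp add: S_def)
          have a': "\<iota> a \<in> S'" using ab by (simp add: S_def)
          have "\<iota> a \<in> e" "\<iota> b \<in> e" "\<iota> a \<noteq> \<iota> b" using ab i a' b' by auto
          ultimately have "e = {\<iota> a, \<iota> b}" by (auto simp: card_2_iff)
          moreover have "\<iota> b \<in> verts ?G - S'" unfolding vG using bV b' by (auto simp: X_def)
          ultimately show "e \<in> edges_between ?G S' (verts ?G - S')"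
            using eE a' by (auto simp: edges_between_def)
        qed
        show "finite (edges_between ?G S' (verts ?G - S'))"
          by (rule finite_subset[of _ "edges ?G"]) (auto simp: edges_between_def edges finite_bonds)
      qed
      finally show ?thesis unfolding cS by simp
    qed
    thus "regular_expander b d ?G"
      unfolding regular_expander_def expander_def
      using cg.simple cg.max_degree_eq cg.degree_eq by (simp add: vG)
  next
    fix p :: real and Q t
    assume p: "0 \<le> p" "p \<le> 1" and Q: "\<And>J. J \<subseteq> bonds \<Longrightarrow> Q J \<Longrightarrow> two_large_sets J t"
    have "measure_pmf.prob (percolation ?G p) {H. t \<le> card (nth_component H 2)} =
       bond_mean p (?bond_ends ` bonds) (\<lambda>H. of_bool (t \<le> card (nth_component (UGraph X H) 2)))"
      using prob_percolation[of ?G p "\<lambda>H. t \<le> card (nth_component H 2)"] p finite_bonds by (simp add: edges vG)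
    also have "\<dots> = bond_mean p bonds (\<lambda>J. of_bool (t \<le> card (nth_component (UGraph X (?bond_ends ` J)) 2)))"
      by (rule bond_mean_image[OF finite_bonds inj])
    also have "\<dots> \<ge> bond_mean p bonds (\<lambda>J. of_bool (Q J))"
    proof (intro bond_mean_mono p)
      fix J assume J: "J \<subseteq> bonds"
      have "t \<le> card (nth_component (UGraph X (?bond_ends ` J)) 2)" if QJ: "Q J"
      proof -
        obtain S X1 X2 where raw: "X1 \<subseteq> wired_verts \<and> X2 \<subseteq> wired_verts \<and> X1 \<noteq> {} \<and> X2 \<noteq> {} \<and> t \<le> card X1 \<and> t \<le> card X2 \<and>
            (\<forall>u\<in>X1. \<forall>v\<in>X1. (u, v) \<in> joined (bond_ends ` J)) \<and> (\<forall>u\<in>X2. \<forall>v\<in>X2. (u, v) \<in> joined (bond_ends ` J)) \<and>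
            fst ` X1 \<subseteq> S \<and> fst ` X2 \<inter> S = {} \<and> (\<forall>y k. Inr (y, k) \<in> J \<longrightarrow> (y \<in> S \<longleftrightarrow> fst (\<tau> (y, k)) \<in> S))"
          using Q[OF J QJ] unfolding two_large_sets_def by (elim exE) (rule that)
        have X12: "X1 \<subseteq> wired_verts" "X2 \<subseteq> wired_verts" "X1 \<noteq> {}" "X2 \<noteq> {}" "t \<le> card X1" "t \<le> card X2"
          using raw by auto
        have J1: "(u, v) \<in> joined (bond_ends ` J)" if "u \<in> X1" "v \<in> X1" for u v using raw that by auto
        have J2: "(u, v) \<in> joined (bond_ends ` J)" if "u \<in> X2" "v \<in> X2" for u v using raw that by auto
        have S: "fst ` X1 \<subseteq> S" "fst ` X2 \<inter> S = {}" using raw by auto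
        have S3: "y \<in> S \<longleftrightarrow> fst (\<tau> (y, k)) \<in> S" if "Inr (y, k) \<in> J" for y k using raw that by auto
        have im: "?bond_ends ` J = (`) \<iota> ` bond_ends ` J" by (simp add: image_image)
        have pre: "\<exists>a b. u = \<iota> a \<and> v = \<iota> b \<and> a \<in> wired_verts \<and> b \<in> wired_verts \<and> {a, b} \<in> bond_ends ` J"
          if uv: "{u, v} \<in> ?bond_ends ` J" for u v
        proof -
          obtain i where i: "i \<in> J" "{u, v} = \<iota> ` bond_ends i" using uv by blast
          obtain a where a: "a \<in> bond_ends i" "u = \<iota> a" using i(2) by blast
          obtain b where b: "b \<in> bond_ends i" "v = \<iota> b" using i(2) by blast
          have V: "bond_ends i \<subseteq> wired_verts" using bond_ends_wired_verts i J by blast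
          hence "\<iota> ` {a, b} = \<iota> ` bond_ends i" using i a b by simp
          hence "{a, b} = bond_ends i" using inj_on_image_eq_iff[OF \<iota> _ V, of "{a, b}"] a b V by blast
          thus ?thesis using a b V i by blast
        qed
        show ?thesis
        proof (rule second_component_ge[where S = "\<iota> ` {x \<in> wired_verts. fst x \<in> S}" and ?X1.0 = "\<iota> ` X1" and ?X2.0 = "\<iota> ` X2"])
          show "finite X" by (rule cg.finX)
          show "u \<in> X \<and> v \<in> X" if "{u, v} \<in> ?bond_ends ` J" for u v
            using pre[OF that] by (auto simp: X_def)
          show "\<iota> ` X1 \<subseteq> X" "\<iota> ` X2 \<subseteq> X" "\<iota> ` X1 \<noteq> {}" "\<iota> ` X2 \<noteq> {}" using X12 by (auto simp: X_def)
          show "t \<le> card (\<iota> ` X1)" "t \<le> card (\<iota> ` X2)"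
            using X12 by (auto simp: card_image[OF inj_on_subset[OF \<iota>]])
          show "(u, v) \<in> joined (?bond_ends ` J)" if "u \<in> \<iota> ` X1" "v \<in> \<iota> ` X1" for u v
            unfolding im using that J1 joined_image[where h = \<iota>] by blast
          show "(u, v) \<in> joined (?bond_ends ` J)" if "u \<in> \<iota> ` X2" "v \<in> \<iota> ` X2" for u v
            unfolding im using that J2 joined_image[where h = \<iota>] by blast
          show "\<iota> ` X1 \<subseteq> \<iota> ` {x \<in> wired_verts. fst x \<in> S}" using X12 S by blast
          show "\<iota> ` X2 \<inter> \<iota> ` {x \<in> wired_verts. fst x \<in> S} = {}"
          proof -
            have "X2 \<inter> {x \<in> wired_verts. fst x \<in> S} = {}" using S(2) by blast
            thus ?thesis using inj_on_image_Int[OF \<iota> X12(2), of "{x \<in> wired_verts. fst x \<in> S}"] by auto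
          qed
          show "v \<in> \<iota> ` {x \<in> wired_verts. fst x \<in> S}" if uv: "{u, v} \<in> ?bond_ends ` J" "u \<in> \<iota> ` {x \<in> wired_verts. fst x \<in> S}" for u v
          proof -
            obtain a b where ab: "u = \<iota> a" "v = \<iota> b" "a \<in> wired_verts" "b \<in> wired_verts" "{a, b} \<in> bond_ends ` J" using pre[OF uv(1)] by blast
            obtain a' where a': "u = \<iota> a'" "a' \<in> wired_verts" "fst a' \<in> S" using uv(2) by blast
            have "a = a'" using \<iota> ab a' by (auto dest: inj_onD)
            hence "fst b \<in> S" using closed_under_edges[OF J S3 ab(5)] a' by blast
            thus ?thesis using ab by blast
          qed
        qed
      qed
      thus "(of_bool (Q J) :: real) \<le> of_bool (t \<le> card (nth_component (UGraph X (?bond_ends ` J)) 2))" by auto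
    qed
    finally show "bond_mean p bonds (\<lambda>J. of_bool (Q J)) \<le> measure_pmf.prob (percolation ?G p) {H. t \<le> card (nth_component H 2)}"
      by simp
  qed
qed

end

section \<open>The wiring: chains, trees and two ends\<close>

text \<open>The site \<open>(j, i, s)\<close> is the element number \<open>s\<close> of the chain above the node \<open>i\<close> of level \<open>j\<close>. Level
  \<open>j\<close> has \<open>2 * m * 2 ^ j\<close> nodes, and the node \<open>i\<close> has the parent \<open>i div 2\<close>. The two halves
  of level \<open>0\<close> have \<open>m\<close> nodes each.\<close>

definition sites :: "nat \<Rightarrow> nat \<Rightarrow> nat \<Rightarrow> (nat \<times> nat \<times> nat) set" where
  "sites m h l = {(j, i, s). j \<le> h \<and> i < 2 * m * 2 ^ j \<and> s < l}"

lemma finite_sites: "finite (sites m h l)"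
proof (rule finite_subset)
  show "sites m h l \<subseteq> {..h} \<times> {..<2 * m * 2 ^ h} \<times> {..<l}"
  proof
    fix y assume "y \<in> sites m h l"
    then obtain j i s where y: "y = (j, i, s)" "j \<le> h" "i < 2 * m * 2 ^ j" "s < l" by (auto simp: sites_def)
    have "2 * m * 2 ^ j \<le> 2 * m * 2 ^ h" using y(2) by (intro mult_left_mono power_increasing) auto
    hence "i < 2 * m * 2 ^ h" using y(3) by linarith
    thus "y \<in> {..h} \<times> {..<2 * m * 2 ^ h} \<times> {..<l}" using y by auto
  qed
qed simp

lemma permutes_ifI:
  assumes "\<And>z. z \<in> A \<Longrightarrow> f z \<in> A" "\<And>z. z \<in> A \<Longrightarrow> g z \<in> A"
    "\<And>z. z \<in> A \<Longrightarrow> g (f z) = z" "\<And>z. z \<in> A \<Longrightarrow> f (g z) = z"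
  shows "(\<lambda>z. if z \<in> A then f z else z) permutes A"
proof (rule bij_imp_permutes)
  have "bij_betw f A A" by (rule bij_betwI[where g = g]) (use assms in auto)
  thus "bij_betw (\<lambda>z. if z \<in> A then f z else z) A A" by (subst bij_betw_cong[where g = f]) auto
qed simp

text \<open>The edges along the chains and between the levels. Label \<open>0\<close> leads towards the bottom, the
  labels \<open>1\<close> and \<open>2\<close> lead towards the top. Both ports of a label go to the same
  neighbour, so a link consists of two edges of the graph and \<open>tree_wire\<close> is an involution.\<close>

definition tree_wire :: "nat \<Rightarrow> nat \<Rightarrow> (nat \<times> nat \<times> nat) \<times> nat \<Rightarrow> (nat \<times> nat \<times> nat) \<times> nat" where
  "tree_wire h l = (\<lambda>((j, i, s), k).
     if k = 0 \<and> s > 0 then ((j, i, s - 1), 1)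
     else if k = 0 \<and> j > 0 then ((j - 1, i div 2, l - 1), 1 + i mod 2)
     else if k = 1 \<and> Suc s < l then ((j, i, Suc s), 0)
     else if (k = 1 \<or> k = 2) \<and> Suc s = l \<and> j < h then ((Suc j, 2 * i + (k - 1), 0), 0)
     else ((j, i, s), k))"

lemma tree_wire_in:
  assumes "z \<in> sites m h l \<times> {..<D}" "3 \<le> D" "2 \<le> l"
  shows "tree_wire h l z \<in> sites m h l \<times> {..<D}"
proof -
  obtain j i s k where z: "z = ((j, i, s), k)" by (metis prod.exhaust)
  have "i div 2 < 2 * m * 2 ^ (j - 1)" if "j > 0" "i < 2 * m * 2 ^ j"
    using that by (cases j) auto
  thus ?thesis using assms unfolding z tree_wire_def sites_def by auto
qed

lemma tree_wire_wire:
  assumes "z \<in> sites m h l \<times> {..<D}" "2 \<le> l"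
  shows "tree_wire h l (tree_wire h l z) = z"
proof -
  obtain j i s k where z: "z = ((j, i, s), k)" by (metis prod.exhaust)
  have lt: "j \<le> h" "s < l" using assms z by (auto simp: sites_def)
  have fixed: "tree_wire h l z = z" if "\<not> (k = 0 \<and> s > 0)" "\<not> (k = 0 \<and> s = 0 \<and> j > 0)" "\<not> (k = 1 \<and> Suc s < l)"
      "\<not> (k = 1 \<and> Suc s = l \<and> j < h)" "\<not> (k = 2 \<and> Suc s = l \<and> j < h)"
    using that unfolding z tree_wire_def by auto
  consider "k = 0" "s > 0" | "k = 0" "s = 0" "j > 0" | "k = 1" "Suc s < l" | "k = 1" "Suc s = l" "j < h"
    | "k = 2" "Suc s = l" "j < h" | "tree_wire h l z = z"
    using fixed by blast
  thus ?thesis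
  proof cases
    case 2
    then obtain j' where "j = Suc j'" by (cases j) auto
    thus ?thesis using 2 lt assms(2) unfolding z tree_wire_def
      by (auto simp: mod2_eq_if elim: oddE evenE)
  qed (use lt assms(2) in \<open>auto simp: z tree_wire_def\<close>)
qed

text \<open>The wiring is the composition of three permutations with disjoint supports: the forest on the labels
  below \<open>3\<close>, two copies of \<open>\<sigma>\<close> on the two halves of the bottom, and the expanding permutations
  at the top. The last property lists all pairs of neighbouring sites.\<close>

theorem wiring_exists:
  fixes m h l D :: nat
  assumes h: "1 \<le> h" and l: "2 \<le> l" and D: "24 \<le> D"
    and \<sigma>: "\<sigma> permutes {..<m} \<times> {3..<D}"
    and \<pi>: "\<And>k. k < 21 \<Longrightarrow> \<pi> k permutes {..<2 * m * 2 ^ h}"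
  obtains \<tau> :: "(nat \<times> nat \<times> nat) \<times> nat \<Rightarrow> (nat \<times> nat \<times> nat) \<times> nat" where
    "\<tau> permutes sites m h l \<times> {..<D}"
    "\<And>j i s. j \<le> h \<Longrightarrow> i < 2 * m * 2 ^ j \<Longrightarrow> Suc s < l \<Longrightarrow> \<tau> ((j, i, Suc s), 0) = ((j, i, s), 1)"
    "\<And>j i. j < h \<Longrightarrow> i < 2 * m * 2 ^ Suc j \<Longrightarrow> \<tau> ((Suc j, i, 0), 0) = ((j, i div 2, l - 1), 1 + i mod 2)"
    "\<And>b x k. b < 2 \<Longrightarrow> x < m \<Longrightarrow> 3 \<le> k \<Longrightarrow> k < D \<Longrightarrow>
       \<tau> ((0, b * m + x, 0), k) = ((0, b * m + fst (\<sigma> (x, k)), 0), snd (\<sigma> (x, k)))"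
    "\<And>i k. i < 2 * m * 2 ^ h \<Longrightarrow> k < 21 \<Longrightarrow> \<tau> ((h, i, l - 1), 3 + k) = ((h, \<pi> k i, l - 1), 3 + k)"
    "\<And>j i s k. (j, i, s) \<in> sites m h l \<Longrightarrow> k < D \<Longrightarrow>
       fst (\<tau> ((j, i, s), k)) = (j, i, s)
     \<or> k = 0 \<and> 0 < s \<and> fst (\<tau> ((j, i, s), k)) = (j, i, s - 1)
     \<or> k = 1 \<and> Suc s < l \<and> fst (\<tau> ((j, i, s), k)) = (j, i, Suc s)
     \<or> s = 0 \<and> 0 < j \<and> fst (\<tau> ((j, i, s), k)) = (j - 1, i div 2, l - 1)
     \<or> Suc s = l \<and> j < h \<and> (\<exists>a<2. fst (\<tau> ((j, i, s), k)) = (Suc j, 2 * i + a, 0))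
     \<or> j = 0 \<and> s = 0 \<and> (\<exists>i'. i' div m = i div m \<and> fst (\<tau> ((j, i, s), k)) = (0, i', 0))
     \<or> j = h \<and> Suc s = l \<and> (\<exists>i'. fst (\<tau> ((j, i, s), k)) = (h, i', l - 1))"
proof -
  define A where "A = sites m h l \<times> {..<D}"
  define A2 :: "((nat \<times> nat \<times> nat) \<times> nat) set" where
    "A2 = {((j, i, s), k). j = 0 \<and> s = 0 \<and> i < 2 * m \<and> 3 \<le> k \<and> k < D}"
  define A3 :: "((nat \<times> nat \<times> nat) \<times> nat) set" where
    "A3 = {((j, i, s), k). j = h \<and> s = l - 1 \<and> i < 2 * m * 2 ^ h \<and> 3 \<le> k \<and> k < 24}"
  define f2 :: "(nat \<times> nat \<Rightarrow> nat \<times> nat) \<Rightarrow> (nat \<times> nat \<times> nat) \<times> nat \<Rightarrow> (nat \<times> nat \<times> nat) \<times> nat" where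
    "f2 \<sigma>' = (\<lambda>((j, i, s), k). ((0, i div m * m + fst (\<sigma>' (i mod m, k)), 0), snd (\<sigma>' (i mod m, k))))" for \<sigma>'
  define f3 :: "(nat \<Rightarrow> nat \<Rightarrow> nat) \<Rightarrow> (nat \<times> nat \<times> nat) \<times> nat \<Rightarrow> (nat \<times> nat \<times> nat) \<times> nat" where
    "f3 \<pi>' = (\<lambda>((j, i, s), k). ((h, \<pi>' (k - 3) i, l - 1), k))" for \<pi>'
  have f2_in: "f2 \<sigma>' z \<in> A2" and f2_inv: "\<sigma>'' \<circ> \<sigma>' = id \<Longrightarrow> f2 \<sigma>'' (f2 \<sigma>' z) = z"
    if perm': "\<sigma>' permutes {..<m} \<times> {3..<D}" and zA: "z \<in> A2" for \<sigma>' \<sigma>'' z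
  proof -
    obtain i k where z: "z = ((0, i, 0), k)" "i < 2 * m" "3 \<le> k" "k < D" using zA by (auto simp: A2_def)
    have m: "m > 0" using z by (cases m) auto
    have "\<sigma>' (i mod m, k) \<in> {..<m} \<times> {3..<D}"
      using permutes_in_image[OF perm', of "(i mod m, k)"] z m by simp
    then obtain x k' where x: "\<sigma>' (i mod m, k) = (x, k')" "x < m" "3 \<le> k'" "k' < D" by auto
    have "i div m < 2" using z m by (simp add: less_mult_imp_div_less)
    hence "i div m * m + x < 2 * m" using x by (cases "i div m") auto
    thus "f2 \<sigma>' z \<in> A2" using x by (simp add: f2_def z A2_def)
    assume "\<sigma>'' \<circ> \<sigma>' = id"
    hence "\<sigma>'' (x, k') = (i mod m, k)" using x(1) by (metis comp_apply id_apply)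
    thus "f2 \<sigma>'' (f2 \<sigma>' z) = z" using x m by (simp add: f2_def z)
  qed
  define t1 where "t1 = (\<lambda>z. if z \<in> A then tree_wire h l z else z)"
  define t2 where "t2 = (\<lambda>z. if z \<in> A2 then f2 \<sigma> z else z)"
  define t3 where "t3 = (\<lambda>z. if z \<in> A3 then f3 \<pi> z else z)"
  have p1: "t1 permutes A" unfolding t1_def
    by (rule permutes_ifI[where g = "tree_wire h l"])
      (use tree_wire_in[of _ m h l D] tree_wire_wire[of _ m h l D] l D in \<open>auto simp: A_def\<close>)
  have p2: "t2 permutes A2" unfolding t2_def
  proof (rule permutes_ifI[where g = "f2 (inv \<sigma>)"])
    note perm = \<sigma> permutes_inv[OF \<sigma>]
    show "f2 \<sigma> z \<in> A2" "f2 (inv \<sigma>) z \<in> A2" if "z \<in> A2" for z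
      using f2_in perm that by blast+
    show "f2 (inv \<sigma>) (f2 \<sigma> z) = z" "f2 \<sigma> (f2 (inv \<sigma>) z) = z" if "z \<in> A2" for z
      using f2_inv[OF perm(1) that, of "inv \<sigma>"] f2_inv[OF perm(2) that, of \<sigma>] permutes_inv_o[OF \<sigma>] by blast+
  qed
  have p3: "t3 permutes A3" unfolding t3_def
  proof (rule permutes_ifI[where g = "f3 (\<lambda>k. inv (\<pi> k))"])
    fix z assume "z \<in> A3"
    then obtain i k where z: "z = ((h, i, l - 1), k)" "i < 2 * m * 2 ^ h" "3 \<le> k" "k < 24" by (auto simp: A3_def)
    note perm = \<pi>[of "k - 3"]
    show "f3 \<pi> z \<in> A3" "f3 (\<lambda>k. inv (\<pi> k)) z \<in> A3"
      using z permutes_in_image[OF perm, of i] permutes_in_image[OF permutes_inv[OF perm], of i]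
      by (auto simp: f3_def A3_def)
    show "f3 (\<lambda>k. inv (\<pi> k)) (f3 \<pi> z) = z" "f3 \<pi> (f3 (\<lambda>k. inv (\<pi> k)) z) = z"
      using z permutes_inverses[OF perm] by (auto simp: f3_def)
  qed
  have sub2: "A2 \<subseteq> A" using l D by (auto simp: A2_def A_def sites_def)
  have sub3: "A3 \<subseteq> A" using l D by (auto simp: A3_def A_def sites_def)
  have disj: "z \<notin> A3" if "z \<in> A2" for z using that h by (auto simp: A2_def A3_def)
  define \<tau> where "\<tau> = t3 \<circ> t2 \<circ> t1"
  have perm: "\<tau> permutes A" unfolding \<tau>_def
    by (intro permutes_compose p1 permutes_subset[OF p2 sub2] permutes_subset[OF p3 sub3])
  have low: "\<tau> (y, k) = tree_wire h l (y, k)" if "(y, k) \<in> A" "k < 3" for y k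
  proof -
    obtain j i s where y: "y = (j, i, s)" by (metis prod.exhaust)
    have "snd (tree_wire h l (y, k)) < 3" using that(2) by (auto simp: y tree_wire_def)
    hence "tree_wire h l (y, k) \<notin> A2" "tree_wire h l (y, k) \<notin> A3" by (auto simp: A2_def A3_def)
    thus ?thesis using that(1) by (simp add: \<tau>_def t1_def t2_def t3_def)
  qed
  have high: "\<tau> (y, k) = t3 (t2 (y, k))" if "3 \<le> k" for y k
  proof -
    have "tree_wire h l (y, k) = (y, k)" using that by (auto simp: tree_wire_def split: prod.splits)
    thus ?thesis by (simp add: \<tau>_def t1_def)
  qed
  have mid: "\<tau> z = f2 \<sigma> z" if "z \<in> A2" for z
  proof -
    have "3 \<le> snd z" using that by (auto simp: A2_def)
    hence "\<tau> z = t3 (t2 z)" using high[of "snd z" "fst z"] by simp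
    also have "\<dots> = f2 \<sigma> z" using that f2_in[OF \<sigma> that] disj by (auto simp: t2_def t3_def)
    finally show ?thesis .
  qed
  have top: "\<tau> z = f3 \<pi> z" if "z \<in> A3" for z
  proof -
    have "3 \<le> snd z" using that by (auto simp: A3_def)
    hence "\<tau> z = t3 (t2 z)" using high[of "snd z" "fst z"] by simp
    also have "z \<notin> A2" using that disj by blast
    hence "t3 (t2 z) = f3 \<pi> z" using that by (simp add: t2_def t3_def)
    finally show ?thesis .
  qed
  have rest: "\<tau> (y, k) = (y, k)" if "3 \<le> k" "(y, k) \<notin> A2" "(y, k) \<notin> A3" for y k
    using high[OF that(1), of y] that by (simp add: t2_def t3_def)
  show thesis
  proof (rule that[of \<tau>])
    show "\<tau> permutes sites m h l \<times> {..<D}" using perm by (simp add: A_def)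
    show "\<tau> ((j, i, Suc s), 0) = ((j, i, s), 1)" if "j \<le> h" "i < 2 * m * 2 ^ j" "Suc s < l" for j i s
      using low[of "(j, i, Suc s)" 0] that D by (simp add: A_def sites_def tree_wire_def)
    show "\<tau> ((Suc j, i, 0), 0) = ((j, i div 2, l - 1), 1 + i mod 2)" if "j < h" "i < 2 * m * 2 ^ Suc j" for j i
      using low[of "(Suc j, i, 0)" 0] that D l by (simp add: A_def sites_def tree_wire_def)
    show "\<tau> ((0, b * m + x, 0), k) = ((0, b * m + fst (\<sigma> (x, k)), 0), snd (\<sigma> (x, k)))"
      if "b < 2" "x < m" "3 \<le> k" "k < D" for b x k
    proof -
      have "b * m + x < 2 * m" using that by (cases b) auto
      hence "((0, b * m + x, 0), k) \<in> A2" using that by (simp add: A2_def)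
      from mid[OF this] show ?thesis using that by (simp add: f2_def)
    qed
    show "\<tau> ((h, i, l - 1), 3 + k) = ((h, \<pi> k i, l - 1), 3 + k)" if "i < 2 * m * 2 ^ h" "k < 21" for i k
    proof -
      have "((h, i, l - 1), 3 + k) \<in> A3" using that by (simp add: A3_def)
      from top[OF this] show ?thesis by (simp add: f3_def)
    qed
    fix j i s k assume y: "(j, i, s) \<in> sites m h l" and k: "k < D"
    show "fst (\<tau> ((j, i, s), k)) = (j, i, s)
     \<or> k = 0 \<and> 0 < s \<and> fst (\<tau> ((j, i, s), k)) = (j, i, s - 1)
     \<or> k = 1 \<and> Suc s < l \<and> fst (\<tau> ((j, i, s), k)) = (j, i, Suc s)
     \<or> s = 0 \<and> 0 < j \<and> fst (\<tau> ((j, i, s), k)) = (j - 1, i div 2, l - 1)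
     \<or> Suc s = l \<and> j < h \<and> (\<exists>a<2. fst (\<tau> ((j, i, s), k)) = (Suc j, 2 * i + a, 0))
     \<or> j = 0 \<and> s = 0 \<and> (\<exists>i'. i' div m = i div m \<and> fst (\<tau> ((j, i, s), k)) = (0, i', 0))
     \<or> j = h \<and> Suc s = l \<and> (\<exists>i'. fst (\<tau> ((j, i, s), k)) = (h, i', l - 1))" (is ?G)
    proof (cases "k < 3")
      case True
      have "\<tau> ((j, i, s), k) = tree_wire h l ((j, i, s), k)" using low[of "(j, i, s)" k] y k True by (simp add: A_def)
      moreover have "fst (tree_wire h l ((j, i, s), k)) = (j, i, s)
         \<or> k = 0 \<and> 0 < s \<and> fst (tree_wire h l ((j, i, s), k)) = (j, i, s - 1)
         \<or> k = 1 \<and> Suc s < l \<and> fst (tree_wire h l ((j, i, s), k)) = (j, i, Suc s)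
         \<or> s = 0 \<and> 0 < j \<and> fst (tree_wire h l ((j, i, s), k)) = (j - 1, i div 2, l - 1)
         \<or> Suc s = l \<and> j < h \<and> (\<exists>a<2. fst (tree_wire h l ((j, i, s), k)) = (Suc j, 2 * i + a, 0))"
        using True by (auto simp: tree_wire_def)
      ultimately show ?G by metis
    next
      case False
      consider "((j, i, s), k) \<in> A2" | "((j, i, s), k) \<in> A3" | "((j, i, s), k) \<notin> A2" "((j, i, s), k) \<notin> A3" by blast
      thus ?G
      proof cases
        case 1
        hence js: "j = 0" "s = 0" "i < 2 * m" "3 \<le> k" by (auto simp: A2_def)
        hence m: "m > 0" by (cases m) auto
        have "\<sigma> (i mod m, k) \<in> {..<m} \<times> {3..<D}"
          using permutes_in_image[OF \<sigma>, of "(i mod m, k)"] js k m by simp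
        hence "fst (\<sigma> (i mod m, k)) < m" by auto
        hence "(i div m * m + fst (\<sigma> (i mod m, k))) div m = i div m" using m by simp
        moreover have "fst (\<tau> ((j, i, s), k)) = (0, i div m * m + fst (\<sigma> (i mod m, k)), 0)"
          using mid[OF 1] js by (simp add: f2_def)
        ultimately show ?G using js by blast
      next
        case 2
        hence "j = h" "Suc s = l" using l by (auto simp: A3_def)
        moreover have "fst (\<tau> ((j, i, s), k)) = (h, \<pi> (k - 3) i, l - 1)"
          using top[OF 2] by (simp add: f3_def)
        ultimately show ?G by blast
      next
        case 3
        thus ?G using rest[OF _ 3] False by simp
      qed
    qed
  qed
qed

section \<open>Edge expansion of the wired graph\<close>

definition blocks :: "nat \<Rightarrow> nat \<Rightarrow> (nat \<times> nat) set" where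
  "blocks m h = {(j, i). j \<le> h \<and> i < 2 * m * 2 ^ j}"

definition tree_boundary :: "nat \<Rightarrow> nat \<Rightarrow> (nat \<times> nat) set \<Rightarrow> (nat \<times> nat) set" where
  "tree_boundary m h A = {(j, i). j < h \<and> i < 2 * m * 2 ^ Suc j \<and> ((Suc j, i) \<in> A) \<noteq> ((j, i div 2) \<in> A)}"

definition top_boundary :: "nat \<Rightarrow> nat \<Rightarrow> (nat \<Rightarrow> nat \<Rightarrow> nat) \<Rightarrow> (nat \<times> nat) set \<Rightarrow> (nat \<times> nat) set" where
  "top_boundary m h \<pi> A = {(i, k). i < 2 * m * 2 ^ h \<and> k < 21 \<and> ((h, i) \<in> A) \<noteq> ((h, \<pi> k i) \<in> A)}"

lemma mem_sites: "(j, i, s) \<in> sites m h l \<longleftrightarrow> j \<le> h \<and> i < 2 * m * 2 ^ j \<and> s < l"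
  by (simp add: sites_def)

lemma finite_blocks: "finite (blocks m h)"
proof -
  have "blocks m h = Sigma {..h} (\<lambda>j. {..<2 * m * 2 ^ j})" by (auto simp: blocks_def)
  thus ?thesis by simp
qed

lemma finite_tree_boundary: "finite (tree_boundary m h A)"
proof -
  have "tree_boundary m h A \<subseteq> Sigma {..h} (\<lambda>j. {..<2 * m * 2 ^ Suc j})" by (auto simp: tree_boundary_def)
  thus ?thesis by (rule finite_subset) simp
qed

lemma finite_top_boundary: "finite (top_boundary m h \<pi> A)"
proof -
  have "top_boundary m h \<pi> A \<subseteq> {..<2 * m * 2 ^ h} \<times> {..<21}" by (auto simp: top_boundary_def)
  thus ?thesis by (rule finite_subset) simp
qed

text \<open>Each element of \<open>A\<close> below the top has two children. Those children either belong to
  \<open>A\<close> again or give a boundary edge, so \<open>A\<close> consists mostly of elements of the top unless the boundary is large;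
  and the top expands.\<close>

lemma forest_expansion_half:
  assumes A: "A \<subseteq> blocks m h" and top: "2 * card {i. (h, i) \<in> A} \<le> 2 * m * 2 ^ h"
    and ex: "\<And>S. S \<subseteq> {..<2 * m * 2 ^ h} \<Longrightarrow> 2 * card S \<le> 2 * m * 2 ^ h \<Longrightarrow>
       card S \<le> 2 * card {(i, k). i \<in> S \<and> k < (21::nat) \<and> \<pi> k i \<notin> S}"
  shows "card A \<le> 4 * card (top_boundary m h \<pi> A) + card (tree_boundary m h A)"
proof -
  let ?top = "{i. (h, i) \<in> A}" and ?M = "2 * m * 2 ^ h"
  have finA: "finite A" using A finite_blocks finite_subset by blast
  have tM: "?top \<subseteq> {..<?M}" using A by (auto simp: blocks_def)
  have "card ?top \<le> 2 * card {(i, k). i \<in> ?top \<and> k < (21::nat) \<and> \<pi> k i \<notin> ?top}"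
    by (rule ex[OF tM top])
  also have "card {(i, k). i \<in> ?top \<and> k < (21::nat) \<and> \<pi> k i \<notin> ?top} \<le> card (top_boundary m h \<pi> A)"
    by (rule card_mono[OF finite_top_boundary]) (use tM in \<open>auto simp: top_boundary_def\<close>)
  finally have t: "card ?top \<le> 2 * card (top_boundary m h \<pi> A)" by simp
  define N where "N = {(j, i) \<in> A. j < h}"
  define Ch where "Ch = (\<lambda>((j, i), a). (j, 2 * i + a)) ` (N \<times> {..<2::nat})"
  have finN: "finite N" using finA by (auto simp: N_def intro: finite_subset[of _ A])
  have cardCh: "card Ch = 2 * card N"
  proof -
    have "inj_on (\<lambda>((j, i), a). (j, 2 * i + a)) (N \<times> {..<2::nat})"
      by (rule inj_on_inverseI[where g = "\<lambda>(j, i). ((j, i div 2), i mod 2)"]) auto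
    thus ?thesis by (simp add: Ch_def card_image card_cartesian_product)
  qed
  let ?L = "{(j, i). j < h \<and> (Suc j, i) \<in> A}"
  have finL: "finite ?L"
    by (rule finite_imageD[of "\<lambda>(j, i). (Suc j, i)"])
      (auto simp: inj_on_def intro: finite_subset[OF _ finA])
  have cardL: "card ?L \<le> card A"
    by (rule card_inj_on_le[of "\<lambda>(j, i). (Suc j, i)"]) (use finA in \<open>auto simp: inj_on_def\<close>)
  have "Ch \<subseteq> tree_boundary m h A \<union> ?L"
    using A by (auto simp: Ch_def N_def tree_boundary_def blocks_def)
  hence "card Ch \<le> card (tree_boundary m h A) + card A"
    using card_mono[of "tree_boundary m h A \<union> ?L" Ch] card_Un_le[of "tree_boundary m h A" ?L] finite_tree_boundary finL cardL
    by (meson add_left_mono finite_UnI order_trans)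
  hence n: "2 * card N \<le> card (tree_boundary m h A) + card A" using cardCh by simp
  have "A \<subseteq> N \<union> Pair h ` ?top"
  proof
    fix x assume x: "x \<in> A"
    obtain j i where ji: "x = (j, i)" by (cases x)
    have "j \<le> h" using x A ji by (auto simp: blocks_def)
    thus "x \<in> N \<union> Pair h ` ?top" using x ji by (cases "j = h") (auto simp: N_def)
  qed
  hence "card A \<le> card (N \<union> Pair h ` ?top)"
    using finN finite_subset[OF tM] by (intro card_mono) auto
  also have "\<dots> \<le> card N + card (Pair h ` ?top)" by (rule card_Un_le)
  also have "card (Pair h ` ?top) = card ?top" by (rule card_image) (simp add: inj_on_def)
  finally show ?thesis using n t by linarith
qed

text \<open>If \<open>A\<close> contains more than half of the top, pass to the complement, which has the
  same boundary and is at least as large as \<open>A\<close>.\<close>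

lemma forest_expansion:
  assumes A: "A \<subseteq> blocks m h" "2 * card A \<le> card (blocks m h)"
    and \<pi>: "\<And>k. k < 21 \<Longrightarrow> \<pi> k permutes {..<2 * m * 2 ^ h}"
    and ex: "\<And>S. S \<subseteq> {..<2 * m * 2 ^ h} \<Longrightarrow> 2 * card S \<le> 2 * m * 2 ^ h \<Longrightarrow>
       card S \<le> 2 * card {(i, k). i \<in> S \<and> k < (21::nat) \<and> \<pi> k i \<notin> S}"
  shows "card A \<le> 4 * card (top_boundary m h \<pi> A) + card (tree_boundary m h A)"
proof (cases "2 * card {i. (h, i) \<in> A} \<le> 2 * m * 2 ^ h")
  case True
  thus ?thesis using forest_expansion_half[OF A(1) _ ex] by blast
next
  case False
  define B where "B = blocks m h - A"
  let ?M = "2 * m * 2 ^ h"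
  have "{i. (h, i) \<in> B} = {..<?M} - {i. (h, i) \<in> A}" by (auto simp: B_def blocks_def)
  moreover have "{i. (h, i) \<in> A} \<subseteq> {..<?M}" using A by (auto simp: blocks_def)
  ultimately have "card {i. (h, i) \<in> B} = ?M - card {i. (h, i) \<in> A}"
    by (simp add: card_Diff_subset finite_subset)
  hence "2 * card {i. (h, i) \<in> B} \<le> ?M" using False by linarith
  hence "card B \<le> 4 * card (top_boundary m h \<pi> B) + card (tree_boundary m h B)"
    by (intro forest_expansion_half ex) (auto simp: B_def)
  moreover have "tree_boundary m h B = tree_boundary m h A"
    by (auto simp: tree_boundary_def B_def blocks_def)
  moreover have "top_boundary m h \<pi> B = top_boundary m h \<pi> A"
  proof -
    have "\<pi> k i < ?M" if "k < 21" "i < ?M" for k i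
      using permutes_in_image[OF \<pi>[OF that(1)], of i] that by simp
    thus ?thesis by (auto simp: top_boundary_def B_def blocks_def)
  qed
  moreover have "card A \<le> card B"
    using A finite_blocks card_Diff_subset[of A "blocks m h"] finite_subset[OF A(1) finite_blocks] by (simp add: B_def)
  ultimately show ?thesis by simp
qed

text \<open>The wired graph of the construction. A block is one chain of sites; the blocks form the forest of
  \<open>forest_expansion\<close>.\<close>

locale tower = wired d g0 g D lab "sites m h l" \<tau>
  for d g0 g D m h l :: nat and lab :: "nat \<Rightarrow> piece_vertex"
    and \<tau> :: "(nat \<times> nat \<times> nat) \<times> nat \<Rightarrow> (nat \<times> nat \<times> nat) \<times> nat" +
  fixes \<sigma> :: "nat \<times> nat \<Rightarrow> nat \<times> nat" and \<pi> :: "nat \<Rightarrow> nat \<Rightarrow> nat"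
  assumes m: "1 \<le> m" and h: "1 \<le> h" and l: "2 \<le> l" and D: "24 \<le> D"
    and \<sigma>: "\<sigma> permutes {..<m} \<times> {3..<D}"
    and \<pi>: "\<And>k. k < 21 \<Longrightarrow> \<pi> k permutes {..<2 * m * 2 ^ h}"
    and \<pi>_expanding: "\<And>S. S \<subseteq> {..<2 * m * 2 ^ h} \<Longrightarrow> 2 * card S \<le> 2 * m * 2 ^ h \<Longrightarrow>
       card S \<le> 2 * card {(i, k). i \<in> S \<and> k < (21::nat) \<and> \<pi> k i \<notin> S}"
    and \<tau>_chain: "\<And>j i s. j \<le> h \<Longrightarrow> i < 2 * m * 2 ^ j \<Longrightarrow> Suc s < l \<Longrightarrow> \<tau> ((j, i, Suc s), 0) = ((j, i, s), 1)"
    and \<tau>_tree: "\<And>j i. j < h \<Longrightarrow> i < 2 * m * 2 ^ Suc j \<Longrightarrow> \<tau> ((Suc j, i, 0), 0) = ((j, i div 2, l - 1), 1 + i mod 2)"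
    and \<tau>_bottom: "\<And>b x k. b < 2 \<Longrightarrow> x < m \<Longrightarrow> 3 \<le> k \<Longrightarrow> k < D \<Longrightarrow>
       \<tau> ((0, b * m + x, 0), k) = ((0, b * m + fst (\<sigma> (x, k)), 0), snd (\<sigma> (x, k)))"
    and \<tau>_top: "\<And>i k. i < 2 * m * 2 ^ h \<Longrightarrow> k < 21 \<Longrightarrow> \<tau> ((h, i, l - 1), 3 + k) = ((h, \<pi> k i, l - 1), 3 + k)"
    and \<tau>_cases: "\<And>j i s k. (j, i, s) \<in> sites m h l \<Longrightarrow> k < D \<Longrightarrow>
       fst (\<tau> ((j, i, s), k)) = (j, i, s)
     \<or> k = 0 \<and> 0 < s \<and> fst (\<tau> ((j, i, s), k)) = (j, i, s - 1)
     \<or> k = 1 \<and> Suc s < l \<and> fst (\<tau> ((j, i, s), k)) = (j, i, Suc s)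
     \<or> s = 0 \<and> 0 < j \<and> fst (\<tau> ((j, i, s), k)) = (j - 1, i div 2, l - 1)
     \<or> Suc s = l \<and> j < h \<and> (\<exists>a<2. fst (\<tau> ((j, i, s), k)) = (Suc j, 2 * i + a, 0))
     \<or> j = 0 \<and> s = 0 \<and> (\<exists>i'. i' div m = i div m \<and> fst (\<tau> ((j, i, s), k)) = (0, i', 0))
     \<or> j = h \<and> Suc s = l \<and> (\<exists>i'. fst (\<tau> ((j, i, s), k)) = (h, i', l - 1))"
begin

definition block_verts :: "nat \<times> nat \<Rightarrow> ((nat \<times> nat \<times> nat) \<times> piece_vertex) set" where
  "block_verts B = (\<lambda>(s, f). ((fst B, snd B, s), f)) ` ({..<l} \<times> piece_verts g)"

lemma mem_block_verts: "((j, i, s), f) \<in> block_verts B \<longleftrightarrow> B = (j, i) \<and> s < l \<and> f \<in> piece_verts g"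
  by (cases B) (auto simp: block_verts_def image_iff)

lemma card_block_verts: "card (block_verts B) = l * card (piece_verts g)"
  by (simp add: block_verts_def card_image inj_on_def card_cartesian_product)

lemma finite_block_verts [simp]: "finite (block_verts B)"
  using finite_piece_verts by (simp add: block_verts_def)

lemma card_UN_block_verts: "finite \<A> \<Longrightarrow> card (\<Union>B\<in>\<A>. block_verts B) = card \<A> * (l * card (piece_verts g))"
proof -
  assume "finite \<A>"
  hence "card (\<Union>B\<in>\<A>. block_verts B) = (\<Sum>B\<in>\<A>. card (block_verts B))"
    by (intro card_UN_disjoint ballI impI finite_block_verts) (auto simp: block_verts_def)
  thus ?thesis by (simp add: card_block_verts)
qed

lemma wired_verts_block_verts: "wired_verts = (\<Union>B\<in>blocks m h. block_verts B)"
proof (rule set_eqI)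
  fix x :: "(nat \<times> nat \<times> nat) \<times> piece_vertex"
  obtain j i s f where x: "x = ((j, i, s), f)" by (metis prod.exhaust)
  show "x \<in> wired_verts \<longleftrightarrow> x \<in> (\<Union>B\<in>blocks m h. block_verts B)"
    unfolding x by (auto simp: wired_verts_def mem_sites mem_block_verts blocks_def)
qed

definition block_bonds :: "nat \<times> nat \<Rightarrow> (nat \<times> nat \<times> nat) bond set" where
  "block_bonds B = {Inl ((fst B, snd B, s), e) | s e. s < l \<and> e \<in> piece_edges g} \<union> {Inr ((fst B, snd B, Suc s), 0) | s. Suc s < l}"

definition block_of_bond :: "(nat \<times> nat \<times> nat) bond \<Rightarrow> nat \<times> nat" where
  "block_of_bond i = (case i of Inl ((j, i, s), e) \<Rightarrow> (j, i) | Inr ((j, i, s), k) \<Rightarrow> (j, i))"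

lemma block_bonds_subset: "B \<in> blocks m h \<Longrightarrow> block_bonds B \<subseteq> bonds"
  using D by (auto simp: block_bonds_def blocks_def bonds_def mem_sites)

lemma block_of_bond_inside: "i \<in> block_bonds B \<Longrightarrow> block_of_bond i = B"
  by (auto simp: block_bonds_def block_of_bond_def)

lemma block_verts_joined:
  assumes B: "B \<in> blocks m h" and a: "a \<in> block_verts B" "b \<in> block_verts B"
  shows "(a, b) \<in> joined (bond_ends ` block_bonds B)"
proof -
  obtain j i where ji: "B = (j, i)" by (cases B)
  have le: "j \<le> h" "i < 2 * m * 2 ^ j" using B ji by (auto simp: blocks_def)
  let ?J = "joined (bond_ends ` block_bonds B)"
  have inn: "(((j, i, s), f), ((j, i, s), f')) \<in> ?J" if "s < l" "f \<in> piece_verts g" "f' \<in> piece_verts g" for s f f'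
    by (rule joined_inner[OF piece_verts_joined]) (use that ji in \<open>auto simp: block_bonds_def\<close>)
  have 01: "0 < D" "1 < D" using D by auto
  have root: "(((j, i, s), f), ((j, i, 0), (id, id))) \<in> ?J" if "s < l" "f \<in> piece_verts g" for s f
    using that
  proof (induction s arbitrary: f)
    case 0
    thus ?case using inn id_piece_verts by blast
  next
    case (Suc s)
    have t: "\<tau> ((j, i, Suc s), 0) = ((j, i, s), 1)" by (rule \<tau>_chain[OF le Suc.prems(1)])
    have "Inr ((j, i, Suc s), 0) \<in> block_bonds B" using Suc.prems ji by (auto simp: block_bonds_def)
    from joined_port[OF this 01(1)] have "(((j, i, Suc s), lab 0), ((j, i, s), kappa g (lab 1))) \<in> ?J"
      by (simp add: t)
    moreover have "(((j, i, Suc s), f), ((j, i, Suc s), lab 0)) \<in> ?J"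
      by (rule inn) (use Suc.prems lab_piece_verts[OF 01(1)] in auto)
    moreover have "(((j, i, s), kappa g (lab 1)), ((j, i, 0), (id, id))) \<in> ?J"
      by (rule Suc.IH) (use Suc.prems kappa_piece_verts[OF 01(2)] in auto)
    ultimately show ?case using joined_trans by meson
  qed
  have "(x, ((j, i, 0), (id, id))) \<in> ?J" if x: "x \<in> block_verts B" for x
  proof -
    obtain s f where "x = ((j, i, s), f)" "s < l" "f \<in> piece_verts g" using x ji by (auto simp: block_verts_def)
    thus ?thesis using root by blast
  qed
  thus ?thesis using a joined_sym joined_trans by meson
qed

text \<open>All blocks have the same size. A block that meets \<open>S\<close> without being contained
  in \<open>S\<close> is connected and therefore contributes a boundary edge of its own. The blocks contained in \<open>S\<close>
  form at most half of the forest, and \<open>forest_expansion\<close> gives many pairs of neighbours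
  of which only one is contained in \<open>S\<close>; such a pair yields a boundary edge unless a
  partially covered block is involved, and each of these spoils only boundedly many pairs.\<close>

lemma cut_bound:
  assumes S: "S \<subseteq> wired_verts" "2 * card S \<le> card wired_verts"
  shows "card S \<le> 177 * (l * card (piece_verts g)) * card (cut_bonds S)"
proof -
  define Full where "Full = {B \<in> blocks m h. block_verts B \<subseteq> S}"
  define Par where "Par = {B \<in> blocks m h. block_verts B \<inter> S \<noteq> {} \<and> \<not> block_verts B \<subseteq> S}"
  let ?C = "l * card (piece_verts g)" and ?c = "card (cut_bonds S)"
  have fin: "finite Full" "finite Par" using finite_blocks by (auto simp: Full_def Par_def)
  have fincut: "finite (cut_bonds S)" using finite_bonds by (simp add: cut_bonds_def)
  have C: "?C > 0" using l finite_piece_verts id_piece_verts by (auto simp: card_gt_0_iff)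
  have S_le: "card S \<le> (card Full + card Par) * ?C"
  proof -
    have "S \<subseteq> (\<Union>B\<in>Full \<union> Par. block_verts B)"
    proof
      fix x assume x: "x \<in> S"
      then obtain B where B: "B \<in> blocks m h" "x \<in> block_verts B" using S(1) unfolding wired_verts_block_verts by blast
      hence "B \<in> Full \<union> Par" using x unfolding Full_def Par_def by blast
      thus "x \<in> (\<Union>B\<in>Full \<union> Par. block_verts B)" using B by blast
    qed
    hence "card S \<le> card (\<Union>B\<in>Full \<union> Par. block_verts B)" using fin by (intro card_mono) auto
    also have "\<dots> = card (Full \<union> Par) * ?C" using fin by (intro card_UN_block_verts) auto
    also have "\<dots> \<le> (card Full + card Par) * ?C" by (intro mult_right_mono card_Un_le) simp
    finally show ?thesis .
  qed
  have Full_half: "2 * card Full \<le> card (blocks m h)"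
  proof -
    have "card Full * ?C = card (\<Union>B\<in>Full. block_verts B)" using card_UN_block_verts[OF fin(1)] by simp
    also have "\<dots> \<le> card S" using finite_subset[OF S(1) finite_wired_verts] by (intro card_mono) (auto simp: Full_def)
    finally have "2 * (card Full * ?C) \<le> card (blocks m h) * ?C"
      using S(2) card_UN_block_verts[OF finite_blocks, of m h] unfolding wired_verts_block_verts by linarith
    hence "(2 * card Full) * ?C \<le> card (blocks m h) * ?C" by (simp only: mult.assoc)
    thus ?thesis using C by (simp only: mult_le_cancel2)
  qed
  have par: "card Par \<le> ?c"
  proof -
    have "Par \<subseteq> block_of_bond ` cut_bonds S"
    proof
      fix B assume B: "B \<in> Par"
      then obtain a b where ab: "a \<in> block_verts B" "a \<in> S" "b \<in> block_verts B" "b \<notin> S" "B \<in> blocks m h" by (auto simp: Par_def)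
      have "\<exists>u v. {u, v} \<in> bond_ends ` block_bonds B \<and> u \<in> S \<and> v \<notin> S"
        using joined_closed[OF block_verts_joined[OF ab(5,1,3)] ab(2)] ab(4) by blast
      then obtain u v i where i: "i \<in> block_bonds B" "{u, v} = bond_ends i" "u \<in> S" "v \<notin> S" by blast
      hence "i \<in> cut_bonds S" using block_bonds_subset[OF ab(5)] by (auto simp: cut_bonds_def)
      thus "B \<in> block_of_bond ` cut_bonds S" using block_of_bond_inside[OF i(1)] by blast
    qed
    hence "card Par \<le> card (block_of_bond ` cut_bonds S)" using fincut by (intro card_mono) auto
    also have "\<dots> \<le> ?c" by (rule card_image_le[OF fincut])
    finally show ?thesis .
  qed
  have dich: "block_verts B \<subseteq> S \<and> B \<in> Full \<or> block_verts B \<inter> S = {} \<and> B \<notin> Full" if "B \<in> blocks m h" "B \<notin> Par" for B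
  proof -
    have "block_verts B \<noteq> {}" using C card_block_verts[of B] by auto
    thus ?thesis using that by (auto simp: Full_def Par_def)
  qed
  have cutI: "Inr ((j, i, s), k) \<in> cut_bonds S"
    if "(j, i, s) \<in> sites m h l" "k < D" "fst (\<tau> ((j, i, s), k)) = (j', i', s')"
      "(j, i) \<notin> Par" "(j', i') \<notin> Par" "((j, i) \<in> Full) \<noteq> ((j', i') \<in> Full)" for j i s k j' i' s'
  proof -
    have in': "(j', i', s') \<in> sites m h l" "snd (\<tau> ((j, i, s), k)) < D" using \<tau>_in[OF that(1,2)] that(3) by auto
    let ?u = "((j, i, s), lab k)" and ?v = "((j', i', s'), kappa g (lab (snd (\<tau> ((j, i, s), k)))))"
    have e: "bond_ends (Inr ((j, i, s), k)) = {?u, ?v}" using that(2,3) by (simp add: nb_u)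
    have "?u \<in> block_verts (j, i)" using that(1) lab_piece_verts[OF that(2)] by (auto simp: mem_block_verts mem_sites)
    moreover have "?v \<in> block_verts (j', i')" using in' kappa_piece_verts by (auto simp: mem_block_verts mem_sites)
    moreover have "(j, i) \<in> blocks m h" "(j', i') \<in> blocks m h" using that(1) in' by (auto simp: mem_sites blocks_def)
    ultimately have "(?u \<in> S) \<noteq> (?v \<in> S)" using dich[of "(j, i)"] dich[of "(j', i')"] that(4,5,6) by blast
    moreover have "Inr ((j, i, s), k) \<in> bonds" using that(1,2) by (auto simp: bonds_def)
    ultimately show ?thesis unfolding cut_bonds_def mem_Collect_eq e by blast
  qed
  \<comment> \<open>A block has one parent and two children, so a partially covered block spoils at most three links.\<close>
  have T: "card (tree_boundary m h Full) \<le> 4 * ?c"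
  proof -
    let ?T1 = "{(j, i). Inr ((Suc j, i, 0), 0) \<in> cut_bonds S}"
    let ?T2 = "{(j, i). (Suc j, i) \<in> Par}"
    let ?T3 = "(\<lambda>((j, i), a). (j, 2 * i + a)) ` (Par \<times> {..<2::nat})"
    have inj1: "inj_on (\<lambda>(j, i). Inr ((Suc j, i, 0), 0)) ?T1" by (auto simp: inj_on_def)
    have inj2: "inj_on (\<lambda>(j, i). (Suc j, i)) ?T2" by (auto simp: inj_on_def)
    have f1: "finite ?T1" by (rule inj_on_finite[OF inj1 _ fincut]) auto
    have f2: "finite ?T2" by (rule inj_on_finite[OF inj2 _ fin(2)]) auto
    have c1: "card ?T1 \<le> ?c" by (rule card_inj_on_le[OF inj1 _ fincut]) auto
    have c2: "card ?T2 \<le> card Par" by (rule card_inj_on_le[OF inj2 _ fin(2)]) auto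
    have c3: "card ?T3 \<le> card Par * 2"
      using card_image_le[of "Par \<times> {..<2::nat}" "\<lambda>((j, i), a). (j, 2 * i + a)"] fin by (simp add: card_cartesian_product)
    have "tree_boundary m h Full \<subseteq> ?T1 \<union> (?T2 \<union> ?T3)"
    proof
      fix ji assume "ji \<in> tree_boundary m h Full"
      then obtain j i where ji: "ji = (j, i)" "j < h" "i < 2 * m * 2 ^ Suc j" "((Suc j, i) \<in> Full) \<noteq> ((j, i div 2) \<in> Full)"
        by (auto simp: tree_boundary_def)
      consider "(Suc j, i) \<in> Par" | "(j, i div 2) \<in> Par" | "(Suc j, i) \<notin> Par" "(j, i div 2) \<notin> Par" by blast
      thus "ji \<in> ?T1 \<union> (?T2 \<union> ?T3)"
      proof cases
        case 1
        thus ?thesis using ji by auto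
      next
        case 2
        have "ji = (\<lambda>((j, i), a). (j, 2 * i + a)) ((j, i div 2), i mod 2)" using ji by simp
        moreover have "((j, i div 2), i mod 2) \<in> Par \<times> {..<2}" using 2 by simp
        ultimately have "ji \<in> ?T3" by blast
        thus ?thesis by blast
      next
        case 3
        have "Inr ((Suc j, i, 0), 0) \<in> cut_bonds S"
        proof (rule cutI[where j' = j and i' = "i div 2" and s' = "l - 1"])
          show "(Suc j, i, 0) \<in> sites m h l" using ji l by (auto simp: mem_sites)
          show "0 < D" using D by simp
          show "fst (\<tau> ((Suc j, i, 0), 0)) = (j, i div 2, l - 1)" using \<tau>_tree[OF ji(2,3)] by simp
        qed (use 3 ji in auto)
        thus ?thesis using ji by simp
      qed
    qed
    hence "card (tree_boundary m h Full) \<le> card (?T1 \<union> (?T2 \<union> ?T3))"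
      using f1 f2 fin by (intro card_mono) auto
    also have "\<dots> \<le> card ?T1 + (card ?T2 + card ?T3)"
      using card_Un_le[of ?T1 "?T2 \<union> ?T3"] card_Un_le[of ?T2 ?T3] by linarith
    finally show ?thesis using c1 c2 c3 par by linarith
  qed
  \<comment> \<open>A block at the top lies in \<open>21\<close> pairs as a source and in \<open>21\<close> pairs as a target.\<close>
  have Q: "card (top_boundary m h \<pi> Full) \<le> 43 * ?c"
  proof -
    let ?M = "2 * m * 2 ^ h"
    let ?Q1 = "{(i, k). Inr ((h, i, l - 1), 3 + k) \<in> cut_bonds S}"
    let ?P = "{i. (h, i) \<in> Par}"
    let ?Q2 = "?P \<times> {..<21::nat}"
    let ?Q3 = "{(i, k). i < ?M \<and> k < (21::nat) \<and> (h, \<pi> k i) \<in> Par}"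
    have inj1: "inj_on (\<lambda>(i, k). Inr ((h, i, l - 1), 3 + k)) ?Q1" by (auto simp: inj_on_def)
    have f1: "finite ?Q1" by (rule inj_on_finite[OF inj1 _ fincut]) auto
    have c1: "card ?Q1 \<le> ?c" by (rule card_inj_on_le[OF inj1 _ fincut]) auto
    have injP: "inj_on (Pair h) ?P" by (simp add: inj_on_def)
    have fP: "finite ?P" by (rule inj_on_finite[OF injP _ fin(2)]) auto
    have cP: "card ?P \<le> card Par" by (rule card_inj_on_le[OF injP _ fin(2)]) auto
    have c2: "card ?Q2 \<le> card Par * 21" using cP by (simp add: card_cartesian_product)
    have inj3: "inj_on (\<lambda>(i, k). (\<pi> k i, k)) ?Q3"
    proof (rule inj_onI)
      fix x y assume "x \<in> ?Q3" "y \<in> ?Q3" "(\<lambda>(i, k). (\<pi> k i, k)) x = (\<lambda>(i, k). (\<pi> k i, k)) y"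
      then obtain i i' k where "x = (i, k)" "y = (i', k)" "k < 21" "\<pi> k i = \<pi> k i'" by auto
      thus "x = y" using permutes_inj[OF \<pi>[of k]] by (auto dest: injD)
    qed
    have c3: "card ?Q3 \<le> card ?Q2" by (rule card_inj_on_le[OF inj3]) (use fP in auto)
    have f3: "finite ?Q3" by (rule finite_subset[of _ "{..<?M} \<times> {..<21}"]) auto
    have "top_boundary m h \<pi> Full \<subseteq> ?Q1 \<union> (?Q2 \<union> ?Q3)"
    proof
      fix ik assume "ik \<in> top_boundary m h \<pi> Full"
      then obtain i k where ik: "ik = (i, k)" "i < ?M" "k < 21" "((h, i) \<in> Full) \<noteq> ((h, \<pi> k i) \<in> Full)"
        by (auto simp: top_boundary_def)
      consider "(h, i) \<in> Par" | "(h, \<pi> k i) \<in> Par" | "(h, i) \<notin> Par" "(h, \<pi> k i) \<notin> Par" by blast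
      thus "ik \<in> ?Q1 \<union> (?Q2 \<union> ?Q3)"
      proof cases
        case 3
        have "Inr ((h, i, l - 1), 3 + k) \<in> cut_bonds S"
        proof (rule cutI[where j' = h and i' = "\<pi> k i" and s' = "l - 1"])
          show "(h, i, l - 1) \<in> sites m h l" using ik l by (auto simp: mem_sites)
          show "3 + k < D" using D ik by simp
          show "fst (\<tau> ((h, i, l - 1), 3 + k)) = (h, \<pi> k i, l - 1)" using \<tau>_top[OF ik(2,3)] by simp
        qed (use 3 ik in auto)
        thus ?thesis using ik by simp
      qed (use ik in auto)
    qed
    hence "card (top_boundary m h \<pi> Full) \<le> card (?Q1 \<union> (?Q2 \<union> ?Q3))"
      using f1 f3 fP by (intro card_mono) auto
    also have "\<dots> \<le> card ?Q1 + (card ?Q2 + card ?Q3)"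
      using card_Un_le[of ?Q1 "?Q2 \<union> ?Q3"] card_Un_le[of ?Q2 ?Q3] by linarith
    finally show ?thesis using c1 c2 c3 par by linarith
  qed
  have "card Full \<le> 4 * card (top_boundary m h \<pi> Full) + card (tree_boundary m h Full)"
    by (rule forest_expansion[OF _ Full_half \<pi> \<pi>_expanding]) (auto simp: Full_def)
  hence "card Full + card Par \<le> 177 * ?c" using T Q par by linarith
  hence "(card Full + card Par) * ?C \<le> 177 * ?c * ?C" by (rule mult_right_mono) simp
  thus ?thesis using S_le by (simp only: mult_ac)
qed

end

section \<open>Percolation on the wired graph\<close>

text \<open>The probability that each of several disjoint links of two edges is open.\<close>

lemma bond_mean_pairs_met:
  assumes "finite E" "finite A" "\<And>a. a \<in> A \<Longrightarrow> P a \<subseteq> E" "\<And>a. a \<in> A \<Longrightarrow> card (P a) = 2"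
    "\<And>a b. a \<in> A \<Longrightarrow> b \<in> A \<Longrightarrow> a \<noteq> b \<Longrightarrow> P a \<inter> P b = {}"
  shows "bond_mean p E (\<lambda>H. of_bool (\<forall>a\<in>A. H \<inter> P a \<noteq> {})) = (1 - (1 - p)\<^sup>2) ^ card A"
  using assms(2-5)
proof (induction A rule: finite_induct)
  case empty
  thus ?case using assms(1) by simp
next
  case (insert a A)
  let ?U = "\<Union>b\<in>A. P b"
  have sub: "P a \<subseteq> E" "?U \<subseteq> E" using insert.prems(1) by auto
  have disj: "P a \<inter> ?U = {}" using insert.prems(3) insert.hyps(2) by fastforce
  have fin: "finite (P a)" using sub(1) assms(1) finite_subset by blast
  have "bond_mean p E (\<lambda>H. of_bool (\<forall>b\<in>insert a A. H \<inter> P b \<noteq> {})) =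
      bond_mean p E (\<lambda>H. (\<lambda>H. of_bool (H \<inter> P a \<noteq> {})) (H \<inter> P a) * (\<lambda>H. of_bool (\<forall>b\<in>A. H \<inter> P b \<noteq> {})) (H \<inter> ?U))"
  proof (intro bond_mean_cong)
    fix H
    have "H \<inter> ?U \<inter> P b = H \<inter> P b" if "b \<in> A" for b using that by auto
    thus "of_bool (\<forall>b\<in>insert a A. H \<inter> P b \<noteq> {}) =
        of_bool (H \<inter> P a \<inter> P a \<noteq> {}) * (of_bool (\<forall>b\<in>A. H \<inter> ?U \<inter> P b \<noteq> {}) :: real)"
      by (simp add: Int_assoc)
  qed
  also have "\<dots> = bond_mean p (P a) (\<lambda>H. of_bool (H \<inter> P a \<noteq> {})) *
      bond_mean p ?U (\<lambda>H. of_bool (\<forall>b\<in>A. H \<inter> P b \<noteq> {}))"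
    by (rule bond_mean_indep[OF assms(1) sub disj])
  also have "bond_mean p (P a) (\<lambda>H. of_bool (H \<inter> P a \<noteq> {})) = 1 - (1 - p)\<^sup>2"
  proof -
    have "bond_mean p (P a) (\<lambda>H. of_bool (H \<inter> P a \<noteq> {})) =
        bond_mean p (P a) (\<lambda>H. 1 + (- 1) * of_bool (H \<inter> P a = {}))"
      by (intro bond_mean_cong) auto
    also have "\<dots> = 1 + (- 1) * bond_mean p (P a) (\<lambda>H. of_bool (H \<inter> P a = {}))"
      using fin by (simp only: bond_mean_add bond_mean_cmult bond_mean_const)
    also have "\<dots> = 1 - (1 - p)\<^sup>2"
      using bond_mean_all_closed[OF fin, of "P a" p] insert.prems(2)[of a] by simp
    finally show ?thesis .
  qed
  also have "bond_mean p ?U (\<lambda>H. of_bool (\<forall>b\<in>A. H \<inter> P b \<noteq> {})) =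
      bond_mean p E (\<lambda>H. (\<lambda>H. of_bool (\<forall>b\<in>A. H \<inter> P b \<noteq> {})) (H \<inter> ?U))"
    by (rule bond_mean_restrict[OF assms(1) sub(2), symmetric])
  also have "\<dots> = bond_mean p E (\<lambda>H. of_bool (\<forall>b\<in>A. H \<inter> P b \<noteq> {}))"
  proof (intro bond_mean_cong)
    fix H
    have "H \<inter> ?U \<inter> P b = H \<inter> P b" if "b \<in> A" for b using that by auto
    thus "of_bool (\<forall>b\<in>A. H \<inter> ?U \<inter> P b \<noteq> {}) = (of_bool (\<forall>b\<in>A. H \<inter> P b \<noteq> {}) :: real)" by simp
  qed
  also have "\<dots> = (1 - (1 - p)\<^sup>2) ^ card A" using insert.prems by (intro insert.IH) auto
  finally show ?case using insert.hyps by simp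
qed

context tower
begin

type_synonym config = "(nat \<times> nat \<times> nat) bond set"

definition linkopen :: "config \<Rightarrow> nat \<Rightarrow> nat \<Rightarrow> nat \<Rightarrow> bool" where
  "linkopen J j i s \<longleftrightarrow> Inr ((j, i, Suc s), 0) \<in> J \<or> Inr ((j, i, s), 1) \<in> J"

definition blockopen :: "config \<Rightarrow> nat \<Rightarrow> nat \<Rightarrow> bool" where
  "blockopen J j i \<longleftrightarrow> (\<forall>s < l - 1. linkopen J j i s)"

primrec upopen :: "config \<Rightarrow> nat \<Rightarrow> nat \<Rightarrow> bool" where
  "upopen J 0 i \<longleftrightarrow> True"
| "upopen J (Suc j) i \<longleftrightarrow> upopen J j (i div 2) \<and> blockopen J j (i div 2)"

definition crossing :: "config \<Rightarrow> bool" where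
  "crossing J \<longleftrightarrow> (\<exists>i < 2 * m * 2 ^ h. upopen J h i \<and> blockopen J h i)"

text \<open>The sites above the first half of the bottom whose whole path down to the bottom consists of open links. Only links along the
  chains are tested: whatever the state of a link between two levels, its ends lie in the
  region together.\<close>

definition lower_region :: "config \<Rightarrow> (nat \<times> nat \<times> nat) set" where
  "lower_region J = {(j, i, s). i div 2 ^ j div m = 0 \<and> upopen J j i \<and> (\<forall>s' < s. linkopen J j i s')}"

lemma mem_lower_region: "(j, i, s) \<in> lower_region J \<longleftrightarrow> i div 2 ^ j div m = 0 \<and> upopen J j i \<and> (\<forall>s' < s. linkopen J j i s')"
  by (simp add: lower_region_def)

lemma upopen_blockopen_iff:
  "upopen J j i \<and> blockopen J j i \<longleftrightarrow> (\<forall>j' \<le> j. blockopen J j' (i div 2 ^ (j - j')))"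
proof (induction j arbitrary: i)
  case (Suc j)
  have "(\<forall>j' \<le> Suc j. blockopen J j' (i div 2 ^ (Suc j - j'))) \<longleftrightarrow>
      (\<forall>j' \<le> j. blockopen J j' (i div 2 ^ (Suc j - j'))) \<and> blockopen J (Suc j) i"
    by (auto simp: le_Suc_eq)
  also have "(\<forall>j' \<le> j. blockopen J j' (i div 2 ^ (Suc j - j'))) \<longleftrightarrow>
      (\<forall>j' \<le> j. blockopen J j' (i div 2 div 2 ^ (j - j')))"
    by (simp add: Suc_diff_le div_mult2_eq)
  finally show ?case using Suc[of "i div 2"] by auto
qed simp

lemma tree_step_lower_region: "(Suc j, i, 0) \<in> lower_region J \<longleftrightarrow> (j, i div 2, l - 1) \<in> lower_region J"
  by (auto simp: mem_lower_region blockopen_def div_mult2_eq)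

lemma chain_step_lower_region: "linkopen J j i s \<Longrightarrow> (j, i, Suc s) \<in> lower_region J \<longleftrightarrow> (j, i, s) \<in> lower_region J"
  by (auto simp: mem_lower_region less_Suc_eq)

lemma top_not_lower_region: "\<not> crossing J \<Longrightarrow> i < 2 * m * 2 ^ h \<Longrightarrow> (h, i, l - 1) \<notin> lower_region J"
  by (auto simp: mem_lower_region crossing_def blockopen_def)

text \<open>The region can be left neither within the bottom, where the matching preserves the halves,
  nor at the top, which it does not reach unless there is a crossing.\<close>

lemma lower_region_closed:
  assumes J: "J \<subseteq> bonds" "\<not> crossing J" and "Inr (y, k) \<in> J"
  shows "y \<in> lower_region J \<longleftrightarrow> fst (\<tau> (y, k)) \<in> lower_region J"
proof -
  obtain j i s where y: "y = (j, i, s)" by (metis prod.exhaust)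
  have YD: "(j, i, s) \<in> sites m h l" "k < D" using assms y by (auto simp: bonds_def)
  have in': "fst (\<tau> ((j, i, s), k)) \<in> sites m h l" using \<tau>_in[OF YD] by blast
  from \<tau>_cases[OF YD] show ?thesis unfolding y
  proof (elim disjE conjE exE)
    assume "k = 0" "0 < s" "fst (\<tau> ((j, i, s), k)) = (j, i, s - 1)"
    moreover from this have "linkopen J j i (s - 1)" using assms(3) y by (simp add: linkopen_def)
    ultimately show "(j, i, s) \<in> lower_region J \<longleftrightarrow> fst (\<tau> ((j, i, s), k)) \<in> lower_region J"
      using chain_step_lower_region[of J j i "s - 1"] by simp
  next
    assume "k = 1" "Suc s < l" "fst (\<tau> ((j, i, s), k)) = (j, i, Suc s)"
    moreover from this have "linkopen J j i s" using assms(3) y by (simp add: linkopen_def)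
    ultimately show "(j, i, s) \<in> lower_region J \<longleftrightarrow> fst (\<tau> ((j, i, s), k)) \<in> lower_region J"
      using chain_step_lower_region[of J j i s] by simp
  next
    assume "s = 0" "0 < j" "fst (\<tau> ((j, i, s), k)) = (j - 1, i div 2, l - 1)"
    thus "(j, i, s) \<in> lower_region J \<longleftrightarrow> fst (\<tau> ((j, i, s), k)) \<in> lower_region J"
      using tree_step_lower_region[of "j - 1" i J] by simp
  next
    fix a assume "Suc s = l" "(a::nat) < 2" "fst (\<tau> ((j, i, s), k)) = (Suc j, 2 * i + a, 0)"
    moreover from this have "(2 * i + a) div 2 = i" "s = l - 1" by auto
    ultimately show "(j, i, s) \<in> lower_region J \<longleftrightarrow> fst (\<tau> ((j, i, s), k)) \<in> lower_region J"
      using tree_step_lower_region[of j "2 * i + a" J] by simp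
  next
    fix i' assume "j = 0" "s = 0" "i' div m = i div m" "fst (\<tau> ((j, i, s), k)) = (0, i', 0)"
    thus "(j, i, s) \<in> lower_region J \<longleftrightarrow> fst (\<tau> ((j, i, s), k)) \<in> lower_region J" by (simp add: mem_lower_region)
  next
    fix i' assume a: "j = h" "Suc s = l" "fst (\<tau> ((j, i, s), k)) = (h, i', l - 1)"
    hence "i < 2 * m * 2 ^ h" "i' < 2 * m * 2 ^ h" "s = l - 1" using YD(1) in' by (auto simp: mem_sites)
    thus "(j, i, s) \<in> lower_region J \<longleftrightarrow> fst (\<tau> ((j, i, s), k)) \<in> lower_region J" using top_not_lower_region[OF J(2)] a by simp
  qed simp
qed

text \<open>Each node of the top level has only one path to the bottom, which contains \<open>Suc h\<close>
  disjoint chains of \<open>l - 1\<close> links.\<close>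

lemma crossing_prob:
  fixes p :: real
  assumes p: "0 \<le> p" "p \<le> 1"
  shows "bond_mean p bonds (\<lambda>J. of_bool (crossing J)) \<le> (2 * m * 2 ^ h) * ((1 - (1 - p)\<^sup>2) ^ (l - 1)) ^ Suc h"
proof -
  let ?A = "{..h} \<times> {..<l - 1}"
  define P :: "nat \<Rightarrow> nat \<times> nat \<Rightarrow> config" where
    "P i = (\<lambda>(j, s). {Inr ((j, i div 2 ^ (h - j), Suc s), 0), Inr ((j, i div 2 ^ (h - j), s), 1)})" for i
  have "bond_mean p bonds (\<lambda>J. of_bool (crossing J)) \<le>
      (\<Sum>i<2 * m * 2 ^ h. bond_mean p bonds (\<lambda>J. of_bool (\<forall>a\<in>?A. J \<inter> P i a \<noteq> {})))"
  proof (rule bond_mean_exists_le[OF p])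
    fix J assume "crossing J"
    then obtain i where i: "i < 2 * m * 2 ^ h" "upopen J h i \<and> blockopen J h i" by (auto simp: crossing_def)
    hence "\<forall>j \<le> h. blockopen J j (i div 2 ^ (h - j))" by (simp add: upopen_blockopen_iff)
    hence "\<forall>a\<in>?A. J \<inter> P i a \<noteq> {}" by (fastforce simp: P_def blockopen_def linkopen_def)
    thus "\<exists>i\<in>{..<2 * m * 2 ^ h}. \<forall>a\<in>?A. J \<inter> P i a \<noteq> {}" using i by blast
  qed simp
  also have "\<dots> = (\<Sum>i<2 * m * 2 ^ h. (1 - (1 - p)\<^sup>2) ^ card ?A)"
  proof (intro sum.cong refl bond_mean_pairs_met finite_bonds)
    fix i a assume i: "i \<in> {..<2 * m * 2 ^ h}" and a: "a \<in> ?A"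
    obtain j s where js: "a = (j, s)" "j \<le> h" "s < l - 1" using a by auto
    have "i < 2 * m * 2 ^ j * 2 ^ (h - j)" using i js(2) by (simp add: mult.assoc flip: power_add)
    hence "i div 2 ^ (h - j) < 2 * m * 2 ^ j" by (simp add: less_mult_imp_div_less)
    thus "P i a \<subseteq> bonds" using js D by (auto simp: P_def bonds_def mem_sites)
    show "card (P i a) = 2" using js by (simp add: P_def)
  qed (auto simp: P_def)
  also have "\<dots> = (2 * m * 2 ^ h) * ((1 - (1 - p)\<^sup>2) ^ (l - 1)) ^ Suc h"
  proof -
    have cA: "card ?A = (l - 1) * Suc h" by (simp add: card_cartesian_product)
    show ?thesis unfolding cA power_mult by simp
  qed
  finally show ?thesis .
qed

definition inner_of :: "nat \<Rightarrow> config \<Rightarrow> (nat \<times> piece_vertex set) set" where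
  "inner_of b J = {(x, e). x < m \<and> e \<in> piece_edges g \<and> Inl ((0, b * m + x, 0), e) \<in> J}"

definition ports_of :: "nat \<Rightarrow> config \<Rightarrow> (nat \<times> nat) set" where
  "ports_of b J = {(x, k). x < m \<and> 3 \<le> k \<and> k < D \<and> Inr ((0, b * m + x, 0), k) \<in> J}"

definition large :: "nat \<Rightarrow> real \<Rightarrow> nat \<Rightarrow> config \<Rightarrow> bool" where
  "large K a b J \<longleftrightarrow> large_glued a (SIGMA x:{..<m}. good_labels K (slice (inner_of b J) x))
     (\<lambda>(x, i). (x, label_cluster (slice (inner_of b J) x) i)) \<sigma> (ports_of b J)"

lemma base_sites: "b < 2 \<Longrightarrow> x < m \<Longrightarrow> (0, b * m + x, 0) \<in> sites m h l"
  using l by (cases b) (auto simp: mem_sites)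

text \<open>The event depends only on the edges inside the pieces of one half of the bottom and on the
  edges of its matching, so it is the event of \<open>random_wiring\<close>.\<close>

lemma large_prob:
  assumes b: "b < 2"
  shows "bond_mean p bonds (\<lambda>J. of_bool (\<not> large K a b J)) =
    bond_mean p ({..<m} \<times> piece_edges g) (\<lambda>J1. bond_mean p ({..<m} \<times> {3..<D}) (\<lambda>H. of_bool
      (\<not> large_glued a (SIGMA x:{..<m}. good_labels K (slice J1 x)) (\<lambda>(x, i). (x, label_cluster (slice J1 x) i)) \<sigma> H)))"
proof -
  define f1 :: "nat \<times> piece_vertex set \<Rightarrow> (nat \<times> nat \<times> nat) bond"
    where "f1 = (\<lambda>(x, e). Inl ((0, b * m + x, 0), e))"
  define f2 :: "nat \<times> nat \<Rightarrow> (nat \<times> nat \<times> nat) bond"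
    where "f2 = (\<lambda>(x, k). Inr ((0, b * m + x, 0), k))"
  let ?A1 = "{..<m} \<times> piece_edges g" and ?A2 = "{..<m} \<times> {3..<D}"
  have fin: "finite ?A1" "finite ?A2" using finite_piece_edges by auto
  have inj: "inj_on f1 ?A1" "inj_on f2 ?A2" by (auto simp: inj_on_def f1_def f2_def)
  have sub: "f1 ` ?A1 \<union> f2 ` ?A2 \<subseteq> bonds"
    using base_sites[OF b] by (auto simp: f1_def f2_def bonds_def)
  have disj: "f1 ` ?A1 \<inter> f2 ` ?A2 = {}" by (auto simp: f1_def f2_def)
  have of1: "inner_of b (J \<inter> (f1 ` ?A1 \<union> f2 ` ?A2)) = inner_of b J" "ports_of b (J \<inter> (f1 ` ?A1 \<union> f2 ` ?A2)) = ports_of b J" for J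
    by (auto simp: inner_of_def ports_of_def f1_def f2_def image_iff)
  have "bond_mean p bonds (\<lambda>J. of_bool (\<not> large K a b J)) =
      bond_mean p bonds (\<lambda>J. (\<lambda>J. of_bool (\<not> large K a b J)) (J \<inter> (f1 ` ?A1 \<union> f2 ` ?A2)))"
    by (simp add: large_def of1)
  also have "\<dots> = bond_mean p (f1 ` ?A1 \<union> f2 ` ?A2) (\<lambda>J. of_bool (\<not> large K a b J))"
    by (rule bond_mean_restrict[OF finite_bonds sub])
  also have "\<dots> = bond_mean p (f1 ` ?A1) (\<lambda>J1. bond_mean p (f2 ` ?A2) (\<lambda>J2. of_bool (\<not> large K a b (J1 \<union> J2))))"
    by (rule bond_mean_union[OF _ _ disj]) (use fin in auto)
  also have "\<dots> = bond_mean p ?A1 (\<lambda>J1. bond_mean p ?A2 (\<lambda>H. of_bool (\<not> large K a b (f1 ` J1 \<union> f2 ` H))))"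
    by (simp only: bond_mean_image[OF fin(1) inj(1)] bond_mean_image[OF fin(2) inj(2)])
  also have "\<dots> = bond_mean p ?A1 (\<lambda>J1. bond_mean p ?A2 (\<lambda>H. of_bool
      (\<not> large_glued a (SIGMA x:{..<m}. good_labels K (slice J1 x)) (\<lambda>(x, i). (x, label_cluster (slice J1 x) i)) \<sigma> H)))"
  proof (intro bond_mean_cong)
    fix J1 H assume s: "J1 \<subseteq> ?A1" "H \<subseteq> ?A2"
    have i1: "Inl ((0, b * m + x, 0), e) \<in> f1 ` J1 \<union> f2 ` H \<longleftrightarrow> (x, e) \<in> J1" for x e
      by (force simp: f1_def f2_def)
    have i2: "Inr ((0, b * m + x, 0), k) \<in> f1 ` J1 \<union> f2 ` H \<longleftrightarrow> (x, k) \<in> H" for x k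
      by (force simp: f1_def f2_def)
    have "inner_of b (f1 ` J1 \<union> f2 ` H) = J1" "ports_of b (f1 ` J1 \<union> f2 ` H) = H"
      unfolding inner_of_def ports_of_def i1 i2 using s by auto
    thus "(of_bool (\<not> large K a b (f1 ` J1 \<union> f2 ` H)) :: real) = of_bool (\<not> large_glued a (SIGMA x:{..<m}. good_labels K (slice J1 x)) (\<lambda>(x, i). (x, label_cluster (slice J1 x) i)) \<sigma> H)"
      by (simp add: large_def)
  qed
  finally show ?thesis .
qed

lemma large_set:
  assumes b: "b < 2" and large: "large K a b J"
  obtains X where "X \<subseteq> wired_verts" "a \<le> real (card X)" "\<forall>u\<in>X. \<forall>v\<in>X. (u, v) \<in> joined (bond_ends ` J)"
    "fst ` X \<subseteq> {(0, b * m + x, 0) | x. x < m}"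
proof -
  let ?s = "slice (inner_of b J)"
  let ?Wg = "SIGMA x:{..<m}. good_labels K (?s x)"
  let ?cl = "\<lambda>(x, i). (x, label_cluster (?s x) i)"
  obtain X where X: "X \<subseteq> ?Wg" "a \<le> real (card X)"
      "\<And>u v. u \<in> X \<Longrightarrow> v \<in> X \<Longrightarrow> (u, v) \<in> (glue ?Wg ?cl \<sigma> (ports_of b J))\<^sup>*"
    using large unfolding large_def large_glued_def by blast
  define \<phi> where "\<phi> = (\<lambda>(x, k). ((0::nat, b * m + x, 0::nat), lab k))"
  have goodD: "k < D" "3 \<le> k" "(lab k, kappa g (lab k)) \<in> joined H" if "k \<in> good_labels K H" for k H
    using that by (auto simp: good_labels_def)
  have inn: "(((0, b * m + x, 0), f), ((0, b * m + x, 0), f')) \<in> joined (bond_ends ` J)"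
    if "x < m" "(f, f') \<in> joined (?s x)" for x f f'
    by (rule joined_inner[OF that(2)]) (auto simp: slice_def inner_of_def)
  have port: "(\<phi> u, \<phi> (\<sigma> u)) \<in> joined (bond_ends ` J)" if u: "u \<in> ports_of b J" "\<sigma> u \<in> ?Wg" for u
  proof -
    obtain x k where xk: "u = (x, k)" "x < m" "3 \<le> k" "k < D" "Inr ((0, b * m + x, 0), k) \<in> J"
      using u(1) by (auto simp: ports_of_def)
    obtain x' k' where xk': "\<sigma> (x, k) = (x', k')" by fastforce
    hence g': "x' < m" "k' \<in> good_labels K (?s x')" using u(2) xk(1) by auto
    have e1: "\<phi> u = ((0, b * m + x, 0), lab k)" by (simp add: \<phi>_def xk)
    have e2: "\<phi> (\<sigma> u) = ((0, b * m + x', 0), lab k')" by (simp add: \<phi>_def xk xk')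
    have "(((0, b * m + x, 0), lab k), ((0, b * m + x', 0), kappa g (lab k'))) \<in> joined (bond_ends ` J)"
      using joined_port[OF xk(5,4)] \<tau>_bottom[OF b xk(2-4)] xk' by simp
    moreover have "(((0, b * m + x', 0), kappa g (lab k')), ((0, b * m + x', 0), lab k')) \<in> joined (bond_ends ` J)"
      by (rule inn[OF g'(1)]) (rule joined_sym[OF goodD(3)[OF g'(2)]])
    ultimately show ?thesis unfolding e1 e2 by (rule joined_trans)
  qed
  have glue_step: "(\<phi> u, \<phi> v) \<in> joined (bond_ends ` J)" if uv: "(u, v) \<in> glue ?Wg ?cl \<sigma> (ports_of b J)" for u v
  proof -
    have W: "u \<in> ?Wg" "v \<in> ?Wg" and c: "?cl u = ?cl v \<or> (u \<in> ports_of b J \<and> v = \<sigma> u) \<or> (v \<in> ports_of b J \<and> u = \<sigma> v)"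
      using uv unfolding glue_def by blast+
    from c show ?thesis
    proof (elim disjE conjE)
      assume eq: "?cl u = ?cl v"
      obtain x k x' k' where uv': "u = (x, k)" "v = (x', k')" "x < m" using W by auto
      hence "x' = x" "label_cluster (?s x) k' = label_cluster (?s x) k" using eq by auto
      hence "(lab k, lab k') \<in> joined (?s x)" by (simp add: label_cluster_eq)
      thus ?thesis using inn[OF uv'(3)] uv' \<open>x' = x\<close> by (simp add: \<phi>_def)
    next
      assume u: "u \<in> ports_of b J" "v = \<sigma> u"
      show ?thesis unfolding u(2) by (rule port[OF u(1)]) (use W(2) u(2) in simp)
    next
      assume v: "v \<in> ports_of b J" "u = \<sigma> v"
      show ?thesis unfolding v(2) by (rule joined_sym, rule port[OF v(1)]) (use W(1) v(2) in simp)
    qed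
  qed
  have steps: "(\<phi> u, \<phi> v) \<in> joined (bond_ends ` J)" if uv: "(u, v) \<in> (glue ?Wg ?cl \<sigma> (ports_of b J))\<^sup>*" for u v
    using uv
  proof (induction rule: rtrancl_induct)
    case (step v w)
    show ?case by (rule joined_trans[OF step.IH glue_step[OF step.hyps(2)]])
  qed simp
  have inj: "inj_on \<phi> X"
  proof (rule inj_onI)
    fix u v assume uv: "u \<in> X" "v \<in> X" "\<phi> u = \<phi> v"
    obtain x k x' k' where xk: "u = (x, k)" "v = (x', k')" by (metis prod.exhaust)
    have "u \<in> ?Wg" "v \<in> ?Wg" using uv X(1) by blast+
    hence kD: "k < D" "k' < D" using goodD(1) xk by auto
    have eq: "x = x'" "lab k = lab k'" using uv(3) by (auto simp: \<phi>_def xk)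
    have "k = label_of (lab k)" by (rule label_of_lab[OF kD(1), symmetric])
    also have "\<dots> = k'" unfolding eq(2) by (rule label_of_lab[OF kD(2)])
    finally show "u = v" using eq(1) xk by simp
  qed
  show thesis
  proof (rule that[of "\<phi> ` X"])
    have mem: "\<exists>x k. \<phi> u = ((0, b * m + x, 0), lab k) \<and> x < m \<and> k < D" if u: "u \<in> X" for u
    proof -
      have "u \<in> ?Wg" using X(1) u by blast
      then obtain x k where xk: "u = (x, k)" "x < m" "k \<in> good_labels K (?s x)" by blast
      have "\<phi> u = ((0, b * m + x, 0), lab k)" by (simp add: \<phi>_def xk(1))
      thus ?thesis using xk(2) goodD(1)[OF xk(3)] by blast
    qed
    show "\<phi> ` X \<subseteq> wired_verts"
    proof
      fix z assume "z \<in> \<phi> ` X"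
      then obtain u where u: "u \<in> X" "z = \<phi> u" by blast
      obtain x k where "z = ((0, b * m + x, 0), lab k)" "x < m" "k < D" using mem[OF u(1)] u(2) by blast
      thus "z \<in> wired_verts" using base_sites[OF b] lab_piece_verts by (simp add: wired_verts_def)
    qed
    show "a \<le> real (card (\<phi> ` X))" using X(2) card_image[OF inj] by simp
    show "\<forall>u\<in>\<phi> ` X. \<forall>v\<in>\<phi> ` X. (u, v) \<in> joined (bond_ends ` J)"
      using X(3) steps by simp
    show "fst ` \<phi> ` X \<subseteq> {(0, b * m + x, 0) | x. x < m}"
    proof
      fix z assume "z \<in> fst ` \<phi> ` X"
      then obtain u where u: "u \<in> X" "z = fst (\<phi> u)" by blast
      obtain x k where "\<phi> u = ((0, b * m + x, 0), lab k)" "x < m" using mem[OF u(1)] by blast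
      hence "z = (0, b * m + x, 0)" "x < m" using u(2) by auto
      thus "z \<in> {(0, b * m + x, 0) | x. x < m}" by blast
    qed
  qed
qed

lemma two_comp_event:
  assumes J: "J \<subseteq> bonds" "\<not> crossing J" and large: "large K a 0 J" "large K a 1 J" and a: "0 < a"
  shows "two_large_sets J (nat \<lceil>a\<rceil>)"
proof -
  have b: "(0::nat) < 2" "(1::nat) < 2" by simp_all
  obtain X1 where X1: "X1 \<subseteq> wired_verts" "a \<le> real (card X1)" "\<forall>u\<in>X1. \<forall>v\<in>X1. (u, v) \<in> joined (bond_ends ` J)"
    "fst ` X1 \<subseteq> {(0, 0 * m + x, 0) | x. x < m}"
    by (rule large_set[OF b(1) large(1)]) (erule (3) that)
  obtain X2 where X2: "X2 \<subseteq> wired_verts" "a \<le> real (card X2)" "\<forall>u\<in>X2. \<forall>v\<in>X2. (u, v) \<in> joined (bond_ends ` J)"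
    "fst ` X2 \<subseteq> {(0, 1 * m + x, 0) | x. x < m}"
    by (rule large_set[OF b(2) large(2)]) (erule (3) that)
  have in1: "fst ` X1 \<subseteq> lower_region J"
  proof
    fix y assume "y \<in> fst ` X1"
    then obtain x where "y = (0, x, 0)" "x < m" using X1(4) by auto
    thus "y \<in> lower_region J" by (simp add: mem_lower_region)
  qed
  have in2: "fst ` X2 \<inter> lower_region J = {}"
  proof -
    have "y \<notin> lower_region J" if y: "y \<in> fst ` X2" for y
    proof -
      obtain x where x: "y = (0, m + x, 0)" "x < m" using X2(4) y by auto
      hence "(m + x) div m = 1" by (simp add: div_add_self1)
      thus ?thesis using x by (simp add: mem_lower_region)
    qed
    thus ?thesis by blast
  qed
  have ne: "X1 \<noteq> {}" "X2 \<noteq> {}" using X1(2) X2(2) a by auto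
  have card: "nat \<lceil>a\<rceil> \<le> card X1" "nat \<lceil>a\<rceil> \<le> card X2" using X1(2) X2(2) by linarith+
  have closed: "\<forall>y k. Inr (y, k) \<in> J \<longrightarrow> (y \<in> lower_region J \<longleftrightarrow> fst (\<tau> (y, k)) \<in> lower_region J)"
    by (intro allI impI lower_region_closed[OF J])
  show ?thesis unfolding two_large_sets_def
    by (rule exI[of _ "lower_region J"], rule exI[of _ X1], rule exI[of _ X2])
      (intro conjI X1(1,3) X2(1,3) ne card in1 in2 closed)
qed

lemma event_prob:
  fixes p :: real
  assumes p: "0 \<le> p" "p \<le> 1"
    and \<delta>: "\<And>b. b < 2 \<Longrightarrow> bond_mean p bonds (\<lambda>J. of_bool (\<not> large K a b J)) \<le> \<delta>"
  shows "1 - (2 * m * 2 ^ h) * ((1 - (1 - p)\<^sup>2) ^ (l - 1)) ^ Suc h - 2 * \<delta> \<le>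
     bond_mean p bonds (\<lambda>J. of_bool (\<not> crossing J \<and> large K a 0 J \<and> large K a 1 J))"
proof -
  let ?E = "bond_mean p bonds"
  have "1 = ?E (\<lambda>_. 1)" using finite_bonds by simp
  also have "\<dots> \<le> ?E (\<lambda>J. of_bool (\<not> crossing J \<and> large K a 0 J \<and> large K a 1 J) +
      (of_bool (crossing J) + (of_bool (\<not> large K a 0 J) + of_bool (\<not> large K a 1 J))))"
    by (intro bond_mean_mono p) auto
  also have "\<dots> = ?E (\<lambda>J. of_bool (\<not> crossing J \<and> large K a 0 J \<and> large K a 1 J)) +
      (?E (\<lambda>J. of_bool (crossing J)) + (?E (\<lambda>J. of_bool (\<not> large K a 0 J)) + ?E (\<lambda>J. of_bool (\<not> large K a 1 J))))"
    by (simp only: bond_mean_add)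
  finally show ?thesis using crossing_prob[OF p] \<delta>[of 0] \<delta>[of 1] by simp
qed

end

section \<open>Choice of the parameters\<close>

text \<open>Both halves of the bottom are matched by the same permutation. The asserted event fails only if there
  is a crossing or if one of the two halves has no large cluster.\<close>

lemma (in labelled) expander_with_two_large_clusters:
  fixes p \<theta> :: real and K m h l :: nat
  assumes p: "0 < p" "p < 1" and \<theta>: "0 < \<theta>" "\<theta> \<le> 1" and K: "0 < K" and D: "24 \<le> D"
    and m: "1 \<le> m" and h: "1 \<le> h" and l: "2 \<le> l"
    and good_labels: "\<And>k. k \<in> {3..<D} \<Longrightarrow> \<theta> \<le> bond_mean p (piece_edges g) (\<lambda>H. of_bool (k \<in> good_labels K H))"
  obtains G :: "nat ugraph" where
    "regular_expander (1 / (177 * real (l * card (piece_verts g)))) d G" "enat g0 \<le> girth G"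
    "card (verts G) = (\<Sum>j\<le>h. 2 * m * 2 ^ j) * (l * card (piece_verts g))"
    "1 - real (2 * m * 2 ^ h) * ((1 - (1 - p)\<^sup>2) ^ (l - 1)) ^ Suc h
       - 2 * (4 / (\<theta>\<^sup>2 * m) + 2 powr (real (m * (D - 3)) / K) * (1 - p * \<theta> / 8) powr (\<theta> * real (m * (D - 3)) / 8))
     \<le> measure_pmf.prob (percolation G p) {H. nat \<lceil>\<theta> * real (m * (D - 3)) / 8\<rceil> \<le> card (nth_component H 2)}"
proof -
  let ?w = "real (m * (D - 3))"
  let ?\<delta> = "4 / (\<theta>\<^sup>2 * m) + 2 powr (?w / K) * (1 - p * \<theta> / 8) powr (\<theta> * ?w / 8)"
  obtain \<sigma> where \<sigma>: "\<sigma> permutes {..<m} \<times> {3..<D}"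
    "bond_mean p ({..<m} \<times> piece_edges g) (\<lambda>J. bond_mean p ({..<m} \<times> {3..<D}) (\<lambda>H. of_bool (\<not> large_glued (\<theta> * real (m * card {3..<D}) / 8)
        (SIGMA x:{..<m}. good_labels K (slice J x)) (\<lambda>(x, i). (x, label_cluster (slice J x) i)) \<sigma> H)))
     \<le> 4 / (\<theta>\<^sup>2 * m) + 2 powr (real (m * card {3..<D}) / K) * (1 - p * \<theta> / 8) powr (\<theta> * real (m * card {3..<D}) / 8)"
  proof (rule random_wiring[where E = "piece_edges g" and L = "{3..<D}" and good_labels = "good_labels K" and cl = label_cluster and p = p and \<theta> = \<theta> and m = m and K = K])
    show "finite (piece_edges g)" by (rule finite_piece_edges)
    show "{3..<D} \<noteq> {}" using D by simp
    show "good_labels K H \<subseteq> {3..<D}" for H by (auto simp: good_labels_def)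
    show "K \<le> card {j \<in> good_labels K H. label_cluster H j = label_cluster H i}" if "i \<in> good_labels K H" for H i
      by (rule good_clusters[OF that])
    show "\<theta> \<le> bond_mean p (piece_edges g) (\<lambda>H. of_bool (i \<in> good_labels K H))" if "i \<in> {3..<D}" for i
      by (rule good_labels[OF that])
  qed (use p \<theta> K m in auto)
  note wiring = \<sigma>(2)
  have cD: "card {3..<D} = D - 3" by simp
  show thesis
  proof (rule expanding_permutations_exist[of "2 * m * 2 ^ h"], goal_cases)
  case (1 \<pi>)
  note \<pi> = 1
  show thesis
  proof (rule wiring_exists[OF h l D \<sigma>(1) \<pi>(1)], assumption, goal_cases)
  case (1 \<tau>)
  note \<tau> = 1
  interpret tower d g0 g D m h l lab \<tau> \<sigma> \<pi>
  proof unfold_locales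
    show "finite (sites m h l)" by (rule finite_sites)
    show "sites m h l \<noteq> {}" using m l by (auto simp: sites_def intro!: exI[of _ 0])
  qed (fact \<tau> \<sigma> \<pi> m h l D)+
  let ?a = "\<theta> * ?w / 8"
  have a: "0 < ?a" using \<theta> m D by simp
  have \<delta>: "bond_mean p bonds (\<lambda>J. of_bool (\<not> large K ?a b J)) \<le> ?\<delta>" if "b < 2" for b
    unfolding large_prob[OF that] using wiring unfolding cD .
  have cardVV: "card wired_verts = (\<Sum>j\<le>h. 2 * m * 2 ^ j) * (l * card (piece_verts g))"
  proof -
    have "blocks m h = Sigma {..h} (\<lambda>j. {..<2 * m * 2 ^ j})" by (auto simp: blocks_def)
    hence "card (blocks m h) = (\<Sum>j\<le>h. 2 * m * 2 ^ j)" by simp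
    thus ?thesis unfolding wired_verts_block_verts card_UN_block_verts[OF finite_blocks] by simp
  qed
  obtain G :: "nat ugraph" where G: "enat g0 \<le> girth G" "card (verts G) = card (sites m h l) * card (piece_verts g)"
    "\<And>b. 0 < b \<Longrightarrow> (\<And>S. S \<subseteq> wired_verts \<Longrightarrow> 2 * card S \<le> card wired_verts \<Longrightarrow> b * real (card S) \<le> real (card (cut_bonds S))) \<Longrightarrow> regular_expander b d G"
    "\<And>p Q t. 0 \<le> p \<Longrightarrow> p \<le> 1 \<Longrightarrow> (\<And>J. J \<subseteq> bonds \<Longrightarrow> Q J \<Longrightarrow> two_large_sets J t) \<Longrightarrow>
      bond_mean p bonds (\<lambda>J. of_bool (Q J)) \<le> measure_pmf.prob (percolation G p) {H. t \<le> card (nth_component H 2)}"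
    by (rule nat_graph) (rule that; blast)
  have "0 < card (piece_verts g)" using finite_piece_verts[of g] id_piece_verts[of g] by (auto simp: card_gt_0_iff)
  hence C: "0 < real (l * card (piece_verts g))" using l by simp
  show thesis
  proof (rule that[of G])
    show "regular_expander (1 / (177 * real (l * card (piece_verts g)))) d G"
    proof (rule G(3))
      show "0 < 1 / (177 * real (l * card (piece_verts g)))" using C by simp
      fix S assume "S \<subseteq> wired_verts" "2 * card S \<le> card wired_verts"
      hence "real (card S) \<le> real (177 * (l * card (piece_verts g)) * card (cut_bonds S))"
        using cut_bound of_nat_le_iff by blast
      thus "1 / (177 * real (l * card (piece_verts g))) * real (card S) \<le> real (card (cut_bonds S))"
        using C by (simp add: field_simps)
    qed
    show "enat g0 \<le> girth G" by (rule G(1))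
    show "card (verts G) = (\<Sum>j\<le>h. 2 * m * 2 ^ j) * (l * card (piece_verts g))"
      using G(2) cardVV by (simp add: wired_verts_def card_cartesian_product)
    have "1 - real (2 * m * 2 ^ h) * ((1 - (1 - p)\<^sup>2) ^ (l - 1)) ^ Suc h - 2 * ?\<delta> \<le>
        bond_mean p bonds (\<lambda>J. of_bool (\<not> crossing J \<and> large K ?a 0 J \<and> large K ?a 1 J))"
      using event_prob[OF _ _ \<delta>] p by simp
    also have "\<dots> \<le> measure_pmf.prob (percolation G p) {H. nat \<lceil>?a\<rceil> \<le> card (nth_component H 2)}"
      by (rule G(4)) (use p two_comp_event[OF _ _ _ _ a] in auto)
    finally show "1 - real (2 * m * 2 ^ h) * ((1 - (1 - p)\<^sup>2) ^ (l - 1)) ^ Suc h - 2 * ?\<delta>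
     \<le> measure_pmf.prob (percolation G p) {H. nat \<lceil>?a\<rceil> \<le> card (nth_component H 2)}" .
  qed
  qed
  qed
qed

text \<open>As \<open>g0\<close> grows, ports become so rare that the growth rate approaches \<open>d - 1\<close>.\<close>

lemma growth_parameter_exists:
  fixes R p :: real
  assumes "3 \<le> d" "1 / (real d - 1) < p"
  obtains g0 where "2 \<le> g0" "R \<le> real g0" "1 < (real d - 1) * 2 powr (- 1 / (real g0 + 1)) * p"
proof -
  define q where "q = (real d - 1) * p"
  have q: "1 < q" using assms by (simp add: q_def field_simps)
  \<comment> \<open>This is the condition \<open>2 powr (1 / N) < q\<close>.\<close>
  obtain N where N: "2 < q ^ N" using real_arch_pow[OF q] by blast
  define g0 where "g0 = max 2 (max N (nat \<lceil>R\<rceil>))"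
  have g: "2 \<le> g0" "N \<le> g0 + 1" "R \<le> real g0" by (auto simp: g0_def) linarith
  define n where "n = g0 + 1"
  have n: "0 < n" "real g0 + 1 = real n" by (simp_all add: n_def)
  have "q ^ N \<le> q ^ n" using q g(2) by (intro power_increasing) (auto simp: n_def)
  hence "2 < q ^ n" using N by linarith
  hence "2 powr (1 / real n) < (q ^ n) powr (1 / real n)" using n by (intro powr_less_mono2) auto
  also have "\<dots> = q" using q n by (simp add: powr_powr flip: powr_realpow)
  finally have "2 powr (1 / real n) < q" .
  hence "1 < q * 2 powr (- 1 / real n)" by (simp add: powr_minus field_simps)
  thus thesis using that[of g0] g unfolding n(2)[symmetric] by (simp add: q_def mult_ac)
qed

theorem theorem2:
  fixes d :: nat and R p \<alpha> :: real
  assumes "d \<ge> 3"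
    and "R \<ge> 1"
    and "1 / (real d - 1) < p" and "p < 1"
    and "0 < \<alpha>" and "\<alpha> < 1"
  shows "\<exists>(b::real) > 0. \<exists>(c::real) > 0. \<exists>\<G> :: nat \<Rightarrow> nat ugraph.
    (\<forall>k. regular_expander b d (\<G> k) \<and> ereal R \<le> ereal_of_enat (girth (\<G> k))) \<and>
    filterlim (\<lambda>k. card (verts (\<G> k))) at_top sequentially \<and>
    (\<lambda>k. measure_pmf.prob (percolation (\<G> k) p)
        {G. real (card (nth_component G 2)) \<ge> c * real (card (verts (\<G> k))) powr \<alpha>})
      \<longlonglongrightarrow> 1"
proof -
  have "0 < 1 / (real d - 1)" using assms(1) by simp
  hence p: "0 < p" "p < 1" using assms(3,4) by linarith+
  obtain g0 where gg: "2 \<le> g0" "R \<le> real g0" "1 < (real d - 1) * 2 powr (- 1 / (real g0 + 1)) * p"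
    using growth_parameter_exists[OF assms(1,3)] by blast
  interpret tree_base d g0 by unfold_locales (use assms gg in auto)
  have "1 < growth * p" using gg(3) by (simp add: growth_def)
  then obtain \<theta>0 where \<theta>0: "\<theta>0 > 0" "\<And>K. \<exists>g. \<forall>x\<in>uports g. \<theta>0 \<le> bond_mean p (piece_edges g) (\<lambda>H. of_bool
    ((x, kappa g x) \<in> joined H \<and> K \<le> card {j\<in>uports g. (x, j) \<in> joined H \<and> (j, kappa g j) \<in> joined H}))"
    using piece_percolation[OF p] by blast
  define \<theta> where "\<theta> = min \<theta>0 1"
  have \<theta>: "0 < \<theta>" "\<theta> \<le> 1" "\<theta> \<le> \<theta>0" using \<theta>0(1) by (auto simp: \<theta>_def)
  define \<beta> where "\<beta> = (1 - p * \<theta> / 8) powr (\<theta> / 8)"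
  have p\<theta>: "0 < p * \<theta>" "p * \<theta> < 1"
    using p \<theta> mult_less_le_imp_less[of p 1 \<theta> 1] by auto
  have \<beta>: "0 < \<beta>" "\<beta> < 1"
  proof -
    show "0 < \<beta>" using p\<theta> by (simp add: \<beta>_def)
    have "(1 - p * \<theta> / 8) powr (\<theta> / 8) < 1 powr (\<theta> / 8)" using p\<theta> \<theta> by (intro powr_less_mono2) auto
    thus "\<beta> < 1" by (simp add: \<beta>_def)
  qed
  obtain K0 where K0: "2 < (1 / \<beta>) ^ K0" using real_arch_pow[of "1 / \<beta>" 2] \<beta> by auto
  \<comment> \<open>Three labels for the forest and \<open>21\<close> labels for the permutations at the top require \<open>24\<close> ports.\<close>
  define K where "K = max K0 24"
  have K: "0 < K" "24 \<le> K" "2 < (1 / \<beta>) ^ K"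
  proof -
    have "(1 / \<beta>) ^ K0 \<le> (1 / \<beta>) ^ K" using \<beta> by (intro power_increasing) (auto simp: K_def)
    thus "2 < (1 / \<beta>) ^ K" using K0 by linarith
  qed (auto simp: K_def)
  define \<rho> where "\<rho> = 2 powr (1 / real K) * \<beta>"
  have \<rho>: "0 < \<rho>" "\<rho> < 1"
  proof -
    show "0 < \<rho>" using \<beta> by (simp add: \<rho>_def)
    have "2 powr (1 / real K) < ((1 / \<beta>) ^ K) powr (1 / real K)" using K by (intro powr_less_mono2) auto
    also have "\<dots> = 1 / \<beta>" using \<beta> K by (simp add: powr_powr flip: powr_realpow)
    finally show "\<rho> < 1" using \<beta> by (simp add: \<rho>_def field_simps)
  qed
  obtain g where g: "\<And>x. x \<in> uports g \<Longrightarrow> \<theta>0 \<le> bond_mean p (piece_edges g) (\<lambda>H. of_bool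
    ((x, kappa g x) \<in> joined H \<and> K + 3 \<le> card {j\<in>uports g. (x, j) \<in> joined H \<and> (j, kappa g j) \<in> joined H}))"
    using \<theta>0(2)[of "K + 3"] by blast
  define D where "D = card (uports g)"
  have fin_u: "finite (uports g)" using finite_piece_verts by (simp add: uports_def)
  have D: "24 \<le> D"
  proof (rule ccontr)
    assume "\<not> 24 \<le> D"
    hence small: "card A < K + 3" if "A \<subseteq> uports g" for A
      using card_mono[OF fin_u that] K by (simp add: D_def)
    have "(id, id) \<in> uports g" using id_piece_verts by (simp add: uports_def)
    from g[OF this] have "\<theta>0 \<le> bond_mean p (piece_edges g) (\<lambda>H. 0)"
    proof (rule order_trans)
      show "bond_mean p (piece_edges g) (\<lambda>H. of_bool (((id, id), kappa g (id, id)) \<in> joined H \<and>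
          K + 3 \<le> card {j\<in>uports g. ((id, id), j) \<in> joined H \<and> (j, kappa g j) \<in> joined H})) \<le> bond_mean p (piece_edges g) (\<lambda>H. 0)"
        using p small[of "{j\<in>uports g. ((id, id), j) \<in> joined _ \<and> (j, kappa g j) \<in> joined _}"]
        by (intro bond_mean_mono) (auto simp: not_le)
    qed
    thus False using \<theta>0(1) finite_piece_edges by simp
  qed
  obtain lab where lab: "bij_betw lab {..<D} (uports g)"
    using ex_bij_betw_nat_finite[OF fin_u] by (auto simp: D_def atLeast0LessThan)
  interpret labelled d g0 g D lab by unfold_locales (rule lab)
  have good_labels: "\<theta> \<le> bond_mean p (piece_edges g) (\<lambda>H. of_bool (k \<in> good_labels K H))" if "k \<in> {3..<D}" for k
    using good_prob[of p k \<theta>0 K] that g p \<theta>(3) by fastforce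
  \<comment> \<open>The bottom has \<open>2 ^ (q * h)\<close> nodes, which is the power \<open>q / (q + 1) \<ge> \<alpha>\<close> of the number of nodes at the top.\<close>
  define q where "q = nat \<lceil>\<alpha> / (1 - \<alpha>)\<rceil>"
  have q: "1 \<le> q" "\<alpha> * (real q + 1) \<le> real q"
  proof -
    have "0 < \<alpha> / (1 - \<alpha>)" using assms by simp
    thus "1 \<le> q" unfolding q_def by linarith
    have "\<alpha> / (1 - \<alpha>) \<le> real q" unfolding q_def by linarith
    thus "\<alpha> * (real q + 1) \<le> real q" using assms by (simp add: field_simps)
  qed
  define \<gamma> where "\<gamma> = 1 - (1 - p)\<^sup>2"
  have \<gamma>: "0 \<le> \<gamma>" "\<gamma> < 1" using p by (auto simp: \<gamma>_def power_le_one)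
  \<comment> \<open>There are about \<open>2 ^ ((q + 1) * h)\<close> paths from the top to the bottom, and each consists of more than \<open>h\<close> chains.\<close>
  obtain r where r: "\<gamma> ^ r < 1 / 2 ^ (q + 2)" using real_arch_pow_inv[of "1 / 2 ^ (q + 2)" \<gamma>] \<gamma> by auto
  define l where "l = r + 2"
  have l: "2 \<le> l" "\<gamma> ^ (l - 1) \<le> 1 / 2 ^ (q + 2)"
  proof -
    have "\<gamma> ^ (l - 1) \<le> \<gamma> ^ r" using \<gamma> by (intro power_decreasing) (auto simp: l_def)
    thus "\<gamma> ^ (l - 1) \<le> 1 / 2 ^ (q + 2)" using r by linarith
  qed (simp add: l_def)
  define C where "C = real (l * card (piece_verts g))"
  have C: "1 \<le> C"
  proof -
    have "0 < card (piece_verts g)" using finite_piece_verts[of g] id_piece_verts[of g] by (auto simp: card_gt_0_iff)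
    hence "0 < l * card (piece_verts g)" using l by simp
    thus ?thesis unfolding C_def by linarith
  qed
  define M :: "nat \<Rightarrow> nat" where "M k = 2 ^ (q * Suc k)" for k
  define b where "b = 1 / (177 * C)"
  define c where "c = \<theta> / (32 * C)"
  define err where "err k = 2 * (1 / 2) ^ Suc k + 2 * (4 / (\<theta>\<^sup>2 * M k) + \<rho> ^ Suc k)" for k :: nat
  have M_ge: "Suc k \<le> M k" for k
  proof -
    have "Suc k \<le> q * Suc k" using mult_le_mono1[OF q(1), of "Suc k"] by simp
    also have "\<dots> \<le> 2 ^ (q * Suc k)" by (rule less_imp_le, rule less_exp)
    finally show ?thesis by (simp add: M_def)
  qed
  have main: "\<exists>G :: nat ugraph. regular_expander b d G \<and> ereal R \<le> ereal_of_enat (girth G) \<and> k \<le> card (verts G) \<and>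
      1 - err k \<le> measure_pmf.prob (percolation G p) {H. real (card (nth_component H 2)) \<ge> c * real (card (verts G)) powr \<alpha>}" for k
  proof -
    let ?u = "Suc k" and ?w = "real (M k * (D - 3))"
    have m: "1 \<le> M k" by (simp add: M_def)
    obtain G :: "nat ugraph" where G: "regular_expander (1 / (177 * real (l * card (piece_verts g)))) d G" "enat g0 \<le> girth G"
      "card (verts G) = (\<Sum>j\<le>?u. 2 * M k * 2 ^ j) * (l * card (piece_verts g))"
      "1 - real (2 * M k * 2 ^ ?u) * ((1 - (1 - p)\<^sup>2) ^ (l - 1)) ^ Suc ?u
         - 2 * (4 / (\<theta>\<^sup>2 * M k) + 2 powr (?w / K) * (1 - p * \<theta> / 8) powr (\<theta> * ?w / 8))
       \<le> measure_pmf.prob (percolation G p) {H. nat \<lceil>\<theta> * ?w / 8\<rceil> \<le> card (nth_component H 2)}"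
      by (rule expander_with_two_large_clusters[OF p \<theta>(1,2) K(1) D m _ l(1) good_labels, of ?u]) (simp, assumption, erule (3) that)
    have sum2: "(\<Sum>j\<le>n. 2 ^ j) \<le> (2::nat) * 2 ^ n" for n by (induction n) auto
    have nV: "real (card (verts G)) \<le> 4 * C * (real (M k) * 2 ^ ?u)"
    proof -
      have "(\<Sum>j\<le>?u. 2 * M k * 2 ^ j) = 2 * M k * (\<Sum>j\<le>?u. 2 ^ j)" by (simp only: sum_distrib_left)
      also have "\<dots> \<le> 2 * M k * (2 * 2 ^ ?u)" by (intro mult_left_mono sum2) simp
      finally have "card (verts G) \<le> 2 * M k * (2 * 2 ^ ?u) * (l * card (piece_verts g))"
        unfolding G(3) by (rule mult_right_mono) simp
      hence "real (card (verts G)) \<le> real (2 * M k * (2 * 2 ^ ?u) * (l * card (piece_verts g)))" by (rule of_nat_mono)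
      also have "\<dots> = 4 * C * (real (M k) * 2 ^ ?u)" by (simp add: C_def)
      finally show ?thesis .
    qed
    have girth: "ereal R \<le> ereal_of_enat (girth G)"
    proof -
      have "ereal R \<le> ereal_of_enat (enat g0)" using gg(2) by simp
      also have "\<dots> \<le> ereal_of_enat (girth G)" using G(2) by (simp only: ereal_of_enat_le_iff)
      finally show ?thesis .
    qed
    have size: "k \<le> card (verts G)"
    proof -
      have "M k \<le> (\<Sum>j\<in>{0}. 2 * M k * 2 ^ j)" by simp
      also have "\<dots> \<le> (\<Sum>j\<le>?u. 2 * M k * 2 ^ j)" by (intro sum_mono2) auto
      also have "\<dots> \<le> (\<Sum>j\<le>?u. 2 * M k * 2 ^ j) * (l * card (piece_verts g))"
        using mult_le_mono2[of 1 "l * card (piece_verts g)" "\<Sum>j\<le>?u. 2 * M k * 2 ^ j"] C unfolding C_def by linarith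
      finally show ?thesis using M_ge[of k] G(3) by linarith
    qed
    have w: "real (M k) \<le> ?w" "real ?u \<le> ?w"
    proof -
      have "M k * 1 \<le> M k * (D - 3)" using D by (intro mult_left_mono) auto
      thus "real (M k) \<le> ?w" "real ?u \<le> ?w" using M_ge[of k] by (simp_all only: of_nat_le_iff)
    qed
    have big: "c * real (card (verts G)) powr \<alpha> \<le> \<theta> * ?w / 8"
    proof -
      have "real (card (verts G)) powr \<alpha> \<le> (4 * C * (real (M k) * 2 ^ ?u)) powr \<alpha>"
        using nV assms by (intro powr_mono2) auto
      also have "\<dots> = (4 * C) powr \<alpha> * (2 ^ ((q + 1) * ?u)) powr \<alpha>"
      proof -
        have "q * ?u + ?u = (q + 1) * ?u" by (simp add: algebra_simps)
        hence "real (M k) * 2 ^ ?u = 2 ^ ((q + 1) * ?u)"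
          by (simp only: M_def of_nat_power of_nat_numeral power_add[symmetric])
        moreover have "0 \<le> 4 * C" using C by simp
        ultimately show ?thesis by (simp only:) (rule powr_mult; simp)
      qed
      also have "\<dots> \<le> (4 * C) * 2 ^ (q * ?u)"
      proof (intro mult_mono)
        have "(4 * C) powr \<alpha> \<le> (4 * C) powr 1" using C assms by (intro powr_mono) auto
        thus "(4 * C) powr \<alpha> \<le> 4 * C" using C by simp
        have pw: "((2::real) ^ n) powr \<alpha> = 2 powr (real n * \<alpha>)" for n :: nat
          by (simp add: powr_powr flip: powr_realpow)
        have "(2 ^ ((q + 1) * ?u)) powr \<alpha> = 2 powr (real ((q + 1) * ?u) * \<alpha>)" by (rule pw)
        also have "\<dots> \<le> 2 powr real (q * ?u)"
        proof (rule powr_mono)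
          have "real ((q + 1) * ?u) * \<alpha> = (\<alpha> * (real q + 1)) * real ?u"
            by (simp only: of_nat_mult of_nat_add of_nat_1 mult_ac)
          also have "\<dots> \<le> real q * real ?u" by (rule mult_right_mono[OF q(2)]) simp
          also have "\<dots> = real (q * ?u)" by (simp only: of_nat_mult)
          finally show "real ((q + 1) * ?u) * \<alpha> \<le> real (q * ?u)" .
        qed simp
        also have "\<dots> = 2 ^ (q * ?u)" by (rule powr_realpow) simp
        finally show "(2 ^ ((q + 1) * ?u)) powr \<alpha> \<le> (2::real) ^ (q * ?u)" .
      qed (use C in auto)
      also have "\<dots> = 4 * C * real (M k)" by (simp add: M_def)
      finally have "c * real (card (verts G)) powr \<alpha> \<le> c * (4 * C * real (M k))"
        using \<theta> C by (intro mult_left_mono) (auto simp: c_def)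
      also have "\<dots> = \<theta> * real (M k) / 8" using C by (simp add: c_def)
      also have "\<dots> \<le> \<theta> * ?w / 8" using w \<theta> by (intro divide_right_mono mult_left_mono) auto
      finally show ?thesis .
    qed
    have "real (2 * M k * 2 ^ ?u) * (\<gamma> ^ (l - 1)) ^ Suc ?u \<le> 2 * (1 / 2) ^ ?u"
    proof -
      have "real (2 * M k * 2 ^ ?u) * (\<gamma> ^ (l - 1)) ^ Suc ?u \<le> real (2 * M k * 2 ^ ?u) * (1 / 2 ^ (q + 2)) ^ Suc ?u"
        using l(2) \<gamma> by (intro mult_left_mono power_mono) auto
      also have "\<dots> \<le> real (2 * M k * 2 ^ ?u) * (1 / 2 ^ (q + 2)) ^ ?u"
        using one_le_power[of "2::real" "q + 2"] by (intro mult_left_mono power_decreasing) auto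
      also have "\<dots> = 2 * (1 / 2) ^ ?u"
      proof -
        have "(2::real) ^ ((q + 2) * ?u) = 2 ^ (q * ?u) * (2 ^ ?u * 2 ^ ?u)"
          by (simp add: algebra_simps flip: power_add)
        hence "(1 / 2 ^ (q + 2)) ^ ?u = 1 / (2 ^ (q * ?u) * (2 ^ ?u * (2::real) ^ ?u))"
          by (simp only: power_divide power_one power_mult[symmetric])
        thus ?thesis by (simp only: M_def of_nat_mult of_nat_power of_nat_numeral) (simp add: power_divide)
      qed
      finally show ?thesis .
    qed
    note cross = this
    have large: "2 powr (?w / K) * (1 - p * \<theta> / 8) powr (\<theta> * ?w / 8) \<le> \<rho> ^ ?u"
    proof -
      have "2 powr (?w / K) * (1 - p * \<theta> / 8) powr (\<theta> * ?w / 8) = (2 powr (1 / real K)) powr ?w * \<beta> powr ?w"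
        by (simp add: \<beta>_def powr_powr)
      also have "\<dots> = \<rho> powr ?w" using \<beta> by (simp add: \<rho>_def powr_mult)
      also have "\<dots> \<le> \<rho> powr real ?u" by (rule powr_mono'[OF w(2)]) (use \<rho> in auto)
      also have "\<dots> = \<rho> ^ ?u" by (rule powr_realpow[OF \<rho>(1)])
      finally show ?thesis .
    qed
    have arith: "1 - (x' + 2 * (e + y')) \<le> P" if "x \<le> x'" "y \<le> y'" "1 - x - 2 * (e + y) \<le> P"
      for x x' y y' e P :: real using that by (simp add: algebra_simps)
    have "1 - err k \<le> measure_pmf.prob (percolation G p) {H. nat \<lceil>\<theta> * ?w / 8\<rceil> \<le> card (nth_component H 2)}"
      unfolding err_def by (rule arith[OF cross large G(4)[folded \<gamma>_def]])
    also have "\<dots> \<le> measure_pmf.prob (percolation G p) {H. real (card (nth_component H 2)) \<ge> c * real (card (verts G)) powr \<alpha>}"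
    proof (rule measure_pmf.finite_measure_mono)
      show "{H. nat \<lceil>\<theta> * ?w / 8\<rceil> \<le> card (nth_component H 2)} \<subseteq> {H. real (card (nth_component H 2)) \<ge> c * real (card (verts G)) powr \<alpha>}"
        using big by auto
    qed simp
    finally show ?thesis using G(1) girth size unfolding b_def C_def by blast
  qed
  then obtain \<G> :: "nat \<Rightarrow> nat ugraph" where \<G>: "\<And>k. regular_expander b d (\<G> k)" "\<And>k. ereal R \<le> ereal_of_enat (girth (\<G> k))"
    "\<And>k. k \<le> card (verts (\<G> k))"
    "\<And>k. 1 - err k \<le> measure_pmf.prob (percolation (\<G> k) p) {H. real (card (nth_component H 2)) \<ge> c * real (card (verts (\<G> k))) powr \<alpha>}"
    by metis
  have M_lim: "filterlim (\<lambda>k. real (M k)) at_top sequentially"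
  proof (rule filterlim_at_top_mono[OF filterlim_real_sequentially])
    show "\<forall>\<^sub>F k in sequentially. real k \<le> real (M k)"
      using M_ge by (intro always_eventually allI) (meson Suc_leD of_nat_le_iff)
  qed
  have "(\<lambda>k. 1 - err k) \<longlonglongrightarrow> 1 - (2 * 0 + 2 * (0 + 0))"
    unfolding err_def
  proof (intro tendsto_intros)
    show "(\<lambda>k. (1 / 2 :: real) ^ Suc k) \<longlonglongrightarrow> 0" by (intro LIMSEQ_Suc LIMSEQ_realpow_zero) auto
    show "(\<lambda>k. \<rho> ^ Suc k) \<longlonglongrightarrow> 0" using \<rho> by (intro LIMSEQ_Suc LIMSEQ_realpow_zero) auto
    have "filterlim (\<lambda>k. \<theta>\<^sup>2 * real (M k)) at_top sequentially"
      using \<theta> by (intro filterlim_tendsto_pos_mult_at_top[OF tendsto_const _ M_lim]) auto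
    thus "(\<lambda>k. 4 / (\<theta>\<^sup>2 * real (M k))) \<longlonglongrightarrow> 0"
      by (intro tendsto_divide_0[OF tendsto_const] filterlim_at_top_imp_at_infinity)
  qed
  hence err: "(\<lambda>k. 1 - err k) \<longlonglongrightarrow> 1" by simp
  have "(\<lambda>k. measure_pmf.prob (percolation (\<G> k) p) {H. real (card (nth_component H 2)) \<ge> c * real (card (verts (\<G> k))) powr \<alpha>}) \<longlonglongrightarrow> 1"
  proof (rule tendsto_sandwich[OF _ _ err tendsto_const])
    show "\<forall>\<^sub>F k in sequentially. 1 - err k \<le> measure_pmf.prob (percolation (\<G> k) p)
        {H. real (card (nth_component H 2)) \<ge> c * real (card (verts (\<G> k))) powr \<alpha>}"
      by (intro always_eventually allI \<G>(4))
    show "\<forall>\<^sub>F k in sequentially. measure_pmf.prob (percolation (\<G> k) p)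
        {H. real (card (nth_component H 2)) \<ge> c * real (card (verts (\<G> k))) powr \<alpha>} \<le> 1"
      by (intro always_eventually allI measure_pmf.prob_le_1)
  qed
  moreover have "filterlim (\<lambda>k. card (verts (\<G> k))) at_top sequentially"
    by (rule filterlim_at_top_mono[OF filterlim_ident]) (use \<G>(3) in auto)
  moreover have "0 < b" "0 < c" using C \<theta> by (auto simp: b_def c_def)
  ultimately show ?thesis using \<G>(1,2) by blast
qed

end
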